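(* In the setting of the context, assume that, as $n\to\infty$, (1) $\Lambda_{\max}(\Sigma_Y)+1/\Lambda_{\min}(\Sigma_Y)=O_p(1)$; (2) $s(\Theta_Y)=O_p(s_n)$ for some sequence $s_n\in[1,\infty)$, $n=1,2,\dots$. Let $(\lambda_n)_{n\ge1}$ be a sequence of positive-valued random variables such that $\lambda_n^{-1}\|\hat\Sigma_n-\Sigma_Y\|_{\ell_\infty}\to^p0$ and $s_n\lambda_n\to^p0$ as $n\to\infty$. Then $$\lambda_n^{-1}\|\hat K_{\lambda_n}-K_Y\|_{\ell_2}=O_p(\sqrt{s_n}),\qquad\lambda_n^{-1}|||\hat K_{\lambda_n}-K_Y|||_w=O_p(s_n)$$ and $$\lambda_n^{-1}|||\hat\Theta_{\lambda_n}-\Theta_Y|||_w=O_p(s_n),\qquad\lambda_n^{-1}|||\hat\Theta_{\lambda_n}^{-1}-\Sigma_Y|||_2=O_p(s_n)$$ as $n\to\infty$ for any $w\in[1,\infty]$.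
   Context: All objects (the probability space, the dimension $d=d_n\ge2$, the process $Y$, etc.) may depend on $n\in\mathbb{N}$; the index is suppressed; $O_p$, $\to^p$ are as $n\to\infty$. $Y=(Y_t)_{t\in[0,1]}$ is a $d$-dimensional semimartingale, $\Sigma_Y=[Y,Y]_1$ its quadratic covariation matrix at time 1, assumed a.s. invertible, and $\Theta_Y=\Sigma_Y^{-1}$. $\hat\Sigma_n$ is a random variable with values in the $d\times d$ positive semidefinite matrices, all of whose diagonal entries are a.s. positive (an estimator of $\Sigma_Y$, otherwise arbitrary). $\|A\|_{\ell_w}$ is the entrywise $\ell_w$ norm ($\|A\|_{\ell_\infty}=\max_{i,j}|A^{ij}|$, $\|A\|_{\ell_2}$ = Frobenius norm); $|||A|||_w=\sup\{\|Ax\|_{\ell_w}:\|x\|_{\ell_w}=1\}$. $\Lambda_{\max},\Lambda_{\min}$: largest/smallest eigenvalue. $\mathcal{S}_d^{++}$: positive definite $d\times d$ matrices. $\mathrm{diag}(A)$: diagonal matrix with the diagonal of $A$; $A^-=A-\mathrm{diag}(A)$. For symmetric $A$, $s(A)=\#\{(i,j):i\ne j,A^{ij}\ne0\}$. Let $\hat V_n=\mathrm{diag}(\hat\Sigma_n)^{1/2}$, $\hat R_n=\hat V_n^{-1}\hat\Sigma_n\hat V_n^{-1}$. For $\lambda>0$ (possibly random) the weighted graphical Lasso estimator is $$\hat\Theta_\lambda=\arg\min_{\Theta\in\mathcal{S}_d^{++}}\Big\{\mathrm{tr}(\Theta\hat\Sigma_n)-\log\det\Theta+\lambda\sum_{i\ne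 j}\hat V_n^{ii}\hat V_n^{jj}|\Theta^{ij}|\Big\}$$ and $$\hat K_\lambda=\arg\min_{K\in\mathcal{S}_d^{++}}\big\{\mathrm{tr}(K\hat R_n)-\log\det K+\lambda\|K^-\|_{\ell_1}\big\};$$ both minimizers exist and are unique a.s., and $\hat\Theta_\lambda=\hat V_n^{-1}\hat K_\lambda\hat V_n^{-1}$. Further, $V_Y=\mathrm{diag}(\Sigma_Y)^{1/2}$, $R_Y=V_Y^{-1}\Sigma_YV_Y^{-1}$ and $K_Y=R_Y^{-1}$. *)

theory Defs
  imports
    "HOL-Probability.Probability"
    "Jordan_Normal_Form.Gauss_Jordan_Elimination"
    "Jordan_Normal_Form.Spectral_Radius"
begin

text \<open>Outer measures agree with the probabilities whenever the events are measurable; they keep the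
  definitions from being vacuous for quantities whose measurability has not been established.\<close>

definition big_O_prob :: "(nat \<Rightarrow> 'a measure) \<Rightarrow> (nat \<Rightarrow> 'a \<Rightarrow> real) \<Rightarrow> (nat \<Rightarrow> real) \<Rightarrow> bool" where
  "big_O_prob M X a \<longleftrightarrow>
     (\<forall>\<epsilon>>0. \<exists>C>0. \<forall>\<^sub>F n in sequentially.
        outer_measure_of (M n) {\<omega> \<in> space (M n). \<bar>X n \<omega>\<bar> > C * a n} \<le> ennreal \<epsilon>)"

definition tendsto_prob_0 :: "(nat \<Rightarrow> 'a measure) \<Rightarrow> (nat \<Rightarrow> 'a \<Rightarrow> real) \<Rightarrow> bool" where
  "tendsto_prob_0 M X \<longleftrightarrow>
     (\<forall>\<epsilon>>0. (\<lambda>n. outer_measure_of (M n) {\<omega> \<in> space (M n). \<bar>X n \<omega>\<bar> > \<epsilon>}) \<longlonglongrightarrow> 0)"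

text \<open>All processes live on the time interval [0,1]. Filtrations are indexed by all reals, but only
  the times in [0,1] matter: a filtration on [0,1] can be extended to be constant on both sides.\<close>

definition stochastic_basis :: "'a measure \<Rightarrow> (real \<Rightarrow> 'a measure) \<Rightarrow> bool" where
  "stochastic_basis M F \<longleftrightarrow>
     prob_space M \<and> filtration (space M) F \<and> (\<forall>t. subalgebra M (F t))"

definition adapted :: "(real \<Rightarrow> 'a measure) \<Rightarrow> (real \<Rightarrow> 'a \<Rightarrow> real) \<Rightarrow> bool" where
  "adapted F X \<longleftrightarrow> (\<forall>t\<in>{0..1}. X t \<in> borel_measurable (F t))"

definition cadlag :: "(real \<Rightarrow> real) \<Rightarrow> bool" where
  "cadlag f \<longleftrightarrow>
     (\<forall>t\<in>{0..<1}. (f \<longlongrightarrow> f t) (at_right t)) \<and> (\<forall>t\<in>{0<..1}. \<exists>l. (f \<longlongrightarrow> l) (at_left t))"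

definition bounded_variation :: "(real \<Rightarrow> real) \<Rightarrow> bool" where
  "bounded_variation f \<longleftrightarrow>
     (\<exists>B. \<forall>k t. t ` {..k} \<subseteq> {0..1} \<and> mono_on {..k} t
        \<longrightarrow> (\<Sum>i<(k::nat). \<bar>f (t (Suc i)) - f (t i)\<bar>) \<le> B)"

definition martingale :: "'a measure \<Rightarrow> (real \<Rightarrow> 'a measure) \<Rightarrow> (real \<Rightarrow> 'a \<Rightarrow> real) \<Rightarrow> bool" where
  "martingale M F X \<longleftrightarrow>
     adapted F X \<and> (\<forall>t\<in>{0..1}. integrable M (X t)) \<and>
     (\<forall>s t. 0 \<le> s \<and> s \<le> t \<and> t \<le> 1 \<longrightarrow> (AE \<omega> in M. real_cond_exp M (F s) (X t) \<omega> = X s \<omega>))"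

text \<open>On the compact time interval, a localizing sequence has to reach the terminal time after
  finitely many steps; increasing to 1 would only give a local martingale on [0,1).\<close>

definition local_martingale :: "'a measure \<Rightarrow> (real \<Rightarrow> 'a measure) \<Rightarrow> (real \<Rightarrow> 'a \<Rightarrow> real) \<Rightarrow> bool" where
  "local_martingale M F X \<longleftrightarrow>
     adapted F X \<and> (AE \<omega> in M. cadlag (\<lambda>t. X t \<omega>)) \<and>
     (\<exists>\<tau> :: nat \<Rightarrow> 'a \<Rightarrow> real.
        (\<forall>k. stopping_time F (\<tau> k)) \<and>
        (\<forall>k. \<forall>\<omega>\<in>space M. 0 \<le> \<tau> k \<omega> \<and> \<tau> k \<omega> \<le> \<tau> (Suc k) \<omega> \<and> \<tau> k \<omega> \<le> 1) \<and>
        (AE \<omega> in M. \<forall>\<^sub>F k in sequentially. \<tau> k \<omega> = 1) \<and>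
        (\<forall>k. martingale M F (\<lambda>t \<omega>. X (min t (\<tau> k \<omega>)) \<omega>)))"

definition finite_variation_process :: "'a measure \<Rightarrow> (real \<Rightarrow> 'a measure) \<Rightarrow> (real \<Rightarrow> 'a \<Rightarrow> real) \<Rightarrow> bool" where
  "finite_variation_process M F X \<longleftrightarrow>
     adapted F X \<and> (AE \<omega> in M. cadlag (\<lambda>t. X t \<omega>) \<and> bounded_variation (\<lambda>t. X t \<omega>))"

definition semimartingale :: "'a measure \<Rightarrow> (real \<Rightarrow> 'a measure) \<Rightarrow> (real \<Rightarrow> 'a \<Rightarrow> real) \<Rightarrow> bool" where
  "semimartingale M F X \<longleftrightarrow>
     adapted F X \<and>
     (\<exists>N A. local_martingale M F N \<and> finite_variation_process M F A \<and>
        (\<forall>\<omega>\<in>space M. N 0 \<omega> = 0 \<and> A 0 \<omega> = 0) \<and>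
        (AE \<omega> in M. \<forall>t\<in>{0..1}. X t \<omega> = X 0 \<omega> + N t \<omega> + A t \<omega>))"

definition unit_partition :: "nat \<Rightarrow> (nat \<Rightarrow> real) \<Rightarrow> bool" where
  "unit_partition k t \<longleftrightarrow> t 0 = 0 \<and> t k = 1 \<and> (\<forall>i<k. t i < t (Suc i))"

definition mesh :: "nat \<Rightarrow> (nat \<Rightarrow> real) \<Rightarrow> real" where
  "mesh k t = Max ((\<lambda>i. t (Suc i) - t i) ` {..<k})"

text \<open>\<open>C\<close> is a version of the quadratic covariation of \<open>X\<close> and \<open>Y\<close> at time 1, the limit in
  probability of the realized covariations along every sequence of partitions of [0,1] with vanishing
  mesh. It determines \<open>C\<close> almost surely.\<close>

definition quadratic_covariation ::
  "'a measure \<Rightarrow> (real \<Rightarrow> 'a \<Rightarrow> real) \<Rightarrow> (real \<Rightarrow> 'a \<Rightarrow> real) \<Rightarrow> ('a \<Rightarrow> real) \<Rightarrow> bool" where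
  "quadratic_covariation M X Y C \<longleftrightarrow>
     C \<in> borel_measurable M \<and>
     (\<forall>k t. (\<forall>m. unit_partition (k m) (t m)) \<and> (\<lambda>m. mesh (k m) (t m)) \<longlonglongrightarrow> 0 \<longrightarrow>
        tendsto_prob_0 (\<lambda>_. M)
          (\<lambda>m \<omega>. (\<Sum>i<k m. (X (t m (Suc i)) \<omega> - X (t m i) \<omega>) * (Y (t m (Suc i)) \<omega> - Y (t m i) \<omega>))
                   - C \<omega>))"

definition pos_semidef :: "nat \<Rightarrow> real mat \<Rightarrow> bool" where
  "pos_semidef d A \<longleftrightarrow> A \<in> carrier_mat d d \<and> transpose_mat A = A \<and>
     (\<forall>x\<in>carrier_vec d. scalar_prod x (A *\<^sub>v x) \<ge> 0)"

definition pos_def :: "nat \<Rightarrow> real mat \<Rightarrow> bool" where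
  "pos_def d A \<longleftrightarrow> A \<in> carrier_mat d d \<and> transpose_mat A = A \<and>
     (\<forall>x\<in>carrier_vec d. x \<noteq> 0\<^sub>v d \<longrightarrow> scalar_prod x (A *\<^sub>v x) > 0)"

definition random_matrix :: "'a measure \<Rightarrow> nat \<Rightarrow> ('a \<Rightarrow> real mat) \<Rightarrow> bool" where
  "random_matrix M d A \<longleftrightarrow> (\<forall>\<omega>\<in>space M. A \<omega> \<in> carrier_mat d d) \<and>
     (\<forall>i<d. \<forall>j<d. (\<lambda>\<omega>. A \<omega> $$ (i,j)) \<in> borel_measurable M)"

definition mat_trace :: "real mat \<Rightarrow> real" where
  "mat_trace A = (\<Sum>i<dim_row A. A $$ (i,i))"

text \<open>Meaningful for invertible matrices only.\<close>

definition minv :: "real mat \<Rightarrow> real mat" where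
  "minv A = the (mat_inverse A)"

definition eig_max :: "real mat \<Rightarrow> real" where "eig_max A = Max (spectrum A)"

definition eig_min :: "real mat \<Rightarrow> real" where "eig_min A = Min (spectrum A)"

definition lw_norm :: "ereal \<Rightarrow> 'i set \<Rightarrow> ('i \<Rightarrow> real) \<Rightarrow> real" where
  "lw_norm w I f =
     (if w = \<infinity> then Max ((\<lambda>i. \<bar>f i\<bar>) ` I)
      else (\<Sum>i\<in>I. \<bar>f i\<bar> powr real_of_ereal w) powr (1 / real_of_ereal w))"

definition vec_lw_norm :: "ereal \<Rightarrow> real Matrix.vec \<Rightarrow> real" where
  "vec_lw_norm w x = lw_norm w {..<dim_vec x} (vec_index x)"

definition mat_lw_norm :: "ereal \<Rightarrow> real mat \<Rightarrow> real" where
  "mat_lw_norm w A = lw_norm w ({..<dim_row A} \<times> {..<dim_col A}) (\<lambda>ij. A $$ ij)"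

definition mat_op_norm :: "ereal \<Rightarrow> real mat \<Rightarrow> real" where
  "mat_op_norm w A =
     Sup {vec_lw_norm w (A *\<^sub>v x) | x. x \<in> carrier_vec (dim_col A) \<and> vec_lw_norm w x = 1}"

definition diag_part :: "real mat \<Rightarrow> real mat" where
  "diag_part A = mat_diag (dim_row A) (\<lambda>i. A $$ (i,i))"

definition off_diag :: "real mat \<Rightarrow> real mat" where
  "off_diag A = A - diag_part A"

definition diag_sqrt :: "real mat \<Rightarrow> real mat" where
  "diag_sqrt A = mat_diag (dim_row A) (\<lambda>i. sqrt (A $$ (i,i)))"

definition correlation :: "real mat \<Rightarrow> real mat" where
  "correlation A = minv (diag_sqrt A) * A * minv (diag_sqrt A)"

definition off_diag_support_size :: "real mat \<Rightarrow> nat" where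
  "off_diag_support_size A =
     card {(i,j). i < dim_row A \<and> j < dim_col A \<and> i \<noteq> j \<and> A $$ (i,j) \<noteq> 0}"

text \<open>The argument \<open>S\<close> is the covariance estimate and \<open>l\<close> the penalty level.\<close>

definition Theta_hat :: "real mat \<Rightarrow> real \<Rightarrow> real mat" where
  "Theta_hat S l =
     (let d = dim_row S; V = diag_sqrt S in
      arg_min
        (\<lambda>\<Theta>. mat_trace (\<Theta> * S) - ln (Determinant.det \<Theta>)
             + l * (\<Sum>(i,j) \<in> {(i,j). i < d \<and> j < d \<and> i \<noteq> j}. V $$ (i,i) * V $$ (j,j) * \<bar>\<Theta> $$ (i,j)\<bar>))
        (pos_def d))"

definition K_hat :: "real mat \<Rightarrow> real \<Rightarrow> real mat" where
  "K_hat S l =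
     arg_min
       (\<lambda>K. mat_trace (K * correlation S) - ln (Determinant.det K) + l * mat_lw_norm 1 (off_diag K))
       (pos_def (dim_row S))"

end

theory Submission
  imports Defs
begin

text \<open>Whenever the spectrum of the covariance matrix, the sparsity of its inverse, the estimation error
  of the covariance estimate and the penalty are under control, all bounds hold deterministically. The
  objective at the estimator is at most its value at \<open>K\<^sub>Y\<close>. Strong concavity of \<open>log det\<close>, read off
  the eigenvalues of \<open>K\<^sub>Y\<close> and the estimator after simultaneous diagonalization, bounds a quadratic
  function of the error by linear terms. Since both correlation matrices have unit diagonal, the
  linear terms involve only off-diagonal entries; the penalty absorbs the error off the support of
  \<open>K\<^sub>Y\<close>, and Cauchy-Schwarz on the support gives the Frobenius and \<open>\<ell>\<^sub>1\<close> rates. All operator norms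
  of a symmetric matrix are bounded by its maximal absolute row sum, where the diagonal contributes
  only its largest entry and the off-diagonal part its \<open>\<ell>\<^sub>1\<close> norm. The bounds hold for every minimizer
  of the objective, so rescaling transfers them to the covariance scale without a uniqueness
  argument.\<close>

section \<open>The spectral theorem for real symmetric matrices\<close>

unbundle no vec_syntax and no inner_syntax

text \<open>Strong concavity is used globally. A purely quadratic loss cannot hold for all
  eigenvalues, because \<open>(c - 1) - ln c\<close> grows only linearly. The loss
  \<open>x\<^sup>2 / (2 * (1 + x))\<close> is quadratic near zero and linear far away, and a small
  penalty then excludes large \<open>x\<close> at once, with no restriction to a ball around the
  truth. The estimators are values of the choice operator \<open>arg_min\<close>, so nothing is
  known about them before a minimizer is shown to exist. The estimated correlation matrix may be
  singular; coercivity comes from the penalty combined with the unit diagonal. The covariance matrix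
  is given through entrywise limits in probability, so its symmetry and positive semidefiniteness
  are derived almost surely from realized covariations. The constant \<open>C\<close> is fixed by
  the probability level, and every estimate is made polynomial in it. The tolerance
  \<open>300 * C ^ 8\<close> serves all smallness conditions, the sharpest being
  \<open>264 * C ^ 8\<close>, which keeps the eigenvalues of the precision estimate above
  \<open>1 / (2 * C)\<close>. All rates share the factor \<open>300 * C ^ 9\<close>.\<close>

lemma scalar_prod_self_eq_sum:
  fixes x :: "real Matrix.vec"
  assumes "x \<in> carrier_vec n"
  shows "x \<bullet> x = (\<Sum>i<n. (x $ i)\<^sup>2)"
  using assms by (simp add: scalar_prod_def lessThan_atLeast0 power2_eq_square)

lemma scalar_prod_self_pos:
  fixes x :: "real Matrix.vec"
  assumes x: "x \<in> carrier_vec n" "x \<noteq> 0\<^sub>v n"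
  shows "x \<bullet> x > 0"
proof -
  obtain k where k: "k < n" "x $ k \<noteq> 0" using x by (metis carrier_vecD eq_vecI index_zero_vec)
  have "(x $ k)\<^sup>2 \<le> x \<bullet> x" unfolding scalar_prod_self_eq_sum[OF x(1)]
    by (rule member_le_sum) (use k in auto)
  thus ?thesis using k by (smt (verit) zero_less_power2)
qed

lemma mult_mat_unit_vec:
  fixes A :: "'a :: semiring_1 mat"
  assumes "A \<in> carrier_mat nr nc" "i < nc"
  shows "A *\<^sub>v unit_vec nc i = col A i"
  using assms by (intro eq_vecI) (auto simp: scalar_prod_def unit_vec_def if_distrib[of "\<lambda>x. _ * x"] cong: if_cong)

text \<open>Over the complex numbers an eigenvector \<open>w\<close> with eigenvalue
  \<open>z\<close> exists. Its Hermitian form \<open>q\<close> equals \<open>z\<close> times the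
  squared norm of \<open>w\<close>, and symmetry makes \<open>q\<close> self-conjugate, so
  \<open>z\<close> is real and is a root of the real characteristic polynomial.\<close>

lemma real_symmetric_eigenvalue_exists:
  fixes A :: "real mat"
  assumes A: "A \<in> carrier_mat n n" and sym: "transpose_mat A = A" and n: "n > 0"
  shows "\<exists>e. eigenvalue A e"
proof -
  let ?A = "map_mat complex_of_real A"
  have cA: "?A \<in> carrier_mat n n" using A by simp
  obtain z where "z \<in> spectrum ?A" using spectrum_non_empty[OF cA n] by auto
  hence ez: "eigenvalue ?A z" by (simp add: spectrum_def)
  then obtain w where "eigenvector ?A w z" by (auto simp: eigenvalue_def)
  hence w: "w \<in> carrier_vec n" and w0: "w \<noteq> 0\<^sub>v n" and Aw: "?A *\<^sub>v w = z \<cdot>\<^sub>v w"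
    using A by (auto simp: eigenvector_def)
  have symA: "A $$ (j,i) = A $$ (i,j)" if "i < n" "j < n" for i j
    using sym A that by (metis carrier_matD index_transpose_mat(1))
  have Aw': "(\<Sum>j<n. of_real (A $$ (i,j)) * w $ j) = z * w $ i" if "i < n" for i
  proof -
    have "(?A *\<^sub>v w) $ i = (\<Sum>j<n. of_real (A $$ (i,j)) * w $ j)"
      using that A w by (auto simp: scalar_prod_def row_def lessThan_atLeast0 intro!: sum.cong)
    thus ?thesis using Aw that w by simp
  qed
  define S where "S = (\<Sum>i<n. (cmod (w $ i))\<^sup>2)"
  obtain k where k: "k < n" "w $ k \<noteq> 0" using w w0 by (metis carrier_vecD eq_vecI index_zero_vec)
  have "(cmod (w $ k))\<^sup>2 \<le> S" unfolding S_def
    by (rule member_le_sum) (use k in auto)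
  hence S: "S > 0" using k by (smt (verit) zero_less_norm_iff zero_less_power)
  define q where "q = (\<Sum>i<n. \<Sum>j<n. cnj (w $ i) * of_real (A $$ (i,j)) * w $ j)"
  have "q = (\<Sum>i<n. cnj (w $ i) * (\<Sum>j<n. of_real (A $$ (i,j)) * w $ j))"
    unfolding q_def by (simp add: sum_distrib_left mult.assoc)
  also have "\<dots> = (\<Sum>i<n. cnj (w $ i) * (z * w $ i))" using Aw' by simp
  also have "\<dots> = z * of_real S"
    unfolding S_def by (simp add: sum_distrib_left complex_norm_square mult_ac del: of_real_power)
  finally have q: "q = z * of_real S" .
  have "cnj q = (\<Sum>i<n. \<Sum>j<n. cnj (w $ j) * of_real (A $$ (i,j)) * w $ i)"
    unfolding q_def by (simp add: mult_ac)
  also have "\<dots> = (\<Sum>j<n. \<Sum>i<n. cnj (w $ j) * of_real (A $$ (i,j)) * w $ i)"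
    by (rule sum.swap)
  also have "\<dots> = q" unfolding q_def by (intro sum.cong refl) (use symA in auto)
  finally have "cnj z = z" unfolding q using S by simp
  hence "z = of_real (Re z)" by (metis Reals_cnj_iff of_real_Re)
  hence "poly (char_poly ?A) (of_real (Re z)) = 0"
    using ez eigenvalue_root_char_poly[OF cA] by simp
  hence "complex_of_real (poly (char_poly A) (Re z)) = 0"
    by (simp add: of_real_hom.char_poly_hom[OF A])
  hence "eigenvalue A (Re z)" using eigenvalue_root_char_poly[OF A] by simp
  thus ?thesis ..
qed

lemma real_symmetric_unit_eigenvector_exists:
  fixes A :: "real mat"
  assumes A: "A \<in> carrier_mat n n" and sym: "transpose_mat A = A" and n: "n > 0"
  shows "\<exists>e v. v \<in> carrier_vec n \<and> v \<bullet> v = 1 \<and> A *\<^sub>v v = e \<cdot>\<^sub>v v"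
proof -
  obtain e v where "eigenvector A v e"
    using real_symmetric_eigenvalue_exists[OF assms] by (auto simp: eigenvalue_def)
  hence v: "v \<in> carrier_vec n" "v \<noteq> 0\<^sub>v n" "A *\<^sub>v v = e \<cdot>\<^sub>v v"
    using A by (auto simp: eigenvector_def)
  have pos: "v \<bullet> v > 0"
    using v(1,2) by (rule scalar_prod_self_pos)
  define u where "u = (1 / sqrt (v \<bullet> v)) \<cdot>\<^sub>v v"
  have u: "u \<in> carrier_vec n" using v by (simp add: u_def)
  have "u \<bullet> u = (1 / sqrt (v \<bullet> v)) * ((1 / sqrt (v \<bullet> v)) * (v \<bullet> v))"
    unfolding u_def using v(1) by simp
  also have "\<dots> = 1" using pos by (simp add: field_simps)
  finally have uu: "u \<bullet> u = 1" .
  have "A *\<^sub>v u = e \<cdot>\<^sub>v u" unfolding u_def using v A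
    by (simp add: mult_mat_vec smult_smult_assoc mult.commute)
  thus ?thesis using u uu by blast
qed

text \<open>The Householder reflection along \<open>v\<close> minus the first unit vector, which
  exchanges these two vectors. Being a symmetric involution, it can be used for conjugation without
  a transpose. If both vectors coincide, the reflection is undefined and the identity
  serves.\<close>

lemma householder_exists:
  fixes v :: "real Matrix.vec"
  assumes v: "v \<in> carrier_vec n" and vv: "v \<bullet> v = 1" and n: "n > 0"
  shows "\<exists>W \<in> carrier_mat n n. transpose_mat W = W \<and> W * W = 1\<^sub>m n \<and> W *\<^sub>v v = unit_vec n 0 \<and> col W 0 = v"
proof (cases "v = unit_vec n 0")
  case True
  thus ?thesis using n by (intro bexI[of _ "1\<^sub>m n"]) auto
next
  case False
  define u where "u i = v $ i - (if i = 0 then 1 else 0)" for i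
  define c where "c = (\<Sum>i<n. (u i)\<^sup>2)"
  have sv: "(\<Sum>i<n. (v $ i)\<^sup>2) = 1"
    using vv by (simp add: scalar_prod_self_eq_sum[OF v])
  have c: "c = 2 - 2 * v $ 0"
  proof -
    have "c = (\<Sum>i<n. (v $ i)\<^sup>2 + (if i = 0 then 1 - 2 * v $ 0 else 0))"
      unfolding c_def u_def by (intro sum.cong) (auto simp: power2_eq_square algebra_simps)
    also have "\<dots> = 2 - 2 * v $ 0" using n by (simp add: sum.distrib sv)
    finally show ?thesis .
  qed
  have c0: "c \<noteq> 0"
  proof
    assume "c = 0"
    hence "\<forall>i<n. u i = 0" unfolding c_def by (subst (asm) sum_nonneg_eq_0_iff) auto
    hence "v = unit_vec n 0" using v by (intro eq_vecI) (auto simp: u_def)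
    thus False using False by simp
  qed
  define W where "W = Matrix.mat n n (\<lambda>(i,j). (if i = j then 1 else 0) - 2 / c * u i * u j)"
  have W: "W \<in> carrier_mat n n" by (simp add: W_def)
  have T: "transpose_mat W = W" unfolding W_def by (rule eq_matI) (auto simp: mult_ac)
  have W2: "W * W = 1\<^sub>m n"
  proof (rule eq_matI)
    fix i j assume ij: "i < dim_row (1\<^sub>m n :: real mat)" "j < dim_col (1\<^sub>m n :: real mat)"
    have "(W * W) $$ (i,j) = (\<Sum>k<n. ((if i = k then 1 else 0) - 2 / c * u i * u k) * ((if k = j then 1 else 0) - 2 / c * u k * u j))"
      using ij by (simp add: W_def scalar_prod_def lessThan_atLeast0)
    also have "\<dots> = (\<Sum>k<n. (if k = i then (if i = j then 1 else 0) - 2 / c * u i * u j else 0)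
        - (if k = j then 2 / c * u i * u j else 0) + 4 / c\<^sup>2 * u i * u j * (u k)\<^sup>2)"
      by (intro sum.cong) (auto simp: power2_eq_square algebra_simps)
    also have "\<dots> = (if i = j then 1 else 0) - 2 / c * u i * u j - 2 / c * u i * u j + 4 / c\<^sup>2 * u i * u j * c"
      using ij by (simp only: sum.distrib sum_subtractf sum_distrib_left[symmetric] c_def[symmetric]) simp
    also have "\<dots> = (1\<^sub>m n :: real mat) $$ (i,j)" using c0 ij by (auto simp: power2_eq_square field_simps)
    finally show "(W * W) $$ (i,j) = (1\<^sub>m n :: real mat) $$ (i,j)" .
  qed (auto simp: W_def)
  have colW: "col W 0 = v"
  proof (rule eq_vecI)
    fix i assume "i < dim_vec v"
    hence i: "i < n" using v by simp
    \<comment> \<open>This value cancels the factor \<open>2 / c\<close>, so that column 0 of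
      \<open>W\<close> is the first unit vector plus \<open>u\<close>, which is
      \<open>v\<close>.\<close>
    have "u 0 = - c / 2" using c by (simp add: u_def)
    thus "col W 0 $ i = v $ i" using i n c0 by (simp add: W_def u_def[of i])
  qed (use v W in auto)
  have "W *\<^sub>v v = W *\<^sub>v (W *\<^sub>v unit_vec n 0)" using colW n W
    by (simp add: mult_mat_unit_vec)
  also have "\<dots> = unit_vec n 0" using W W2 by (subst assoc_mult_mat_vec[symmetric, of _ n n _ n]) auto
  finally show ?thesis using W T W2 colW by blast
qed

text \<open>\<open>W\<close> exchanges a unit eigenvector with the first unit vector, which is
  therefore an eigenvector of \<open>W * A * W\<close>. This fixes the first column, and symmetry
  fixes the first row.\<close>

lemma real_symmetric_deflation:
  fixes A :: "real mat"
  assumes A: "A \<in> carrier_mat (Suc n) (Suc n)" and sym: "transpose_mat A = A"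
  obtains W e A3 where "W \<in> carrier_mat (Suc n) (Suc n)" "transpose_mat W = W" "W * W = 1\<^sub>m (Suc n)"
    "A3 \<in> carrier_mat n n" "transpose_mat A3 = A3"
    "W * A * W = four_block_mat (Matrix.mat 1 1 (\<lambda>_. e)) (0\<^sub>m 1 n) (0\<^sub>m n 1) A3"
proof -
  let ?n = "Suc n"
  obtain e v where v: "v \<in> carrier_vec ?n" "v \<bullet> v = 1" "A *\<^sub>v v = e \<cdot>\<^sub>v v"
    using real_symmetric_unit_eigenvector_exists[OF A sym] by auto
  obtain W where W: "W \<in> carrier_mat ?n ?n" "transpose_mat W = W" "W * W = 1\<^sub>m ?n"
      "W *\<^sub>v v = unit_vec ?n 0" "col W 0 = v"
    using householder_exists[OF v(1,2)] by auto
  define B where "B = W * A * W"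
  have B: "B \<in> carrier_mat ?n ?n" using W A by (simp add: B_def)
  have "transpose_mat B = B" unfolding B_def using W A sym
    by (simp add: transpose_mult[of _ ?n ?n _ ?n] assoc_mult_mat[of _ ?n ?n _ ?n _ ?n])
  hence symB: "B $$ (j,i) = B $$ (i,j)" if "i < ?n" "j < ?n" for i j
    using B that by (metis carrier_matD index_transpose_mat(1))
  have "col B 0 = B *\<^sub>v unit_vec ?n 0" using B by (simp add: mult_mat_unit_vec)
  also have "\<dots> = W *\<^sub>v (A *\<^sub>v (W *\<^sub>v unit_vec ?n 0))"
    unfolding B_def using W A by (simp add: assoc_mult_mat_vec[of _ ?n ?n _ ?n])
  also have "W *\<^sub>v unit_vec ?n 0 = v" using W by (simp add: mult_mat_unit_vec)
  also have "W *\<^sub>v (A *\<^sub>v v) = e \<cdot>\<^sub>v unit_vec ?n 0"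
    using v W by (simp add: mult_mat_vec)
  finally have col: "col B 0 = e \<cdot>\<^sub>v unit_vec ?n 0" .
  have B0: "B $$ (i,0) = (if i = 0 then e else 0)" if "i < ?n" for i
  proof -
    have "B $$ (i,0) = col B 0 $ i" using B that by simp
    thus ?thesis using that by (simp add: col)
  qed
  define A3 where "A3 = Matrix.mat n n (\<lambda>(i,j). B $$ (Suc i, Suc j))"
  have "transpose_mat A3 = A3" unfolding A3_def by (rule eq_matI) (auto simp: symB)
  moreover have "B = four_block_mat (Matrix.mat 1 1 (\<lambda>_. e)) (0\<^sub>m 1 n) (0\<^sub>m n 1) A3"
  proof (rule eq_matI)
    fix i j assume "i < dim_row (four_block_mat (Matrix.mat 1 1 (\<lambda>_. e)) (0\<^sub>m 1 n) (0\<^sub>m n 1) A3)"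
      "j < dim_col (four_block_mat (Matrix.mat 1 1 (\<lambda>_. e)) (0\<^sub>m 1 n) (0\<^sub>m n 1) A3)"
    thus "B $$ (i,j) = four_block_mat (Matrix.mat 1 1 (\<lambda>_. e)) (0\<^sub>m 1 n) (0\<^sub>m n 1) A3 $$ (i,j)"
      using B0[of i] B0[of j] symB[of 0 j]
      by (cases i; cases j) (auto simp: A3_def)
  qed (use B in \<open>auto simp: A3_def\<close>)
  moreover have "A3 \<in> carrier_mat n n" by (simp add: A3_def)
  ultimately show ?thesis using that[of W A3 e] W(1-3) unfolding B_def by blast
qed

lemma block_diag_mult:
  fixes A :: "real mat"
  assumes "A \<in> carrier_mat a a" "A' \<in> carrier_mat a a" "D \<in> carrier_mat b b" "D' \<in> carrier_mat b b"
  shows "four_block_mat A (0\<^sub>m a b) (0\<^sub>m b a) D * four_block_mat A' (0\<^sub>m a b) (0\<^sub>m b a) D'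
    = four_block_mat (A * A') (0\<^sub>m a b) (0\<^sub>m b a) (D * D')"
  using assms by (subst mult_four_block_mat[of _ a a _ b _ b _ _ a _ b]) 
    (auto simp: left_mult_zero_mat[of _ b b] left_mult_zero_mat[of _ a a] right_mult_zero_mat[of _ a a] right_mult_zero_mat[of _ b b]
       right_add_zero_mat[of _ a a] left_add_zero_mat[of _ b b] intro!: cong_four_block_mat)

text \<open>Induction on the dimension: the block left by deflation is diagonalized by
  \<open>V\<close>, and the full orthogonal matrix is the reflection \<open>W\<close> times
  \<open>V\<close> bordered by a 1.\<close>

theorem real_spectral_theorem:
  fixes A :: "real mat"
  assumes "A \<in> carrier_mat n n" and "transpose_mat A = A"
  shows "\<exists>U f. U \<in> carrier_mat n n \<and> transpose_mat U * U = 1\<^sub>m n \<and> U * transpose_mat U = 1\<^sub>m n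
    \<and> A = U * mat_diag n f * transpose_mat U"
  using assms
proof (induction n arbitrary: A)
  case 0
  thus ?case by (intro exI[of _ "1\<^sub>m 0"] exI[of _ "\<lambda>_. 0"]) auto
next
  case (Suc n)
  let ?n = "Suc n"
  note A = Suc.prems(1)
  obtain W e A3 where W: "W \<in> carrier_mat ?n ?n" "transpose_mat W = W" "W * W = 1\<^sub>m ?n"
    and A3: "A3 \<in> carrier_mat n n" "transpose_mat A3 = A3"
    and WAW: "W * A * W = four_block_mat (Matrix.mat 1 1 (\<lambda>_. e)) (0\<^sub>m 1 n) (0\<^sub>m n 1) A3"
    using real_symmetric_deflation[OF Suc.prems] by blast
  obtain V f where V: "V \<in> carrier_mat n n" "transpose_mat V * V = 1\<^sub>m n" "V * transpose_mat V = 1\<^sub>m n"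
      "A3 = V * mat_diag n f * transpose_mat V"
    using Suc.IH[OF A3] by blast
  define P where "P = four_block_mat (1\<^sub>m 1) (0\<^sub>m 1 n) (0\<^sub>m n 1) V"
  have P: "P \<in> carrier_mat ?n ?n" using V unfolding P_def by (metis four_block_carrier_mat one_carrier_mat plus_1_eq_Suc)
  have PT: "transpose_mat P = four_block_mat (1\<^sub>m 1) (0\<^sub>m 1 n) (0\<^sub>m n 1) (transpose_mat V)"
    unfolding P_def using V(1) by (subst transpose_four_block_mat[of _ 1 1 _ n _ n]) (auto simp: zero_transpose_mat)
  have one: "four_block_mat (1\<^sub>m 1) (0\<^sub>m 1 n) (0\<^sub>m n 1) (1\<^sub>m n) = (1\<^sub>m ?n :: real mat)"
    by (metis four_block_one_mat plus_1_eq_Suc)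
  have PP: "transpose_mat P * P = 1\<^sub>m ?n" "P * transpose_mat P = 1\<^sub>m ?n"
    unfolding PT unfolding P_def using V one by (simp_all add: block_diag_mult[of _ "Suc 0" _ _ n])
  define g where "g = case_nat e f"
  have Dg: "mat_diag ?n g = four_block_mat (Matrix.mat 1 1 (\<lambda>_. e)) (0\<^sub>m 1 n) (0\<^sub>m n 1) (mat_diag n f)"
    by (rule eq_matI) (auto simp: mat_diag_def g_def split: nat.split)
  have "P * mat_diag ?n g * transpose_mat P = W * A * W"
    unfolding Dg PT WAW unfolding P_def using V(1) by (simp add: block_diag_mult[of _ "Suc 0" _ _ n] V(4))
  hence eq: "P * mat_diag ?n g * transpose_mat P = W * A * W" .
  define U where "U = W * P"
  note as = assoc_mult_mat[of _ ?n ?n _ ?n _ ?n] mult_carrier_mat[of _ ?n ?n _ ?n]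
  have U: "U \<in> carrier_mat ?n ?n" using W P by (simp add: U_def)
  have UT: "transpose_mat U = transpose_mat P * W" unfolding U_def using W P by (simp add: transpose_mult[of _ ?n ?n _ ?n])
  have cancel: "W * (W * X) = X" if "X \<in> carrier_mat ?n ?n" for X
    using that W by (simp add: as(1)[symmetric])
  have cancel2: "transpose_mat P * (P * X) = X" "P * (transpose_mat P * X) = X" if "X \<in> carrier_mat ?n ?n" for X
    using that P PP by (simp_all add: as(1)[symmetric])
  have 1: "transpose_mat U * U = 1\<^sub>m ?n" unfolding UT unfolding U_def using W P PP by (simp add: as cancel)
  have 2: "U * transpose_mat U = 1\<^sub>m ?n" unfolding UT unfolding U_def using W P PP by (simp add: as cancel2)
  have "U * mat_diag ?n g * transpose_mat U = W * (P * mat_diag ?n g * transpose_mat P) * W"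
    unfolding UT unfolding U_def using W P by (simp add: as)
  also have "\<dots> = A" unfolding eq using W A by (simp add: as cancel)
  finally show ?case using U 1 2 by metis
qed

section \<open>Quadratic forms and orthogonal diagonalization\<close>

lemma symmetric_mat_index:
  assumes "A \<in> carrier_mat n n" "transpose_mat A = A" "i < n" "j < n"
  shows "A $$ (j,i) = A $$ (i,j)"
  using assms by (metis carrier_matD index_transpose_mat(1))

lemma scalar_prod_eq_sum:
  assumes "y \<in> carrier_vec n"
  shows "x \<bullet> y = (\<Sum>i<n. x $ i * y $ i)"
  using assms by (simp add: scalar_prod_def lessThan_atLeast0)

lemma mult_mat_vec_index:
  assumes "A \<in> carrier_mat n n" "x \<in> carrier_vec n" "i < n"
  shows "(A *\<^sub>v x) $ i = (\<Sum>j<n. A $$ (i,j) * x $ j)"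
  using assms by (simp add: scalar_prod_def lessThan_atLeast0)

lemma quadratic_form_eq_sum:
  fixes A :: "real mat"
  assumes A: "A \<in> carrier_mat n n" and x: "x \<in> carrier_vec n"
  shows "x \<bullet> (A *\<^sub>v x) = (\<Sum>i<n. \<Sum>j<n. A $$ (i,j) * x $ i * x $ j)"
proof -
  have "x \<bullet> (A *\<^sub>v x) = (\<Sum>i<n. x $ i * (A *\<^sub>v x) $ i)"
    using A x by (intro scalar_prod_eq_sum) auto
  also have "\<dots> = (\<Sum>i<n. x $ i * (\<Sum>j<n. A $$ (i,j) * x $ j))"
    by (intro sum.cong refl) (use mult_mat_vec_index[OF A x] in auto)
  also have "\<dots> = (\<Sum>i<n. \<Sum>j<n. A $$ (i,j) * x $ i * x $ j)"
    by (simp add: sum_distrib_left mult_ac)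
  finally show ?thesis .
qed

lemma quadratic_form_congruence:
  fixes A P :: "real mat"
  assumes "A \<in> carrier_mat n n" "P \<in> carrier_mat n n" "x \<in> carrier_vec n"
  shows "x \<bullet> ((transpose_mat P * A * P) *\<^sub>v x) = (P *\<^sub>v x) \<bullet> (A *\<^sub>v (P *\<^sub>v x))"
  using assms transpose_vec_mult_scalar[of "transpose_mat P" n n "A *\<^sub>v (P *\<^sub>v x)" x]
  by (simp add: assoc_mult_mat_vec[of _ n n _ n])

text \<open>Eigenvalue bounds in Rayleigh form, with symmetry included. In this form, bounds for a
  matrix and for a perturbation of it simply add up. Negative \<open>m\<close> is allowed, so
  indefinite error matrices are covered.\<close>

definition spectrum_within :: "nat \<Rightarrow> real \<Rightarrow> real \<Rightarrow> real mat \<Rightarrow> bool" where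
  "spectrum_within n m L A \<longleftrightarrow> A \<in> carrier_mat n n \<and> transpose_mat A = A \<and>
     (\<forall>x\<in>carrier_vec n. m * (x \<bullet> x) \<le> x \<bullet> (A *\<^sub>v x) \<and> x \<bullet> (A *\<^sub>v x) \<le> L * (x \<bullet> x))"

definition diagonalizes :: "nat \<Rightarrow> real mat \<Rightarrow> (nat \<Rightarrow> real) \<Rightarrow> real mat \<Rightarrow> bool" where
  "diagonalizes n U f A \<longleftrightarrow> U \<in> carrier_mat n n \<and> transpose_mat U * U = 1\<^sub>m n \<and>
     U * transpose_mat U = 1\<^sub>m n \<and> A = U * mat_diag n f * transpose_mat U"

lemma diagonalizesE:
  assumes "diagonalizes n U f A"
  shows "U \<in> carrier_mat n n" "transpose_mat U \<in> carrier_mat n n" "transpose_mat U * U = 1\<^sub>m n"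
     "U * transpose_mat U = 1\<^sub>m n" "A = U * mat_diag n f * transpose_mat U" "A \<in> carrier_mat n n"
     "transpose_mat U * A * U = mat_diag n f"
proof -
  show 1: "U \<in> carrier_mat n n" "transpose_mat U \<in> carrier_mat n n" "transpose_mat U * U = 1\<^sub>m n"
     "U * transpose_mat U = 1\<^sub>m n" "A = U * mat_diag n f * transpose_mat U" "A \<in> carrier_mat n n"
    using assms by (auto simp: diagonalizes_def)
  note as = assoc_mult_mat[of _ n n _ n _ n] mult_carrier_mat[of _ n n _ n]
  have "transpose_mat U * A * U = (transpose_mat U * U) * (mat_diag n f * (transpose_mat U * U))"
    unfolding 1(5) using 1(1,2) by (simp add: as)
  thus "transpose_mat U * A * U = mat_diag n f"
    using 1(3) by (simp add: left_mult_one_mat[of _ n n] right_mult_one_mat[of _ n n])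
qed

lemma mat_diag_mult_vec:
  fixes f :: "nat \<Rightarrow> 'a :: semiring_0"
  assumes "x \<in> carrier_vec n" "i < n"
  shows "(mat_diag n f *\<^sub>v x) $ i = f i * x $ i"
proof -
  have "(mat_diag n f *\<^sub>v x) $ i = (\<Sum>j<n. (if i = j then f j else 0) * x $ j)"
    using assms by (simp add: scalar_prod_def lessThan_atLeast0 mat_diag_def)
  also have "\<dots> = f i * x $ i" using assms by (simp add: if_distrib[of "\<lambda>y. y * _"] cong: if_cong)
  finally show ?thesis .
qed

lemma orthogonal_preserves_norm:
  fixes U :: "real mat"
  assumes U: "U \<in> carrier_mat n n" "U * transpose_mat U = 1\<^sub>m n" and x: "x \<in> carrier_vec n"
  shows "(transpose_mat U *\<^sub>v x) \<bullet> (transpose_mat U *\<^sub>v x) = x \<bullet> x"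
proof -
  have "(transpose_mat U *\<^sub>v x) \<bullet> (transpose_mat U *\<^sub>v x) = x \<bullet> (U *\<^sub>v (transpose_mat U *\<^sub>v x))"
    using U x by (intro transpose_vec_mult_scalar[of _ n n]) auto
  also have "\<dots> = x \<bullet> x"
    using U x by (subst assoc_mult_mat_vec[symmetric, of _ n n _ n]) auto
  finally show ?thesis .
qed

lemma diagonalizes_quadratic_form:
  assumes D: "diagonalizes n U f A" and x: "x \<in> carrier_vec n"
  defines "y \<equiv> transpose_mat U *\<^sub>v x"
  shows "x \<bullet> (A *\<^sub>v x) = (\<Sum>k<n. f k * (y $ k)\<^sup>2)" "x \<bullet> x = (\<Sum>k<n. (y $ k)\<^sup>2)"
    "(A *\<^sub>v x) \<bullet> (A *\<^sub>v x) = (\<Sum>k<n. (f k)\<^sup>2 * (y $ k)\<^sup>2)"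
proof -
  note U = diagonalizesE[OF D]
  have y: "y \<in> carrier_vec n" using U x by (simp add: y_def)
  show "x \<bullet> x = (\<Sum>k<n. (y $ k)\<^sup>2)"
    using orthogonal_preserves_norm[OF U(1,4) x] scalar_prod_self_eq_sum[OF y] by (simp add: y_def)
  have Ax: "A *\<^sub>v x = U *\<^sub>v (mat_diag n f *\<^sub>v y)"
    unfolding U(5) y_def using U(1,2) x by (simp add: assoc_mult_mat_vec[of _ n n _ n])
  have dy: "mat_diag n f *\<^sub>v y \<in> carrier_vec n" using y by (metis mat_diag_dim mult_mat_vec_carrier)
  have "x \<bullet> (A *\<^sub>v x) = y \<bullet> (mat_diag n f *\<^sub>v y)"
    unfolding Ax y_def using U(1) x dy by (intro transpose_vec_mult_scalar[symmetric, of _ n n]) (auto simp: y_def)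
  also have "\<dots> = (\<Sum>k<n. y $ k * (mat_diag n f *\<^sub>v y) $ k)"
    by (rule scalar_prod_eq_sum[OF dy])
  also have "\<dots> = (\<Sum>k<n. f k * (y $ k)\<^sup>2)"
    by (intro sum.cong refl) (simp add: mat_diag_mult_vec[OF y] power2_eq_square)
  finally show "x \<bullet> (A *\<^sub>v x) = (\<Sum>k<n. f k * (y $ k)\<^sup>2)" .
  have "(A *\<^sub>v x) \<bullet> (A *\<^sub>v x) = (mat_diag n f *\<^sub>v y) \<bullet> (mat_diag n f *\<^sub>v y)"
    unfolding Ax using orthogonal_preserves_norm[of "transpose_mat U" n, OF _ _ dy] U by simp
  also have "\<dots> = (\<Sum>k<n. (f k)\<^sup>2 * (y $ k)\<^sup>2)"
    unfolding scalar_prod_self_eq_sum[OF dy]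
    by (intro sum.cong refl) (simp add: mat_diag_mult_vec[OF y] power_mult_distrib)
  finally show "(A *\<^sub>v x) \<bullet> (A *\<^sub>v x) = (\<Sum>k<n. (f k)\<^sup>2 * (y $ k)\<^sup>2)" .
qed

lemma diagonalizes_col:
  assumes D: "diagonalizes n U f A" and k: "k < n"
  shows "col U k \<in> carrier_vec n" "col U k \<bullet> col U k = 1" "A *\<^sub>v col U k = f k \<cdot>\<^sub>v col U k"
    "col U k \<bullet> (A *\<^sub>v col U k) = f k"
proof -
  note U = diagonalizesE[OF D]
  show c: "col U k \<in> carrier_vec n" using U(1) col_dim[of U k] by auto
  have "(transpose_mat U * U) $$ (k,k) = 1" using U(3) k by simp
  thus 1: "col U k \<bullet> col U k = 1" using U(1) k by simp
  have Ue: "transpose_mat U *\<^sub>v col U k = unit_vec n k"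
    using U(1-3) k by (simp add: mult_mat_unit_vec[symmetric, of U n n] assoc_mult_mat_vec[symmetric, of _ n n _ n])
  have De: "mat_diag n f *\<^sub>v unit_vec n k = f k \<cdot>\<^sub>v unit_vec n k"
    using k by (intro eq_vecI) (auto simp: mat_diag_mult_vec mat_diag_def)
  have "A *\<^sub>v col U k = U *\<^sub>v (mat_diag n f *\<^sub>v (transpose_mat U *\<^sub>v col U k))"
    unfolding U(5) using U(1,2) c by (simp add: assoc_mult_mat_vec[of _ n n _ n])
  also have "\<dots> = f k \<cdot>\<^sub>v col U k"
    unfolding Ue De using U(1) k by (simp add: mult_mat_vec mult_mat_unit_vec)
  finally show 2: "A *\<^sub>v col U k = f k \<cdot>\<^sub>v col U k" .
  show "col U k \<bullet> (A *\<^sub>v col U k) = f k" unfolding 2 using c 1 by simp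
qed

text \<open>The Rayleigh quotient at column \<open>k\<close> of \<open>U\<close> equals
  \<open>f k\<close>, so the bounds on the form pass to the eigenvalues.\<close>

lemma spectrum_within_diagonalizes:
  assumes "spectrum_within n m L A"
  shows "\<exists>U f. diagonalizes n U f A \<and> (\<forall>k<n. m \<le> f k \<and> f k \<le> L)"
proof -
  have A: "A \<in> carrier_mat n n" "transpose_mat A = A" using assms by (auto simp: spectrum_within_def)
  obtain U f where D: "diagonalizes n U f A"
    using real_spectral_theorem[OF A] unfolding diagonalizes_def by blast
  have "m \<le> f k \<and> f k \<le> L" if "k < n" for k
    using assms diagonalizes_col[OF D that] by (force simp: spectrum_within_def)
  thus ?thesis using D by blast
qed

lemma diagonalizes_symmetric:
  assumes D: "diagonalizes n U f A"
  shows "transpose_mat A = A"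
proof -
  note U = diagonalizesE[OF D]
  have T: "transpose_mat (mat_diag n f) = mat_diag n f" by (rule eq_matI) (auto simp: mat_diag_def)
  show ?thesis unfolding U(5) using U(1,2) T
    by (simp add: transpose_mult[of _ n n _ n] assoc_mult_mat[of _ n n _ n _ n] mult_carrier_mat[of _ n n _ n])
qed

lemma diagonalizes_spectrum_within:
  assumes D: "diagonalizes n U f A" and f: "\<And>k. k < n \<Longrightarrow> m \<le> f k \<and> f k \<le> L"
  shows "spectrum_within n m L A"
  unfolding spectrum_within_def
proof (intro conjI ballI)
  fix x :: "real Matrix.vec" assume x: "x \<in> carrier_vec n"
  show "m * (x \<bullet> x) \<le> x \<bullet> (A *\<^sub>v x)" "x \<bullet> (A *\<^sub>v x) \<le> L * (x \<bullet> x)"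
    unfolding diagonalizes_quadratic_form[OF D x]
    by (auto simp: sum_distrib_left f intro!: sum_mono mult_right_mono)
qed (use diagonalizes_symmetric[OF D] diagonalizesE[OF D] in auto)

section \<open>Strong concavity of the log determinant\<close>

text \<open>The difference of the two sides vanishes at \<open>c = 1\<close>, and the sign of a
  derivative decides on either side. The denominator damps the quadratic loss to a linear one for
  large \<open>c\<close>, which is the most that \<open>(c - 1) - ln c\<close> permits.\<close>

lemma ln_le_minus_quadratic:
  fixes c :: real
  assumes c: "c > 0"
  shows "ln c \<le> (c - 1) - (c - 1)\<^sup>2 / (2 * (1 + \<bar>c - 1\<bar>))"
proof (cases "c \<ge> 1")
  case True
  \<comment> \<open>For \<open>c \<ge> 1\<close> the denominator is \<open>2 * c\<close>, and the
    right-hand side simplifies to \<open>(c - 1 / c) / 2\<close>.\<close>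
  let ?h = "\<lambda>x::real. (x - 1 / x) / 2 - ln x"
  have "?h 1 \<le> ?h c"
  proof (rule DERIV_nonneg_imp_nondecreasing[OF True])
    fix x :: real assume x: "1 \<le> x"
    have "(?h has_real_derivative (1 - 1 / x)\<^sup>2 / 2) (at x)"
      using x by (auto intro!: derivative_eq_intros simp: field_simps power2_eq_square)
    thus "\<exists>y. (?h has_real_derivative y) (at x) \<and> y \<ge> 0" by (intro exI conjI) auto
  qed
  hence "ln c \<le> (c - 1 / c) / 2" by simp
  also have "\<dots> = (c - 1) - (c - 1)\<^sup>2 / (2 * (1 + \<bar>c - 1\<bar>))"
    using True by (simp add: field_simps power2_eq_square)
  finally show ?thesis .
next
  case False
  \<comment> \<open>Below 1 a stronger inequality holds, with denominator 2 instead of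
    \<open>2 * (1 + \<bar>c - 1\<bar>)\<close>.\<close>
  let ?h = "\<lambda>x::real. (x - 1) - (x - 1)\<^sup>2 / 2 - ln x"
  have "?h 1 \<le> ?h c"
  proof (rule DERIV_nonpos_imp_nonincreasing[of c 1 ?h])
    show "c \<le> 1" using False by simp
    fix x :: real assume x: "c \<le> x" "x \<le> 1"
    have "(?h has_real_derivative - ((1 - x)\<^sup>2 / x)) (at x)"
      using x c by (auto intro!: derivative_eq_intros simp: field_simps power2_eq_square)
    thus "\<exists>y. (?h has_real_derivative y) (at x) \<and> y \<le> 0" using x c by (intro exI conjI) auto
  qed
  hence "ln c \<le> (c - 1) - (c - 1)\<^sup>2 / 2" by simp
  also have "(c - 1)\<^sup>2 / (2 * (1 + \<bar>c - 1\<bar>)) \<le> (c - 1)\<^sup>2 / 2"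
    by (intro divide_left_mono) (auto intro: add_pos_nonneg)
  hence "(c - 1) - (c - 1)\<^sup>2 / 2 \<le> (c - 1) - (c - 1)\<^sup>2 / (2 * (1 + \<bar>c - 1\<bar>))" by simp
  finally show ?thesis .
qed

text \<open>Every \<open>\<bar>c k - 1\<bar>\<close> is at most the Euclidean norm \<open>x\<close>
  of all deviations, so the scalar losses may be given the common denominator
  \<open>2 * (1 + x)\<close> and then add up exactly.\<close>

lemma sum_ln_le_minus_quadratic:
  fixes c :: "nat \<Rightarrow> real"
  assumes c: "\<And>k. k < n \<Longrightarrow> c k > 0"
  defines "x \<equiv> sqrt (\<Sum>k<n. (c k - 1)\<^sup>2)"
  shows "(\<Sum>k<n. ln (c k)) \<le> (\<Sum>k<n. c k - 1) - x\<^sup>2 / (2 * (1 + x))"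
proof -
  have x2: "x\<^sup>2 = (\<Sum>k<n. (c k - 1)\<^sup>2)" unfolding x_def by (simp add: sum_nonneg)
  have x0: "x \<ge> 0" unfolding x_def by (simp add: sum_nonneg)
  have le: "\<bar>c k - 1\<bar> \<le> x" if "k < n" for k
  proof -
    have "(c k - 1)\<^sup>2 \<le> x\<^sup>2" unfolding x2 by (rule member_le_sum) (use that in auto)
    thus ?thesis using x0 by (metis abs_of_nonneg power2_abs abs_le_square_iff)
  qed
  have "ln (c k) \<le> (c k - 1) - (c k - 1)\<^sup>2 / (2 * (1 + x))" if k: "k < n" for k
  proof -
    have "(c k - 1)\<^sup>2 / (2 * (1 + x)) \<le> (c k - 1)\<^sup>2 / (2 * (1 + \<bar>c k - 1\<bar>))"
      using le[OF k] x0 by (intro divide_left_mono mult_pos_pos) auto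
    thus ?thesis using ln_le_minus_quadratic[OF c[OF k]] by simp
  qed
  hence "(\<Sum>k<n. ln (c k)) \<le> (\<Sum>k<n. (c k - 1) - (c k - 1)\<^sup>2 / (2 * (1 + x)))"
    by (intro sum_mono) auto
  also have "\<dots> = (\<Sum>k<n. c k - 1) - x\<^sup>2 / (2 * (1 + x))"
    unfolding x2 by (simp add: sum_subtractf sum_divide_distrib)
  finally show ?thesis .
qed

section \<open>Frobenius norm, trace, determinant and inverse in an eigenbasis\<close>

definition frob_sq :: "real mat \<Rightarrow> real" where
  "frob_sq A = (\<Sum>i<dim_row A. \<Sum>j<dim_col A. (A $$ (i,j))\<^sup>2)"

lemma mat_trace_mult:
  assumes "A \<in> carrier_mat n m" "B \<in> carrier_mat m n"
  shows "mat_trace (A * B) = (\<Sum>i<n. \<Sum>j<m. A $$ (i,j) * B $$ (j,i))"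
  using assms by (simp add: mat_trace_def scalar_prod_def lessThan_atLeast0)

lemma mat_trace_mult_commute:
  assumes "A \<in> carrier_mat n m" "B \<in> carrier_mat m n"
  shows "mat_trace (A * B) = mat_trace (B * A)"
  unfolding mat_trace_mult[OF assms] mat_trace_mult[OF assms(2,1)]
  by (subst sum.swap) (simp add: mult.commute)

lemma frob_sq_eq_trace: "frob_sq A = mat_trace (transpose_mat A * A)"
proof -
  have "mat_trace (transpose_mat A * A) = (\<Sum>i<dim_col A. \<Sum>j<dim_row A. (A $$ (j,i))\<^sup>2)"
    by (subst mat_trace_mult[of _ "dim_col A" "dim_row A"]) (auto simp: power2_eq_square)
  thus ?thesis unfolding frob_sq_def by (subst sum.swap) simp
qed

text \<open>The norm is the trace of the Gram matrix: the inner pair of orthogonal factors cancels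
  directly, the outer pair by cyclicity of the trace.\<close>

lemma frob_sq_orthogonal:
  assumes U: "U \<in> carrier_mat n n" "transpose_mat U * U = 1\<^sub>m n" and A: "A \<in> carrier_mat n n"
  shows "frob_sq (U * A * transpose_mat U) = frob_sq A"
proof -
  note as = assoc_mult_mat[of _ n n _ n _ n] mult_carrier_mat[of _ n n _ n] transpose_mult[of _ n n _ n]
  have cancel: "transpose_mat U * (U * X) = X" if "X \<in> carrier_mat n n" for X
    using that U by (simp add: as(1)[symmetric])
  have "frob_sq (U * A * transpose_mat U) = mat_trace (U * (transpose_mat A * A * transpose_mat U))"
    unfolding frob_sq_eq_trace using U(1) A by (simp add: as cancel)
  also have "\<dots> = mat_trace ((transpose_mat A * A * transpose_mat U) * U)"
    using U(1) A by (intro mat_trace_mult_commute[of _ n n]) (auto simp: as)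
  also have "\<dots> = mat_trace (transpose_mat A * A)" using U A by (simp add: as)
  finally show ?thesis by (simp add: frob_sq_eq_trace)
qed

lemma det_mat_diag: "Determinant.det (mat_diag n f) = (\<Prod>k<n. f k)"
proof -
  have "Determinant.det (mat_diag n f) = prod_list (diag_mat (mat_diag n f))"
    by (rule det_upper_triangular[of _ n]) (auto simp: mat_diag_def)
  also have "\<dots> = (\<Prod>k<n. f k)"
    by (simp add: prod_list_diag_prod mat_diag_def lessThan_atLeast0)
  finally show ?thesis .
qed

lemma diagonalizes_det:
  assumes D: "diagonalizes n U f A"
  shows "Determinant.det A = (\<Prod>k<n. f k)"
proof -
  note U = diagonalizesE[OF D]
  have 1: "Determinant.det U * Determinant.det (transpose_mat U) = 1"
    using det_mult[OF U(1,2)] U(4) by simp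
  have "Determinant.det A = Determinant.det U * (\<Prod>k<n. f k) * Determinant.det (transpose_mat U)"
    unfolding U(5) using U(1,2)
    by (simp add: det_mult[of _ n] mult_carrier_mat[of _ n n _ n] det_mat_diag del: det_transpose)
  thus ?thesis using 1 by (simp add: mult_ac)
qed

lemma diagonalizes_trace:
  assumes D: "diagonalizes n U f A"
  shows "mat_trace A = (\<Sum>k<n. f k)"
proof -
  note U = diagonalizesE[OF D]
  have "mat_trace A = mat_trace (U * (mat_diag n f * transpose_mat U))"
    unfolding U(5) using U(1,2) by (simp add: assoc_mult_mat[of _ n n _ n _ n])
  also have "\<dots> = mat_trace ((mat_diag n f * transpose_mat U) * U)"
    using U(1,2) by (intro mat_trace_mult_commute[of _ n n]) (auto simp: mult_carrier_mat[of _ n n _ n])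
  also have "\<dots> = mat_trace (mat_diag n f)"
    using U(1-3) by (simp add: assoc_mult_mat[of _ n n _ n _ n] right_mult_one_mat[of _ n n])
  finally show ?thesis by (simp add: mat_trace_def mat_diag_def)
qed

lemma diagonalizes_frob_sq:
  assumes D: "diagonalizes n U f A"
  shows "frob_sq A = (\<Sum>k<n. (f k)\<^sup>2)"
proof -
  note U = diagonalizesE[OF D]
  have "frob_sq A = frob_sq (mat_diag n f)"
    unfolding U(5) by (rule frob_sq_orthogonal) (use U in auto)
  also have "\<dots> = (\<Sum>i<n. \<Sum>j<n. if i = j then (f j)\<^sup>2 else 0)"
    by (simp add: frob_sq_def mat_diag_def if_distrib[of "\<lambda>x. x\<^sup>2"] cong: if_cong)
  finally show ?thesis by simp
qed

lemma diagonalizes_mult_eq: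
  assumes D: "diagonalizes n U f A" and E: "diagonalizes n U g B"
  shows "diagonalizes n U (\<lambda>k. f k * g k) (A * B)"
proof -
  note U = diagonalizesE[OF D] and V = diagonalizesE[OF E]
  note as = assoc_mult_mat[of _ n n _ n _ n] mult_carrier_mat[of _ n n _ n]
  have cancel: "transpose_mat U * (U * X) = X" if "X \<in> carrier_mat n n" for X
    using that U(1-3) by (simp add: as(1)[symmetric])
  have "A * B = U * (mat_diag n f * mat_diag n g) * transpose_mat U"
    unfolding U(5) V(5) using U(1,2) by (simp add: as cancel del: mat_diag_diag)
  thus ?thesis using U(1-4) by (simp add: diagonalizes_def)
qed

lemma left_inverse_unique:
  fixes A :: "real mat"
  assumes "A \<in> carrier_mat n n" "B \<in> carrier_mat n n" "C \<in> carrier_mat n n" "B * A = 1\<^sub>m n" "A * C = 1\<^sub>m n"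
  shows "B = C"
proof -
  have "B = B * (A * C)" using assms by simp
  also have "\<dots> = B * A * C" using assms(1-3) by (simp add: assoc_mult_mat[of _ n n _ n _ n])
  finally show ?thesis using assms by simp
qed

lemma diagonalizes_inverse:
  assumes D: "diagonalizes n U f A" and f: "\<And>k. k < n \<Longrightarrow> f k \<noteq> 0"
    and B: "B \<in> carrier_mat n n" "B * A = 1\<^sub>m n"
  shows "diagonalizes n U (\<lambda>k. 1 / f k) B"
proof -
  note U = diagonalizesE[OF D]
  let ?B = "U * mat_diag n (\<lambda>k. 1 / f k) * transpose_mat U"
  have D': "diagonalizes n U (\<lambda>k. 1 / f k) ?B" using U(1-4) by (simp add: diagonalizes_def)
  have "A * ?B = U * mat_diag n (\<lambda>k. f k * (1 / f k)) * transpose_mat U"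
    using diagonalizesE(5)[OF diagonalizes_mult_eq[OF D D']] .
  also have "mat_diag n (\<lambda>k. f k * (1 / f k)) = 1\<^sub>m n"
    using f by (intro eq_matI) (auto simp: mat_diag_def)
  also have "U * 1\<^sub>m n * transpose_mat U = 1\<^sub>m n" using U by simp
  finally have "A * ?B = 1\<^sub>m n" .
  hence "B = ?B" using left_inverse_unique[OF U(6) B(1) diagonalizesE(6)[OF D'] B(2)] by simp
  thus ?thesis using D' by simp
qed

lemma spectrum_within_inverse:
  assumes A: "spectrum_within n m L A" and m: "m > 0" and B: "B \<in> carrier_mat n n" "B * A = 1\<^sub>m n"
  shows "spectrum_within n (1 / L) (1 / m) B"
proof -
  obtain U f where D: "diagonalizes n U f A" and f: "\<And>k. k < n \<Longrightarrow> m \<le> f k \<and> f k \<le> L"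
    using spectrum_within_diagonalizes[OF A] by blast
  have "diagonalizes n U (\<lambda>k. 1 / f k) B"
    using diagonalizes_inverse[OF D _ B] f m by force
  thus ?thesis
    by (rule diagonalizes_spectrum_within) (use f m in \<open>force intro!: divide_left_mono mult_pos_pos\<close>)
qed

lemma pos_def_diagonalizes:
  assumes "pos_def n A"
  shows "\<exists>U f. diagonalizes n U f A \<and> (\<forall>k<n. f k > 0)"
proof -
  have A: "A \<in> carrier_mat n n" "transpose_mat A = A" using assms by (auto simp: pos_def_def)
  obtain U f where D: "diagonalizes n U f A"
    using real_spectral_theorem[OF A] unfolding diagonalizes_def by blast
  have "f k > 0" if "k < n" for k
  proof -
    have "col U k \<noteq> 0\<^sub>v n" using diagonalizes_col(1,2)[OF D that] by auto
    thus ?thesis using assms diagonalizes_col[OF D that] by (force simp: pos_def_def)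
  qed
  thus ?thesis using D by blast
qed

lemma pos_def_det_pos: "pos_def n A \<Longrightarrow> Determinant.det A > 0"
  using pos_def_diagonalizes diagonalizes_det by (metis lessThan_iff prod_pos)

lemma spectrum_within_pos_def: "spectrum_within n m L A \<Longrightarrow> m > 0 \<Longrightarrow> pos_def n A"
  unfolding spectrum_within_def pos_def_def using scalar_prod_self_pos
  by (meson less_le_trans mult_pos_pos)

text \<open>Simultaneous diagonalization: with \<open>P\<^sup>T K P = 1\<close> and \<open>P\<^sup>T B P\<close> diagonalized with eigenvalues
  \<open>c\<^sub>k\<close>, the difference of the log determinants is \<open>\<Sum> ln c\<^sub>k\<close>.\<close>

lemma ln_det_strongly_concave:
  assumes K: "spectrum_within n m L K" and m: "m > 0" and B: "pos_def n B"
    and R: "R \<in> carrier_mat n n" "R * K = 1\<^sub>m n"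
  shows "\<exists>x\<ge>0. frob_sq (B - K) \<le> (L * x)\<^sup>2 \<and>
    ln (Determinant.det B) \<le> ln (Determinant.det K) + mat_trace (R * (B - K)) - x\<^sup>2 / (2 * (1 + x))"
proof -
  obtain U f where D: "diagonalizes n U f K" and f: "\<And>k. k < n \<Longrightarrow> m \<le> f k \<and> f k \<le> L"
    using spectrum_within_diagonalizes[OF K] by blast
  have f0: "f k > 0" if "k < n" for k using f[OF that] m by simp
  note U = diagonalizesE[OF D]
  note as = assoc_mult_mat[of _ n n _ n _ n] mult_carrier_mat[of _ n n _ n] transpose_mult[of _ n n _ n]
  have Bc: "B \<in> carrier_mat n n" and Bs: "transpose_mat B = B" using B by (auto simp: pos_def_def)
  \<comment> \<open>\<open>G\<close> and \<open>H\<close> carry the inverse square roots and the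
    square roots of the eigenvalues of \<open>K\<close>. Hence \<open>P = U * G\<close> turns
    \<open>K\<close> into the identity by congruence, and \<open>Q = H * transpose_mat U\<close> is
    the inverse of \<open>P\<close>.\<close>
  define G where "G = mat_diag n (\<lambda>k. 1 / sqrt (f k))"
  define H where "H = mat_diag n (\<lambda>k. sqrt (f k))"
  have G: "G \<in> carrier_mat n n" "transpose_mat G = G" and H: "H \<in> carrier_mat n n" "transpose_mat H = H"
    by (auto simp: G_def H_def mat_diag_def intro!: eq_matI)
  have GH: "G * H = 1\<^sub>m n" "H * G = 1\<^sub>m n"
  proof -
    have "mat_diag n (\<lambda>k. 1 / sqrt (f k) * sqrt (f k)) = 1\<^sub>m n" "mat_diag n (\<lambda>k. sqrt (f k) * (1 / sqrt (f k))) = 1\<^sub>m n"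
      using f0 by (auto simp: mat_diag_def intro!: eq_matI dest!: f0)
    thus "G * H = 1\<^sub>m n" "H * G = 1\<^sub>m n" unfolding G_def H_def mat_diag_diag by auto
  qed
  have GDG: "G * (mat_diag n f * G) = 1\<^sub>m n"
  proof (rule eq_matI)
    fix i j assume "i < dim_row (1\<^sub>m n :: real mat)" "j < dim_col (1\<^sub>m n :: real mat)"
    thus "(G * (mat_diag n f * G)) $$ (i,j) = (1\<^sub>m n :: real mat) $$ (i,j)"
      unfolding G_def mat_diag_diag using f0[of i] by (auto simp: mat_diag_def)
  qed (use G in auto)
  have GG: "G * G = mat_diag n (\<lambda>k. 1 / f k)"
    unfolding G_def mat_diag_diag using f0 by (intro eq_matI) (auto simp: mat_diag_def less_imp_le)
  define P where "P = U * G"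
  have P: "P \<in> carrier_mat n n" "transpose_mat P = G * transpose_mat U"
    using U(1) G by (simp_all add: P_def as)
  have PKP: "transpose_mat P * K * P = 1\<^sub>m n"
  proof -
    have "transpose_mat P * K * P = G * ((transpose_mat U * K * U) * G)"
      unfolding P(2) unfolding P_def using U(1,2,6) G by (simp add: as)
    thus ?thesis using U(7) GDG by simp
  qed
  have PPT: "P * transpose_mat P = R"
  proof -
    have "P * transpose_mat P = U * (G * G) * transpose_mat U"
      unfolding P(2) unfolding P_def using U(1,2) G by (simp add: as)
    also have "\<dots> = R" unfolding GG
      using diagonalizesE(5)[OF diagonalizes_inverse[OF D _ R]] f0 by force
    finally show ?thesis .
  qed
  define C where "C = transpose_mat P * B * P"
  have C: "C \<in> carrier_mat n n" "transpose_mat C = C"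
    using P(1) Bc Bs by (simp_all add: C_def as)
  define Q where "Q = H * transpose_mat U"
  have Q: "Q \<in> carrier_mat n n" "transpose_mat Q = U * H" using U(1) H by (simp_all add: Q_def as)
  have PQ: "P * Q = 1\<^sub>m n"
  proof -
    have "P * Q = U * ((G * H) * transpose_mat U)"
      unfolding P_def Q_def using U(1,2) G H by (simp add: as)
    thus ?thesis using GH U by simp
  qed
  have QP: "Q * P = 1\<^sub>m n" using mat_mult_left_right_inverse[OF P(1) Q(1) PQ] .
  have Cpd: "pos_def n C"
    unfolding pos_def_def
  proof (intro conjI ballI impI C)
    fix x :: "real Matrix.vec" assume x: "x \<in> carrier_vec n" "x \<noteq> 0\<^sub>v n"
    have "P *\<^sub>v x \<noteq> 0\<^sub>v n"
    proof
      assume "P *\<^sub>v x = 0\<^sub>v n"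
      hence "Q *\<^sub>v (P *\<^sub>v x) = 0\<^sub>v n" using Q(1) by (intro eq_vecI) auto
      thus False using x QP Q(1) P(1) by (simp add: assoc_mult_mat_vec[symmetric, of _ n n _ n])
    qed
    moreover have "P *\<^sub>v x \<in> carrier_vec n" using P x by simp
    ultimately show "x \<bullet> (C *\<^sub>v x) > 0"
      unfolding C_def quadratic_form_congruence[OF Bc P(1) x(1)] using B by (auto simp: pos_def_def)
  qed
  obtain W c where E: "diagonalizes n W c C" and c: "\<And>k. k < n \<Longrightarrow> c k > 0"
    using pos_def_diagonalizes[OF Cpd] by blast
  note W = diagonalizesE[OF E]
  define x where "x = sqrt (\<Sum>k<n. (c k - 1)\<^sup>2)"
  have x0: "x \<ge> 0" by (simp add: x_def sum_nonneg)
  \<comment> \<open>The squared determinant of \<open>P\<close> is the reciprocal of that of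
    \<open>K\<close>, so the eigenvalues \<open>c\<close> of \<open>C\<close> multiply to the
    quotient of the determinants of \<open>B\<close> and \<open>K\<close>.\<close>
  have dets: "Determinant.det P * Determinant.det P * Determinant.det K = 1"
    "Determinant.det P * Determinant.det P * Determinant.det B = (\<Prod>k<n. c k)"
  proof -
    have "Determinant.det (transpose_mat P * K * P) = Determinant.det P * Determinant.det P * Determinant.det K"
      using P(1) U(6) by (simp add: det_mult[of _ n] as(2) det_transpose mult_ac)
    thus "Determinant.det P * Determinant.det P * Determinant.det K = 1" by (simp add: PKP)
    have "Determinant.det C = Determinant.det P * Determinant.det P * Determinant.det B"
      unfolding C_def using P(1) Bc by (simp add: det_mult[of _ n] as(2) det_transpose mult_ac)
    thus "Determinant.det P * Determinant.det P * Determinant.det B = (\<Prod>k<n. c k)"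
      by (simp add: diagonalizes_det[OF E])
  qed
  have dK: "Determinant.det K > 0" using spectrum_within_pos_def[OF K m] by (rule pos_def_det_pos)
  have "Determinant.det B = Determinant.det K * (\<Prod>k<n. c k)"
  proof -
    have "Determinant.det B = (Determinant.det P * Determinant.det P * Determinant.det K) * Determinant.det B"
      unfolding dets(1) by simp
    also have "\<dots> = Determinant.det K * (Determinant.det P * Determinant.det P * Determinant.det B)"
      by (simp only: mult_ac)
    finally show ?thesis by (simp only: dets(2))
  qed
  hence "ln (Determinant.det B) = ln (Determinant.det K) + (\<Sum>k<n. ln (c k))"
  proof -
    have "ln (\<Prod>k<n. c k) = (\<Sum>k<n. ln (c k))" by (rule ln_prod) (use c in force)+
    moreover have "(\<Prod>k<n. c k) > 0" using c by (intro prod_pos) auto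
    ultimately show ?thesis using dK \<open>Determinant.det B = _\<close> by (simp add: ln_mult_pos)
  qed
  also have "\<dots> \<le> ln (Determinant.det K) + ((\<Sum>k<n. c k - 1) - x\<^sup>2 / (2 * (1 + x)))"
    using sum_ln_le_minus_quadratic[of n c] c by (simp add: x_def)
  \<comment> \<open>The left side is the trace of \<open>C\<close> minus \<open>n\<close>. Since
    \<open>P * transpose_mat P = R\<close>, cyclicity turns the trace of \<open>C\<close> into that
    of \<open>R * B\<close>, and \<open>n\<close> is the trace of \<open>R * K\<close>.\<close>
  also have "(\<Sum>k<n. c k - 1) = mat_trace (R * (B - K))"
  proof -
    have "mat_trace C = mat_trace (transpose_mat P * (B * P))"
      unfolding C_def using P(1) Bc by (simp add: as)
    also have "\<dots> = mat_trace ((B * P) * transpose_mat P)"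
      using P(1) Bc by (intro mat_trace_mult_commute[of _ n n]) (auto simp: as)
    also have "\<dots> = mat_trace (R * B)"
      using P(1) Bc R PPT by (simp add: as mat_trace_mult_commute[of B n n R])
    finally have "mat_trace C = mat_trace (R * B)" .
    moreover have "R * (B - K) = R * B - 1\<^sub>m n"
      using R Bc U(6) by (simp add: mult_minus_distrib_mat[of _ n n _ n])
    hence "mat_trace (R * (B - K)) = mat_trace (R * B) - real n"
      using R Bc by (simp add: mat_trace_def sum_subtractf)
    ultimately show ?thesis using diagonalizes_trace[OF E] by (simp add: sum_subtractf)
  qed
  finally have ln: "ln (Determinant.det B) \<le> ln (Determinant.det K) + mat_trace (R * (B - K)) - x\<^sup>2 / (2 * (1 + x))"
    by simp
  \<comment> \<open>In whitened coordinates the error \<open>B - K\<close> becomes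
    \<open>C - 1\<close>, with eigenvalues \<open>c k - 1\<close> and hence squared Frobenius norm
    \<open>x\<close> squared. Undoing the whitening costs at most a factor \<open>L\<close>.\<close>
  define E1 where "E1 = C - 1\<^sub>m n"
  have E1: "E1 \<in> carrier_mat n n" unfolding E1_def by (rule minus_carrier_mat) simp
  have "E1 = W * mat_diag n (\<lambda>k. c k - 1) * transpose_mat W"
  proof -
    have "mat_diag n (\<lambda>k. c k - 1) = mat_diag n c - 1\<^sub>m n" by (rule eq_matI) (auto simp: mat_diag_def)
    thus ?thesis unfolding E1_def using W(1-5)
      by (simp add: minus_mult_distrib_mat[of _ n n _ _ n] mult_minus_distrib_mat[of _ n n _ n] as)
  qed
  hence "diagonalizes n W (\<lambda>k. c k - 1) E1" using W(1-4) by (simp add: diagonalizes_def)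
  hence fE: "frob_sq E1 = x\<^sup>2" by (simp add: diagonalizes_frob_sq x_def sum_nonneg)
  have QCQ: "transpose_mat Q * C * Q = B"
  proof -
    have "transpose_mat Q * C * Q = transpose_mat (P * Q) * B * (P * Q)"
      unfolding C_def using P(1) Q(1) Bc by (simp add: as)
    thus ?thesis using PQ Bc by (simp add: transpose_one)
  qed
  have QQ: "transpose_mat Q * Q = K"
  proof -
    have "transpose_mat Q * Q = transpose_mat Q * (transpose_mat P * K * P) * Q"
      unfolding PKP using Q(1) by (simp add: right_mult_one_mat[of _ n n])
    also have "\<dots> = transpose_mat (P * Q) * K * (P * Q)" using P(1) Q(1) U(6) by (simp add: as)
    finally show ?thesis using PQ U(6) by (simp add: transpose_one)
  qed
  have "B - K = transpose_mat Q * E1 * Q"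
    unfolding E1_def using C Q(1) QCQ QQ
    by (simp add: minus_mult_distrib_mat[of _ n n _ _ n] mult_minus_distrib_mat[of _ n n _ n])
  also have "\<dots> = U * (H * E1 * H) * transpose_mat U"
    unfolding Q(2) unfolding Q_def using U(1,2) H E1 by (simp add: as)
  finally have "frob_sq (B - K) = frob_sq (H * E1 * H)"
    using frob_sq_orthogonal[OF U(1,3), of "H * E1 * H"] H E1 by (simp add: as)
  also have "\<dots> = (\<Sum>i<n. \<Sum>j<n. (sqrt (f i) * E1 $$ (i,j) * sqrt (f j))\<^sup>2)"
  proof -
    have "H * E1 * H = Matrix.mat n n (\<lambda>(i,j). sqrt (f i) * E1 $$ (i,j) * sqrt (f j))"
      unfolding H_def using E1
      by (subst mat_diag_mult_left[OF E1], subst mat_diag_mult_right[of _ n n]) (auto intro!: eq_matI)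
    thus ?thesis by (simp add: frob_sq_def)
  qed
  \<comment> \<open>Conjugation by the diagonal \<open>H\<close> only multiplies entry
    \<open>(i,j)\<close> by \<open>sqrt (f i) * sqrt (f j)\<close>, which is at most
    \<open>L\<close>.\<close>
  also have "\<dots> \<le> (\<Sum>i<n. \<Sum>j<n. L\<^sup>2 * (E1 $$ (i,j))\<^sup>2)"
  proof (intro sum_mono)
    fix i j assume ij: "i \<in> {..<n}" "j \<in> {..<n}"
    have "(sqrt (f i) * E1 $$ (i,j) * sqrt (f j))\<^sup>2 = f i * f j * (E1 $$ (i,j))\<^sup>2"
      using f0[of i] f0[of j] ij by (simp add: power_mult_distrib)
    also have "\<dots> \<le> L\<^sup>2 * (E1 $$ (i,j))\<^sup>2"
      using f[of i] f[of j] f0[of i] f0[of j] ij unfolding power2_eq_square[of L]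
      by (intro mult_right_mono mult_mono) auto
    finally show "(sqrt (f i) * E1 $$ (i,j) * sqrt (f j))\<^sup>2 \<le> L\<^sup>2 * (E1 $$ (i,j))\<^sup>2" .
  qed
  also have "\<dots> = L\<^sup>2 * frob_sq E1" using E1 by (simp add: frob_sq_def sum_distrib_left)
  finally have "frob_sq (B - K) \<le> (L * x)\<^sup>2" by (simp add: fE power_mult_distrib)
  thus ?thesis using x0 ln by blast
qed

section \<open>Spectral bounds and diagonal scaling\<close>

text \<open>All \<open>f k\<close> of a diagonalization lie in the finite set
  \<open>spectrum A\<close>, hence between its \<open>Min\<close> and \<open>Max\<close>. Positive
  dimension makes this set nonempty, without which \<open>Min\<close> and \<open>Max\<close> say
  nothing.\<close>

lemma eig_bounds:
  assumes A: "A \<in> carrier_mat n n" "transpose_mat A = A" and n: "n > 0"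
  shows "spectrum_within n (eig_min A) (eig_max A) A" "eigenvalue A (eig_min A)" "eig_min A \<le> eig_max A"
proof -
  obtain U f where D: "diagonalizes n U f A"
    using real_spectral_theorem[OF A] unfolding diagonalizes_def by blast
  have fin: "finite (spectrum A)" using card_finite_spectrum(1)[OF A(1)] .
  have mem: "f k \<in> spectrum A" if k: "k < n" for k
  proof -
    have "col U k \<noteq> 0\<^sub>v n" using diagonalizes_col(1,2)[OF D k] by auto
    hence "eigenvector A (col U k) (f k)"
      using diagonalizes_col[OF D k] A by (auto simp: eigenvector_def)
    thus ?thesis by (auto simp: spectrum_def eigenvalue_def)
  qed
  hence ne: "spectrum A \<noteq> {}" using n by auto
  show "spectrum_within n (eig_min A) (eig_max A) A"
    unfolding eig_min_def eig_max_def
    by (rule diagonalizes_spectrum_within[OF D]) (use fin mem in auto)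
  show "eigenvalue A (eig_min A)" using Min_in[OF fin ne] by (simp add: eig_min_def spectrum_def)
  show "eig_min A \<le> eig_max A" unfolding eig_min_def eig_max_def
    using fin ne by (meson Max_ge Min_in)
qed

lemma spectrum_within_mono:
  assumes "spectrum_within n m L A" "m' \<le> m" "L \<le> L'"
  shows "spectrum_within n m' L' A"
proof -
  have nn: "x \<bullet> x \<ge> 0" if "x \<in> carrier_vec n" for x :: "real Matrix.vec"
    unfolding scalar_prod_self_eq_sum[OF that] by (simp add: sum_nonneg)
  have "m' * (x \<bullet> x) \<le> m * (x \<bullet> x)" "L * (x \<bullet> x) \<le> L' * (x \<bullet> x)" if "x \<in> carrier_vec n" for x :: "real Matrix.vec"
    using nn[OF that] assms by (auto intro: mult_right_mono)
  thus ?thesis using assms unfolding spectrum_within_def by (meson order_trans)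
qed

text \<open>For positive \<open>eig_min A\<close> both summands are positive, so a bound on the sum
  bounds each. Invertibility excludes a zero eigenvalue, for which \<open>1 / eig_min A\<close>
  would be 0 by convention and the bound would carry no information.\<close>

lemma pos_semidef_invertible_spectrum_within:
  assumes A: "pos_semidef n A" and inv: "invertible_mat A" and n: "n > 0"
    and C: "\<bar>eig_max A + 1 / eig_min A\<bar> \<le> C"
  shows "spectrum_within n (1 / C) C A"
proof -
  have Ac: "A \<in> carrier_mat n n" "transpose_mat A = A" using A by (auto simp: pos_semidef_def)
  note eig = eig_bounds[OF Ac n]
  obtain v where "eigenvector A v (eig_min A)" using eig(2) by (auto simp: eigenvalue_def)
  hence v: "v \<in> carrier_vec n" "v \<noteq> 0\<^sub>v n" "A *\<^sub>v v = eig_min A \<cdot>\<^sub>v v"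
    using Ac by (auto simp: eigenvector_def)
  have vv: "v \<bullet> v > 0" using scalar_prod_self_pos v by blast
  have "v \<bullet> (A *\<^sub>v v) = eig_min A * (v \<bullet> v)" unfolding v(3) using v(1) by simp
  hence ge: "eig_min A \<ge> 0" using A v vv by (metis pos_semidef_def zero_le_mult_iff not_less)
  have "eig_min A \<noteq> 0"
  proof
    assume 0: "eig_min A = 0"
    obtain B where B: "B * A = 1\<^sub>m (dim_row B)" "A * B = 1\<^sub>m n"
      using inv Ac unfolding invertible_mat_def inverts_mat_def by auto
    have "dim_col B = n" using arg_cong[OF B(2), of dim_col] by simp
    moreover have "dim_row B = n" using arg_cong[OF B(1), of dim_col] Ac by simp
    ultimately have Bc: "B \<in> carrier_mat n n" by auto
    have "v = B *\<^sub>v (A *\<^sub>v v)" using B(1) Bc Ac(1) v(1) by (simp add: assoc_mult_mat_vec[symmetric, of _ n n _ n])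
    also have "A *\<^sub>v v = 0\<^sub>v n" unfolding v(3) 0 using v(1) by (intro eq_vecI) auto
    also have "B *\<^sub>v 0\<^sub>v n = 0\<^sub>v n" using Bc by (intro eq_vecI) auto
    finally show False using v by simp
  qed
  hence pos: "eig_min A > 0" using ge by simp
  hence "eig_max A > 0" "1 / eig_min A > 0" using eig(3) by auto
  hence "eig_max A \<le> C" "1 / eig_min A \<le> C" using C by linarith+
  moreover from this pos have "C > 0" by (smt (verit) zero_less_divide_1_iff)
  ultimately show ?thesis using pos
    by (intro spectrum_within_mono[OF eig(1)]) (auto simp: field_simps)
qed

text \<open>The test vector is the \<open>i\<close>-th unit vector plus \<open>c\<close> times the
  \<open>j\<close>-th. Adding the two indicators keeps the formula valid for
  \<open>i = j\<close>.\<close>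

lemma quadratic_form_two_coords:
  fixes A :: "real mat" and c :: real
  assumes A: "A \<in> carrier_mat n n" and ij: "i < n" "j < n"
  defines "x \<equiv> Matrix.vec n (\<lambda>k. (if k = i then 1 else 0) + (if k = j then c else 0))"
  shows "x \<bullet> (A *\<^sub>v x) = A $$ (i,i) + c * A $$ (i,j) + c * A $$ (j,i) + c\<^sup>2 * A $$ (j,j)"
proof -
  have "x \<bullet> (A *\<^sub>v x) = (\<Sum>k<n. \<Sum>l<n. A $$ (k,l) * ((if k = i then 1 else 0) + (if k = j then c else 0))
      * ((if l = i then 1 else 0) + (if l = j then c else 0)))"
    by (subst quadratic_form_eq_sum[OF A]) (simp_all add: x_def)
  also have "\<dots> = (\<Sum>k<n. ((if k = i then 1 else 0) + (if k = j then c else 0)) * (A $$ (k,i) + c * A $$ (k,j)))"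
  proof (intro sum.cong refl)
    fix k
    let ?a = "(if k = i then 1 else 0) + (if k = j then c else 0)"
    have "(\<Sum>l<n. A $$ (k,l) * ?a * ((if l = i then 1 else 0) + (if l = j then c else 0)))
      = (\<Sum>l<n. (if l = i then ?a * A $$ (k,l) else 0) + (if l = j then ?a * (c * A $$ (k,l)) else 0))"
      by (intro sum.cong refl) (simp add: algebra_simps)
    also have "\<dots> = ?a * (A $$ (k,i) + c * A $$ (k,j))"
      unfolding sum.distrib using ij by (simp add: distrib_left)
    finally show "(\<Sum>l<n. A $$ (k,l) * ?a * ((if l = i then 1 else 0) + (if l = j then c else 0)))
      = ?a * (A $$ (k,i) + c * A $$ (k,j))" .
  qed
  also have "\<dots> = (\<Sum>k<n. (if k = i then A $$ (k,i) + c * A $$ (k,j) else 0)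
      + (if k = j then c * (A $$ (k,i) + c * A $$ (k,j)) else 0))"
    by (intro sum.cong refl) (simp add: algebra_simps)
  also have "\<dots> = A $$ (i,i) + c * A $$ (i,j) + c * A $$ (j,i) + c\<^sup>2 * A $$ (j,j)"
    unfolding sum.distrib using ij by (simp add: algebra_simps power2_eq_square)
  finally show ?thesis .
qed

text \<open>Tests with the sum and the difference of two unit vectors. For a matrix of unit diagonal
  this bounds every entry by 1; in general it bounds every entry by the largest diagonal
  one.\<close>

lemma pos_semidef_entry_le:
  assumes A: "pos_semidef n A" and ij: "i < n" "j < n"
  shows "2 * \<bar>A $$ (i,j)\<bar> \<le> A $$ (i,i) + A $$ (j,j)" "A $$ (i,i) \<ge> 0"
proof -
  have Ac: "A \<in> carrier_mat n n" "transpose_mat A = A"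
    and psd: "\<And>x. x \<in> carrier_vec n \<Longrightarrow> x \<bullet> (A *\<^sub>v x) \<ge> 0"
    using A by (auto simp: pos_semidef_def)
  have s: "A $$ (j,i) = A $$ (i,j)" using symmetric_mat_index[OF Ac ij] .
  have q: "A $$ (i,i) + c * A $$ (i,j) + c * A $$ (i,j) + c\<^sup>2 * A $$ (j,j) \<ge> 0" for c
    using quadratic_form_two_coords[OF Ac(1) ij, of c] s
      psd[of "Matrix.vec n (\<lambda>k. (if k = i then 1 else 0) + (if k = j then c else 0))"] by simp
  show "2 * \<bar>A $$ (i,j)\<bar> \<le> A $$ (i,i) + A $$ (j,j)" using q[of 1] q[of "-1"] by simp
  show "A $$ (i,i) \<ge> 0" using q[of 0] by simp
qed

lemma spectrum_within_pos_semidef: "spectrum_within n m L A \<Longrightarrow> m \<ge> 0 \<Longrightarrow> pos_semidef n A"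
proof -
  assume A: "spectrum_within n m L A" and m: "m \<ge> 0"
  have "x \<bullet> (A *\<^sub>v x) \<ge> 0" if x: "x \<in> carrier_vec n" for x
  proof -
    have "0 \<le> m * (x \<bullet> x)" using m unfolding scalar_prod_self_eq_sum[OF x] by (simp add: sum_nonneg)
    thus ?thesis using A x unfolding spectrum_within_def by force
  qed
  thus ?thesis using A by (auto simp: spectrum_within_def pos_semidef_def)
qed

lemma spectrum_within_diag:
  assumes A: "spectrum_within n m L A" and i: "i < n"
  shows "m \<le> A $$ (i,i)" "A $$ (i,i) \<le> L"
proof -
  have Ac: "A \<in> carrier_mat n n" using A by (simp add: spectrum_within_def)
  have "unit_vec n i \<bullet> (A *\<^sub>v unit_vec n i) = A $$ (i,i)"
    using Ac i by (simp add: mult_mat_unit_vec scalar_prod_left_unit[of _ n])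
  moreover have "unit_vec n i \<bullet> unit_vec n i = (1::real)" using i by simp
  ultimately show "m \<le> A $$ (i,i)" "A $$ (i,i) \<le> L"
    using A unfolding spectrum_within_def by (metis mult.right_neutral unit_vec_carrier)+
qed

lemma spectrum_within_entry_le:
  assumes A: "spectrum_within n m L A" and m: "m \<ge> 0" and ij: "i < n" "j < n"
  shows "\<bar>A $$ (i,j)\<bar> \<le> L"
  using pos_semidef_entry_le(1)[OF spectrum_within_pos_semidef[OF A m] ij]
    spectrum_within_diag[OF A ij(1)] spectrum_within_diag[OF A ij(2)] by simp

text \<open>A Euclidean operator norm bound: \<open>- L \<le> m\<close> makes \<open>L\<close> a
  bound for the absolute values of the eigenvalues, also for indefinite matrices.\<close>

lemma spectrum_within_mult_vec:
  assumes A: "spectrum_within n m L A" and m: "- L \<le> m" and x: "x \<in> carrier_vec n"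
  shows "(A *\<^sub>v x) \<bullet> (A *\<^sub>v x) \<le> L\<^sup>2 * (x \<bullet> x)"
proof -
  obtain U f where D: "diagonalizes n U f A" and f: "\<And>k. k < n \<Longrightarrow> m \<le> f k \<and> f k \<le> L"
    using spectrum_within_diagonalizes[OF A] by blast
  have "(f k)\<^sup>2 \<le> L\<^sup>2" if "k < n" for k
    using f[OF that] m by (intro abs_le_square_iff[THEN iffD1]) linarith
  thus ?thesis unfolding diagonalizes_quadratic_form[OF D x] sum_distrib_left
    by (intro sum_mono mult_right_mono) auto
qed

section \<open>Inverses, diagonal congruence and the correlation matrix\<close>

lemma minv_eq:
  assumes A: "A \<in> carrier_mat n n" and B: "B \<in> carrier_mat n n" "B * A = 1\<^sub>m n"
  shows "minv A = B"
proof -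
  have AB: "A * B = 1\<^sub>m n" using mat_mult_left_right_inverse[OF B(1) A B(2)] .
  have "A \<in> Units (ring_mat TYPE(real) n ())"
    using A B AB by (auto simp: Units_def ring_mat_def)
  then obtain C where C: "mat_inverse A = Some C" using mat_inverse(1)[OF A, where b="()"] by (cases "mat_inverse A") auto
  from mat_inverse(2)[OF A C] have "B = C" using left_inverse_unique[OF A B(1) _ B(2)] by blast
  thus ?thesis using C by (simp add: minv_def)
qed

lemma minv_pos_def:
  assumes A: "pos_def n A"
  shows "minv A \<in> carrier_mat n n" "minv A * A = 1\<^sub>m n" "A * minv A = 1\<^sub>m n"
proof -
  obtain U f where D: "diagonalizes n U f A" and f: "\<And>k. k < n \<Longrightarrow> f k > 0"
    using pos_def_diagonalizes[OF A] by blast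
  note U = diagonalizesE[OF D]
  let ?B = "U * mat_diag n (\<lambda>k. 1 / f k) * transpose_mat U"
  have D': "diagonalizes n U (\<lambda>k. 1 / f k) ?B" using U(1-4) by (simp add: diagonalizes_def)
  have "?B * A = U * mat_diag n (\<lambda>k. 1 / f k * f k) * transpose_mat U"
    using diagonalizesE(5)[OF diagonalizes_mult_eq[OF D' D]] .
  also have "mat_diag n (\<lambda>k. 1 / f k * f k) = 1\<^sub>m n"
    using f by (intro eq_matI) (auto simp: mat_diag_def dest!: f)
  also have "U * 1\<^sub>m n * transpose_mat U = 1\<^sub>m n" using U by simp
  finally have BA: "?B * A = 1\<^sub>m n" .
  have B: "?B \<in> carrier_mat n n" using diagonalizesE(6)[OF D'] .
  have "minv A = ?B" using minv_eq[OF U(6) B BA] .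
  thus "minv A \<in> carrier_mat n n" "minv A * A = 1\<^sub>m n" "A * minv A = 1\<^sub>m n"
    using B BA mat_mult_left_right_inverse[OF B U(6) BA] by auto
qed

text \<open>Congruence by a diagonal matrix: the passage between covariance and correlation scale,
  for the matrices as well as for their inverses.\<close>

definition scale_mat :: "nat \<Rightarrow> (nat \<Rightarrow> real) \<Rightarrow> real mat \<Rightarrow> real mat" where
  "scale_mat n v A = mat_diag n v * A * mat_diag n v"

lemma mat_diag_transpose: "transpose_mat (mat_diag n v) = mat_diag n v"
  by (rule eq_matI) (auto simp: mat_diag_def)

lemma scale_mat_carrier [simp]: "A \<in> carrier_mat n n \<Longrightarrow> scale_mat n v A \<in> carrier_mat n n"
  unfolding scale_mat_def by (metis mat_diag_dim mult_carrier_mat)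

lemma scale_mat_index [simp]:
  assumes "A \<in> carrier_mat n n" "i < n" "j < n"
  shows "scale_mat n v A $$ (i,j) = v i * A $$ (i,j) * v j"
  unfolding scale_mat_def using assms
  by (subst mat_diag_mult_left[OF assms(1)], subst mat_diag_mult_right[of _ n n]) auto

lemma scale_mat_scale_mat:
  assumes "A \<in> carrier_mat n n" "\<And>i. i < n \<Longrightarrow> v i * w i = 1"
  shows "scale_mat n v (scale_mat n w A) = A"
proof (rule eq_matI)
  fix i j assume "i < dim_row A" "j < dim_col A"
  hence ij: "i < n" "j < n" using assms by auto
  have "scale_mat n v (scale_mat n w A) $$ (i,j) = (v i * w i) * A $$ (i,j) * (v j * w j)"
    using assms(1) ij by simp
  thus "scale_mat n v (scale_mat n w A) $$ (i,j) = A $$ (i,j)" using assms(2) ij by simp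
qed (use assms scale_mat_carrier[of A n] scale_mat_carrier[of "scale_mat n w A" n v] in \<open>metis carrier_matD\<close>)+

lemma scale_mat_symmetric:
  assumes "A \<in> carrier_mat n n" "transpose_mat A = A"
  shows "transpose_mat (scale_mat n v A) = scale_mat n v A"
  using assms unfolding scale_mat_def
  by (simp add: transpose_mult[of _ n n _ n] mult_carrier_mat[of _ n n _ n] assoc_mult_mat[of _ n n _ n _ n] mat_diag_transpose)

lemma scale_mat_quadratic_form:
  assumes "A \<in> carrier_mat n n" "x \<in> carrier_vec n"
  shows "x \<bullet> (scale_mat n v A *\<^sub>v x) = (mat_diag n v *\<^sub>v x) \<bullet> (A *\<^sub>v (mat_diag n v *\<^sub>v x))"
  using quadratic_form_congruence[of A n "mat_diag n v" x] assms by (simp add: scale_mat_def mat_diag_transpose)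

lemma pos_def_scale_mat:
  assumes A: "pos_def n A" and v: "\<And>i. i < n \<Longrightarrow> v i \<noteq> 0"
  shows "pos_def n (scale_mat n v A)"
  unfolding pos_def_def
proof (intro conjI ballI impI)
  have Ac: "A \<in> carrier_mat n n" "transpose_mat A = A" using A by (auto simp: pos_def_def)
  show "scale_mat n v A \<in> carrier_mat n n" "transpose_mat (scale_mat n v A) = scale_mat n v A"
    using Ac scale_mat_symmetric by auto
  fix x :: "real Matrix.vec" assume x: "x \<in> carrier_vec n" "x \<noteq> 0\<^sub>v n"
  obtain k where k: "k < n" "x $ k \<noteq> 0" using x by (metis carrier_vecD eq_vecI index_zero_vec)
  have "(mat_diag n v *\<^sub>v x) $ k \<noteq> 0" using mat_diag_mult_vec[OF x(1) k(1), of v] k v by simp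
  hence "mat_diag n v *\<^sub>v x \<noteq> 0\<^sub>v n" using k by auto
  moreover have "mat_diag n v *\<^sub>v x \<in> carrier_vec n" using x by (metis mat_diag_dim mult_mat_vec_carrier)
  ultimately show "x \<bullet> (scale_mat n v A *\<^sub>v x) > 0"
    unfolding scale_mat_quadratic_form[OF Ac(1) x(1)] using A by (auto simp: pos_def_def)
qed

lemma pos_semidef_scale_mat:
  assumes A: "pos_semidef n A"
  shows "pos_semidef n (scale_mat n v A)"
  unfolding pos_semidef_def
proof (intro conjI ballI impI)
  have Ac: "A \<in> carrier_mat n n" "transpose_mat A = A" using A by (auto simp: pos_semidef_def)
  show "scale_mat n v A \<in> carrier_mat n n" "transpose_mat (scale_mat n v A) = scale_mat n v A"
    using Ac scale_mat_symmetric by auto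
  fix x :: "real Matrix.vec" assume x: "x \<in> carrier_vec n"
  have "mat_diag n v *\<^sub>v x \<in> carrier_vec n" using x by (metis mat_diag_dim mult_mat_vec_carrier)
  thus "x \<bullet> (scale_mat n v A *\<^sub>v x) \<ge> 0"
    unfolding scale_mat_quadratic_form[OF Ac(1) x] using A by (auto simp: pos_semidef_def)
qed

text \<open>The form at \<open>x\<close> is the form of \<open>A\<close> at the rescaled vector
  \<open>y\<close>, whose squared norm lies between \<open>a\<close> and \<open>b\<close> times that
  of \<open>x\<close>. Nonnegative \<open>m\<close> and \<open>L\<close> let these two-sided bounds
  be multiplied.\<close>

lemma spectrum_within_scale_mat:
  assumes A: "spectrum_within n m L A" and m: "m \<ge> 0" "L \<ge> 0" and v: "\<And>i. i < n \<Longrightarrow> a \<le> (v i)\<^sup>2 \<and> (v i)\<^sup>2 \<le> b"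
  shows "spectrum_within n (m * a) (L * b) (scale_mat n v A)"
  unfolding spectrum_within_def
proof (intro conjI ballI impI)
  have Ac: "A \<in> carrier_mat n n" "transpose_mat A = A" using A by (auto simp: spectrum_within_def)
  show "scale_mat n v A \<in> carrier_mat n n" "transpose_mat (scale_mat n v A) = scale_mat n v A"
    using Ac scale_mat_symmetric by auto
  fix x :: "real Matrix.vec" assume x: "x \<in> carrier_vec n"
  define y where "y = mat_diag n v *\<^sub>v x"
  have y: "y \<in> carrier_vec n" using x unfolding y_def by (metis mat_diag_dim mult_mat_vec_carrier)
  have yy: "y \<bullet> y = (\<Sum>i<n. (v i)\<^sup>2 * (x $ i)\<^sup>2)"
    unfolding scalar_prod_self_eq_sum[OF y]
    by (intro sum.cong refl) (simp add: y_def mat_diag_mult_vec[OF x] power_mult_distrib)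
  have 1: "a * (x \<bullet> x) \<le> y \<bullet> y" "y \<bullet> y \<le> b * (x \<bullet> x)"
    unfolding yy scalar_prod_self_eq_sum[OF x] sum_distrib_left
    by (auto intro!: sum_mono mult_right_mono simp: v)
  have 2: "m * (y \<bullet> y) \<le> y \<bullet> (A *\<^sub>v y)" "y \<bullet> (A *\<^sub>v y) \<le> L * (y \<bullet> y)"
    using A y by (auto simp: spectrum_within_def)
  show "m * a * (x \<bullet> x) \<le> x \<bullet> (scale_mat n v A *\<^sub>v x)" "x \<bullet> (scale_mat n v A *\<^sub>v x) \<le> L * b * (x \<bullet> x)"
    unfolding scale_mat_quadratic_form[OF Ac(1) x] y_def[symmetric]
    using 2 mult_left_mono[OF 1(1) m(1)] mult_left_mono[OF 1(2) m(2)] by (simp_all add: mult.assoc)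
qed

lemma correlation_eq_scale_mat:
  assumes S: "S \<in> carrier_mat n n" and pos: "\<And>i. i < n \<Longrightarrow> S $$ (i,i) > 0"
  shows "correlation S = scale_mat n (\<lambda>i. 1 / sqrt (S $$ (i,i))) S"
proof -
  let ?D = "mat_diag n (\<lambda>i. 1 / sqrt (S $$ (i,i)))"
  have "?D * mat_diag n (\<lambda>i. sqrt (S $$ (i,i))) = 1\<^sub>m n"
    unfolding mat_diag_diag by (intro eq_matI) (auto simp: mat_diag_def dest!: pos)
  hence "minv (diag_sqrt S) = ?D"
    using S by (intro minv_eq[of _ n]) (auto simp: diag_sqrt_def)
  thus ?thesis by (simp add: correlation_def scale_mat_def)
qed

section \<open>Existence of the graphical Lasso estimator\<close>

definition off_l1 :: "real mat \<Rightarrow> real" where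
  "off_l1 K = (\<Sum>i<dim_row K. \<Sum>j<dim_col K. if i = j then 0 else \<bar>K $$ (i,j)\<bar>)"

text \<open>The objective of \<open>K_hat\<close> with the penalty as a double sum. The objective of
  \<open>Theta_hat\<close> turns into this one, up to a constant, after diagonal rescaling.\<close>

definition glasso_objective :: "real mat \<Rightarrow> real \<Rightarrow> real mat \<Rightarrow> real" where
  "glasso_objective R l K = mat_trace (K * R) - ln (Determinant.det K) + l * off_l1 K"

lemma pos_def_imp_pos_semidef:
  assumes "pos_def n A"
  shows "pos_semidef n A"
  unfolding pos_semidef_def
proof (intro conjI ballI)
  fix x :: "real Matrix.vec" assume x: "x \<in> carrier_vec n"
  have Ac: "A \<in> carrier_mat n n" using assms by (simp add: pos_def_def)
  show "x \<bullet> (A *\<^sub>v x) \<ge> 0"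
  proof (cases "x = 0\<^sub>v n")
    case True
    thus ?thesis unfolding quadratic_form_eq_sum[OF Ac x] by simp
  qed (use assms x in \<open>force simp: pos_def_def\<close>)
qed (use assms in \<open>auto simp: pos_def_def\<close>)

lemma pos_semidef_congruence:
  assumes A: "pos_semidef n A" and P: "P \<in> carrier_mat n n"
  shows "pos_semidef n (transpose_mat P * A * P)"
proof -
  have Ac: "A \<in> carrier_mat n n" "transpose_mat A = A" using A by (auto simp: pos_semidef_def)
  have "transpose_mat (transpose_mat P * A * P) = transpose_mat P * A * P"
    using Ac P by (simp add: transpose_mult[of _ n n _ n] mult_carrier_mat[of _ n n _ n] assoc_mult_mat[of _ n n _ n _ n])
  moreover have "transpose_mat P * A * P \<in> carrier_mat n n"
    using Ac P by (simp add: mult_carrier_mat[of _ n n _ n])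
  ultimately show ?thesis
    using A P quadratic_form_congruence[OF Ac(1) P] by (auto simp: pos_semidef_def)
qed

text \<open>Only \<open>K\<close> is diagonalized: in its eigenbasis the trace is a sum of positive
  eigenvalues times the nonnegative diagonal entries of the transformed \<open>R\<close>.\<close>

lemma trace_mult_pos_semidef_nonneg:
  assumes K: "pos_def n K" and R: "pos_semidef n R"
  shows "mat_trace (K * R) \<ge> 0"
proof -
  obtain U f where D: "diagonalizes n U f K" and f: "\<And>k. k < n \<Longrightarrow> f k > 0"
    using pos_def_diagonalizes[OF K] by blast
  note U = diagonalizesE[OF D]
  have Rc: "R \<in> carrier_mat n n" using R by (simp add: pos_semidef_def)
  define X where "X = transpose_mat U * R * U"
  have X: "pos_semidef n X" unfolding X_def by (rule pos_semidef_congruence[OF R U(1)])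
  hence Xc: "X \<in> carrier_mat n n" by (simp add: pos_semidef_def)
  note as = assoc_mult_mat[of _ n n _ n _ n] mult_carrier_mat[of _ n n _ n]
  have "mat_trace (K * R) = mat_trace (U * (mat_diag n f * (transpose_mat U * R)))"
    unfolding U(5) using U(1,2) Rc by (simp add: as)
  also have "\<dots> = mat_trace ((mat_diag n f * (transpose_mat U * R)) * U)"
    using U(1,2) Rc by (intro mat_trace_mult_commute[of _ n n]) (auto simp: as)
  also have "\<dots> = mat_trace (mat_diag n f * X)" unfolding X_def using U(1,2) Rc by (simp add: as)
  also have "\<dots> = (\<Sum>k<n. f k * X $$ (k,k))"
    by (subst mat_diag_mult_left[OF Xc]) (simp add: mat_trace_def)
  also have "\<dots> \<ge> 0"
    using f pos_semidef_entry_le(2)[OF X] by (intro sum_nonneg mult_nonneg_nonneg) (auto simp: less_imp_le)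
  finally show ?thesis .
qed

text \<open>The source of coercivity when \<open>R\<close> is singular. The entries of
  \<open>R\<close> have modulus at most 1 and its diagonal is 1, so the trace of
  \<open>K * R\<close> is at least that of \<open>K\<close> minus \<open>off_l1 K\<close>. A
  multiple \<open>min l 1\<close> of this loss is absorbed by the penalty, since both the trace term
  and the penalty are nonnegative.\<close>

lemma glasso_objective_lower_bound:
  assumes K: "pos_def n K" and R: "pos_semidef n R" and diag: "\<And>i. i < n \<Longrightarrow> R $$ (i,i) = 1" and l: "l > 0"
  shows "glasso_objective R l K \<ge> min l 1 * mat_trace K - ln (Determinant.det K)"
proof -
  have Kc: "K \<in> carrier_mat n n" and Rc: "R \<in> carrier_mat n n" using K R by (auto simp: pos_def_def pos_semidef_def)
  let ?t = "min l 1"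
  have R1: "\<bar>R $$ (i,j)\<bar> \<le> 1" if "i < n" "j < n" for i j
    using pos_semidef_entry_le(1)[OF R that] diag that by simp
  have "mat_trace K - off_l1 K = (\<Sum>i<n. \<Sum>j<n. (if i = j then K $$ (i,j) else 0) - (if i = j then 0 else \<bar>K $$ (i,j)\<bar>))"
    using Kc by (simp add: mat_trace_def off_l1_def sum_subtractf)
  also have "\<dots> \<le> (\<Sum>i<n. \<Sum>j<n. K $$ (i,j) * R $$ (j,i))"
  proof (intro sum_mono)
    fix i j assume ij: "i \<in> {..<n}" "j \<in> {..<n}"
    have "- (K $$ (i,j) * R $$ (j,i)) \<le> \<bar>K $$ (i,j) * R $$ (j,i)\<bar>" by simp
    also have "\<dots> \<le> \<bar>K $$ (i,j)\<bar> * 1" unfolding abs_mult using R1[of j i] ij by (intro mult_left_mono) auto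
    finally show "(if i = j then K $$ (i,j) else 0) - (if i = j then 0 else \<bar>K $$ (i,j)\<bar>) \<le> K $$ (i,j) * R $$ (j,i)"
      using diag ij by auto
  qed
  also have "\<dots> = mat_trace (K * R)" by (rule mat_trace_mult[symmetric, OF Kc Rc])
  finally have 1: "mat_trace K - off_l1 K \<le> mat_trace (K * R)" .
  have off: "off_l1 K \<ge> 0" by (auto simp: off_l1_def intro!: sum_nonneg)
  have "?t * mat_trace K \<le> ?t * mat_trace (K * R) + ?t * off_l1 K"
    using mult_left_mono[OF 1, of ?t] l by (simp add: algebra_simps)
  also have "\<dots> \<le> 1 * mat_trace (K * R) + l * off_l1 K"
    using off trace_mult_pos_semidef_nonneg[OF K R] by (intro add_mono mult_right_mono) auto
  finally show ?thesis by (simp add: glasso_objective_def)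
qed

lemma spectrum_within_scalar_mat:
  "spectrum_within n a a (mat_diag n (\<lambda>_. a))"
proof -
  have "diagonalizes n (1\<^sub>m n) (\<lambda>_. a) (mat_diag n (\<lambda>_. a))"
    by (simp add: diagonalizes_def transpose_one right_mult_one_mat[of _ n n] left_mult_one_mat[of _ n n])
  thus ?thesis by (rule diagonalizes_spectrum_within) auto
qed

text \<open>The tangent inequality of the concave log determinant at \<open>1 / a\<close> times the
  identity, where the gradient is \<open>a\<close> times the identity. As \<open>a\<close> may be
  arbitrarily small, a positive multiple of the trace always dominates.\<close>

lemma ln_det_le_trace:
  assumes a: "a > 0"
  shows "\<exists>c. \<forall>K. pos_def n K \<longrightarrow> ln (Determinant.det K) \<le> c + a * mat_trace K"
proof (intro exI allI impI)
  fix K assume K: "pos_def n K"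
  hence Kc: "K \<in> carrier_mat n n" by (simp add: pos_def_def)
  let ?K = "mat_diag n (\<lambda>_. 1 / a)" and ?R = "mat_diag n (\<lambda>_. a)"
  have "?R * ?K = 1\<^sub>m n" using a by (simp)
  then obtain x where x: "x \<ge> 0" and
    "ln (Determinant.det K) \<le> ln (Determinant.det ?K) + mat_trace (?R * (K - ?K)) - x\<^sup>2 / (2 * (1 + x))"
    using ln_det_strongly_concave[OF spectrum_within_scalar_mat _ K mat_diag_dim] a by (metis zero_less_divide_1_iff)
  moreover have "mat_trace (?R * (K - ?K)) = a * mat_trace K - real n"
    using Kc a by (subst mat_diag_mult_left[of _ n n]) 
      (auto simp: mat_trace_def mat_diag_def sum_subtractf sum_distrib_left right_diff_distrib intro!: minus_carrier_mat)
  moreover have "x\<^sup>2 / (2 * (1 + x)) \<ge> 0" using x by simp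
  ultimately show "ln (Determinant.det K) \<le> (ln (Determinant.det ?K) - real n) + a * mat_trace K" by linarith
qed

text \<open>Positive definiteness is not a closed condition, but semidefiniteness together with a
  positive lower bound on the determinant is; this returns from the closed description to the domain
  of the objective.\<close>

lemma pos_semidef_det_pos_imp_pos_def:
  assumes A: "pos_semidef n A" and det: "Determinant.det A > 0"
  shows "pos_def n A"
proof -
  have Ac: "A \<in> carrier_mat n n" "transpose_mat A = A" using A by (auto simp: pos_semidef_def)
  obtain U f where D: "diagonalizes n U f A"
    using real_spectral_theorem[OF Ac] unfolding diagonalizes_def by blast
  have f: "f k > 0" if "k < n" for k
  proof -
    have "f k \<ge> 0" using A diagonalizes_col[OF D that] by (metis pos_semidef_def)
    moreover have "f k \<noteq> 0"
    proof
      assume "f k = 0"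
      hence "(\<Prod>k<n. f k) = 0" using that by (intro prod_zero) auto
      thus False using det unfolding diagonalizes_det[OF D] by (metis less_irrefl)
    qed
    ultimately show ?thesis by simp
  qed
  show ?thesis
  proof (cases "n = 0")
    case True
    thus ?thesis using Ac by (auto simp: pos_def_def)
  next
    case False
    define m where "m = Min (f ` {..<n})"
    have m: "m > 0" unfolding m_def using f False by (subst Min_gr_iff) auto
    have "spectrum_within n m (Max (f ` {..<n})) A"
      by (rule diagonalizes_spectrum_within[OF D]) (auto simp: m_def)
    thus ?thesis using m by (rule spectrum_within_pos_def)
  qed
qed

text \<open>For the compactness argument a matrix is a function on index pairs, with the product
  topology. By the Leibniz formula the determinant is a polynomial in finitely many of its
  coordinates.\<close>

lemma continuous_on_det_entries:
  "continuous_on UNIV (\<lambda>g :: nat \<times> nat \<Rightarrow> real. Determinant.det (Matrix.mat n n g))"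
proof -
  have "Determinant.det (Matrix.mat n n g) =
    (\<Sum>p\<in>{p. p permutes {0..<n}}. signof p * (\<Prod>i = 0..<n. g (i, p i)))" for g :: "nat \<times> nat \<Rightarrow> real"
  proof -
    have "Determinant.det (Matrix.mat n n g) =
      (\<Sum>p\<in>{p. p permutes {0..<n}}. signof p * (\<Prod>i = 0..<n. Matrix.mat n n g $$ (i, p i)))"
      by (rule det_def') simp
    also have "\<dots> = (\<Sum>p\<in>{p. p permutes {0..<n}}. signof p * (\<Prod>i = 0..<n. g (i, p i)))"
    proof (intro sum.cong refl arg_cong2[of _ _ _ _ "(*)"] prod.cong)
      fix p i assume "p \<in> {p. p permutes {0..<n}}" "i \<in> {0..<n}"
      hence "i < n" "p i < n" using permutes_in_image[of p "{0..<n}" i] by auto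
      thus "Matrix.mat n n g $$ (i, p i) = g (i, p i)" by simp
    qed
    finally show ?thesis .
  qed
  thus ?thesis by (auto intro!: continuous_intros)
qed

text \<open>Matrices at least as good as the identity have bounded trace, hence bounded entries, and
  a determinant bounded away from 0. They lie in a compact set of positive definite matrices on
  which the objective is continuous.\<close>

theorem glasso_minimizer_exists:
  assumes R: "pos_semidef n R" and diag: "\<And>i. i < n \<Longrightarrow> R $$ (i,i) = 1" and l: "l > 0"
  shows "\<exists>K. is_arg_min (glasso_objective R l) (pos_def n) K"
proof -
  let ?F = "glasso_objective R l"
  have Rc: "R \<in> carrier_mat n n" using R by (auto simp: pos_semidef_def)
  define t where "t = min l 1"
  have t: "t > 0" using l by (simp add: t_def)
  obtain c where c: "\<And>K. pos_def n K \<Longrightarrow> ln (Determinant.det K) \<le> c + t / 2 * mat_trace K"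
    using ln_det_le_trace[of "t / 2" n] t by auto
  have one: "pos_def n (1\<^sub>m n)"
    using spectrum_within_pos_def[OF spectrum_within_scalar_mat, of 1 n] by simp
  define f0 where "f0 = ?F (1\<^sub>m n)"
  \<comment> \<open>Half of the coercive term \<open>t * mat_trace K\<close> pays for the log
    determinant; the other half is then at most \<open>f0 + c\<close>, so that \<open>T\<close>
    bounds the trace.\<close>
  define T where "T = (f0 + c) * 2 / t"
  have lower: "t * mat_trace K - ln (Determinant.det K) \<le> ?F K" if "pos_def n K" for K
    using glasso_objective_lower_bound[OF that R diag l] by (simp add: t_def)
  \<comment> \<open>Coordinates outside the \<open>n\<close> by \<open>n\<close> block are pinned to
    0, so that this product over all index pairs is compact.\<close>
  define S where "S = PiE UNIV (\<lambda>ij :: nat \<times> nat. if fst ij < n \<and> snd ij < n then {-T..T} else {0})"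
  \<comment> \<open>Each condition is closed. The bound \<open>exp (- f0)\<close> holds on the
    sublevel set because the trace term in the lower bound of the objective is nonnegative.\<close>
  define Q where "Q = {g :: nat \<times> nat \<Rightarrow> real. (\<forall>i j. g (i,j) = g (j,i)) \<and>
     (\<forall>x. 0 \<le> (\<Sum>i<n. \<Sum>j<n. g (i,j) * x $ i * x $ j)) \<and> exp (- f0) \<le> Determinant.det (Matrix.mat n n g)}"
  have "compactin (product_topology (\<lambda>_. euclidean) UNIV) S"
    unfolding S_def compactin_PiE by auto
  hence "compact S" by (simp add: euclidean_product_topology)
  moreover have "closed Q" unfolding Q_def
    by (intro closed_Collect_conj closed_Collect_all closed_Collect_eq closed_Collect_le
        continuous_intros continuous_on_det_entries continuous_on_product_coordinates)
  ultimately have comp: "compact (S \<inter> Q)" by (rule compact_Int_closed)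
  have pd: "pos_def n (Matrix.mat n n g)" if "g \<in> Q" for g
  proof (rule pos_semidef_det_pos_imp_pos_def)
    show "Determinant.det (Matrix.mat n n g) > 0"
      using that unfolding Q_def by (smt (verit) exp_gt_zero mem_Collect_eq)
    have q: "x \<bullet> (Matrix.mat n n g *\<^sub>v x) = (\<Sum>i<n. \<Sum>j<n. g (i,j) * x $ i * x $ j)" if "x \<in> carrier_vec n" for x
      by (subst quadratic_form_eq_sum[OF _ that]) simp_all
    show "pos_semidef n (Matrix.mat n n g)"
      unfolding pos_semidef_def using that by (auto simp: Q_def q intro!: eq_matI)
  qed
  have mem: "\<exists>g\<in>S \<inter> Q. K = Matrix.mat n n g" if K: "pos_def n K" and le: "?F K \<le> f0" for K
  proof -
    have Kc: "K \<in> carrier_mat n n" "transpose_mat K = K" using K by (auto simp: pos_def_def)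
    have psd: "pos_semidef n K" by (rule pos_def_imp_pos_semidef[OF K])
    have nn: "K $$ (i,i) \<ge> 0" if "i < n" for i using pos_semidef_entry_le(2)[OF psd that] that by simp
    have tr: "K $$ (i,i) \<le> mat_trace K" if "i < n" for i
      unfolding mat_trace_def using Kc nn that by (intro member_le_sum) auto
    have tr0: "mat_trace K \<ge> 0" unfolding mat_trace_def using Kc nn by (intro sum_nonneg) auto
    have "t / 2 * mat_trace K \<le> f0 + c" using lower[OF K] c[OF K] le by (simp add: field_simps)
    hence T: "mat_trace K \<le> T" using t by (simp add: T_def field_simps)
    have "t * mat_trace K \<ge> 0" using t tr0 by simp
    hence "- f0 \<le> ln (Determinant.det K)" using lower[OF K] le by simp
    hence det: "exp (- f0) \<le> Determinant.det K" using pos_def_det_pos[OF K] by (simp add: ln_ge_iff)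
    define g where "g = (\<lambda>(i,j). if i < n \<and> j < n then K $$ (i,j) else 0)"
    have Kg: "Matrix.mat n n g = K" using Kc by (intro eq_matI) (auto simp: g_def)
    have "g ij \<in> {-T..T}" if inb: "fst ij < n \<and> snd ij < n" for ij
    proof -
      obtain i j where ij: "ij = (i,j)" "i < n" "j < n" using inb by (cases ij) auto
      \<comment> \<open>Twice an entry is at most the sum of two diagonal entries, each of which is
        at most the trace.\<close>
      have "\<bar>K $$ (i,j)\<bar> \<le> T" using pos_semidef_entry_le(1)[OF psd ij(2,3)] tr[OF ij(2)] tr[OF ij(3)] T by linarith
      thus ?thesis using ij by (auto simp: g_def)
    qed
    hence "g \<in> S" by (auto simp: S_def) (auto simp: g_def)
    moreover have "g \<in> Q"
    proof -
      have "g (i,j) = g (j,i)" for i j using symmetric_mat_index[OF Kc, of i j] by (auto simp: g_def)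
      \<comment> \<open>The vectors in \<open>Q\<close> carry no dimension constraint; only the
        values at indices below \<open>n\<close> enter, so \<open>x\<close> is replaced by a vector
        of dimension \<open>n\<close> with these values.\<close>
      moreover have "0 \<le> (\<Sum>i<n. \<Sum>j<n. g (i,j) * x $ i * x $ j)" for x :: "real Matrix.vec"
      proof -
        have "0 \<le> Matrix.vec n (\<lambda>i. x $ i) \<bullet> (K *\<^sub>v Matrix.vec n (\<lambda>i. x $ i))"
          using psd by (auto simp: pos_semidef_def)
        also have "\<dots> = (\<Sum>i<n. \<Sum>j<n. g (i,j) * x $ i * x $ j)"
          by (subst quadratic_form_eq_sum[OF Kc(1)]) (auto simp: g_def intro!: sum.cong)
        finally show ?thesis .
      qed
      ultimately show ?thesis using det Kg by (auto simp: Q_def)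
    qed
    ultimately show ?thesis using Kg by blast
  qed
  have obj: "?F (Matrix.mat n n g) = (\<Sum>i<n. \<Sum>j<n. g (i,j) * R $$ (j,i)) - ln (Determinant.det (Matrix.mat n n g))
      + l * (\<Sum>i<n. \<Sum>j<n. if i = j then 0 else \<bar>g (i,j)\<bar>)" for g
    unfolding glasso_objective_def off_l1_def by (subst mat_trace_mult[OF _ Rc]) (auto cong: if_cong)
  have cont: "continuous_on (S \<inter> Q) (\<lambda>g. ?F (Matrix.mat n n g))"
    unfolding obj
  proof (intro continuous_intros)
    show "continuous_on (S \<inter> Q) (\<lambda>g. Determinant.det (Matrix.mat n n g))"
      using continuous_on_det_entries continuous_on_subset by blast
    show "\<forall>g\<in>S \<inter> Q. Determinant.det (Matrix.mat n n g) \<noteq> 0"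
      using pd pos_def_det_pos by (metis IntD2 less_irrefl)
    fix i j
    show "continuous_on (S \<inter> Q) (\<lambda>g. g (i,j))" by (rule continuous_on_subset[OF continuous_on_product_coordinates]) simp
    show "continuous_on (S \<inter> Q) (\<lambda>g. if i = j then 0 else \<bar>g (i,j)\<bar>)"
      by (cases "i = j") (auto intro!: continuous_intros continuous_on_subset[OF continuous_on_product_coordinates])
  qed
  obtain g1 where g1: "g1 \<in> S \<inter> Q" "1\<^sub>m n = Matrix.mat n n g1" using mem[OF one] by (auto simp: f0_def)
  then obtain g where g: "g \<in> S \<inter> Q" "\<And>h. h \<in> S \<inter> Q \<Longrightarrow> ?F (Matrix.mat n n g) \<le> ?F (Matrix.mat n n h)"
    using continuous_attains_inf[OF comp _ cont] by blast
  have "?F (Matrix.mat n n g) \<le> ?F K" if K: "pos_def n K" for K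
  proof (cases "?F K \<le> f0")
    case True
    thus ?thesis using mem[OF K] g(2) by metis
  next
    case False
    thus ?thesis using g(2)[OF g1(1)] g1(2) by (simp add: f0_def)
  qed
  thus ?thesis using pd[of g] g(1) by (intro exI[of _ "Matrix.mat n n g"]) (force simp: is_arg_min_def)
qed

section \<open>Operator norms\<close>

text \<open>Jensen's inequality for the \<open>p\<close>-th power with the weights normalized by
  their total, which is then replaced by its bound \<open>c\<close>.\<close>

lemma weighted_powr_sum_le:
  fixes a z :: "'i \<Rightarrow> real"
  assumes fin: "finite I" and a: "\<And>i. i \<in> I \<Longrightarrow> a i \<ge> 0" and z: "\<And>i. i \<in> I \<Longrightarrow> z i \<ge> 0"
    and c: "(\<Sum>i\<in>I. a i) \<le> c" and p: "p \<ge> 1"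
  shows "(\<Sum>i\<in>I. a i * z i) powr p \<le> c powr (p - 1) * (\<Sum>i\<in>I. a i * z i powr p)"
proof -
  \<comment> \<open>Indices with \<open>z i = 0\<close> contribute to neither sum; on
    \<open>J\<close> the arguments are positive, where convexity of the power is applied.\<close>
  define J where "J = {i\<in>I. z i > 0}"
  have J: "finite J" "J \<subseteq> I" using fin by (auto simp: J_def)
  define b where "b = (\<Sum>i\<in>J. a i)"
  have bc: "b \<le> c" unfolding b_def using sum_mono2[OF fin J(2), of a] a c by force
  have b0: "b \<ge> 0" unfolding b_def using a J by (intro sum_nonneg) auto
  have eq1: "(\<Sum>i\<in>I. a i * z i) = (\<Sum>i\<in>J. a i * z i)"
    using fin z by (intro sum.mono_neutral_right) (auto simp: J_def order.order_iff_strict)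
  have eq2: "(\<Sum>i\<in>I. a i * z i powr p) = (\<Sum>i\<in>J. a i * z i powr p)"
    using fin z by (intro sum.mono_neutral_right) (auto simp: J_def order.order_iff_strict)
  have nn: "(\<Sum>i\<in>J. a i * z i powr p) \<ge> 0" using a J by (intro sum_nonneg) auto
  show ?thesis
  proof (cases "b = 0")
    case True
    hence "a i = 0" if "i \<in> J" for i
      using that a J unfolding b_def by (subst (asm) sum_nonneg_eq_0_iff) auto
    thus ?thesis using eq1 eq2 p by simp
  next
    case False
    hence b: "b > 0" using b0 by simp
    hence "J \<noteq> {}" by (auto simp: b_def)
    have "(\<lambda>x. x powr p) (\<Sum>i\<in>J. (a i / b) *\<^sub>R z i) \<le> (\<Sum>i\<in>J. a i / b * (z i powr p))"
    proof (rule convex_on_sum[OF J(1) \<open>J \<noteq> {}\<close> powr_convex[OF p]])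
      show "(\<Sum>i\<in>J. a i / b) = 1" using b by (simp add: sum_divide_distrib[symmetric] b_def[symmetric])
    qed (use a b J in \<open>auto simp: J_def\<close>)
    also have "(\<Sum>i\<in>J. (a i / b) *\<^sub>R z i) = (\<Sum>i\<in>J. a i * z i) / b"
      by (simp add: sum_divide_distrib)
    also have "(\<Sum>i\<in>J. a i / b * (z i powr p)) = (\<Sum>i\<in>J. a i * z i powr p) / b"
      by (simp add: sum_divide_distrib)
    finally have "b powr p * ((\<Sum>i\<in>J. a i * z i) / b) powr p \<le> b powr p * ((\<Sum>i\<in>J. a i * z i powr p) / b)"
      by (intro mult_left_mono) auto
    moreover have "b powr p * ((\<Sum>i\<in>J. a i * z i) / b) powr p = (\<Sum>i\<in>J. a i * z i) powr p"
      using b a J z by (subst powr_mult[symmetric]) (auto simp: J_def intro!: divide_nonneg_nonneg sum_nonneg)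
    moreover have "b powr p * ((\<Sum>i\<in>J. a i * z i powr p) / b) = b powr (p - 1) * (\<Sum>i\<in>J. a i * z i powr p)"
      using b by (simp add: powr_diff)
    ultimately have "(\<Sum>i\<in>J. a i * z i) powr p \<le> b powr (p - 1) * (\<Sum>i\<in>J. a i * z i powr p)" by simp
    also have "\<dots> \<le> c powr (p - 1) * (\<Sum>i\<in>J. a i * z i powr p)"
      using bc b p nn by (intro mult_right_mono powr_mono2) auto
    finally show ?thesis using eq1 eq2 by simp
  qed
qed

text \<open>A real \<open>Sup\<close> is meaningful only for a nonempty set bounded above. The first
  unit vector has norm 1 for every \<open>w\<close> and supplies a member; as this member is
  nonnegative, the bound extends to the absolute value.\<close>

lemma abs_mat_op_norm_le:
  assumes A: "A \<in> carrier_mat n n" and n: "n > 0"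
    and le: "\<And>x. x \<in> carrier_vec n \<Longrightarrow> vec_lw_norm w x = 1 \<Longrightarrow> vec_lw_norm w (A *\<^sub>v x) \<le> c"
    and w: "w \<ge> 1"
  shows "\<bar>mat_op_norm w A\<bar> \<le> c"
proof -
  let ?S = "{vec_lw_norm w (A *\<^sub>v x) | x. x \<in> carrier_vec (dim_col A) \<and> vec_lw_norm w x = 1}"
  have nn: "vec_lw_norm w x \<ge> 0" if "x \<in> carrier_vec n" for x
  proof (cases "w = \<infinity>")
    case True
    have "\<bar>x $ 0\<bar> \<le> vec_lw_norm w x" unfolding vec_lw_norm_def lw_norm_def using True that n
      by (auto intro!: Max_ge)
    thus ?thesis by (rule order_trans[rotated]) simp
  qed (simp add: vec_lw_norm_def lw_norm_def)
  have "vec_lw_norm w (unit_vec n 0) = 1"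
  proof (cases "w = \<infinity>")
    case True
    have "(\<lambda>i. \<bar>unit_vec n 0 $ i\<bar>) ` {..<n} \<subseteq> {0, 1 :: real}" "(1::real) \<in> (\<lambda>i. \<bar>unit_vec n 0 $ i\<bar>) ` {..<n}"
      using n by (auto simp: unit_vec_def image_iff intro!: bexI[of _ 0])
    hence "Max ((\<lambda>i. \<bar>unit_vec n 0 $ i\<bar>) ` {..<n}) = (1::real)" by (intro Max_eqI) auto
    thus ?thesis using True by (simp add: vec_lw_norm_def lw_norm_def)
  next
    case False
    have "(\<Sum>i<n. \<bar>unit_vec n 0 $ i\<bar> powr real_of_ereal w) = (\<Sum>i<n. if i = 0 then 1 else 0)"
      by (intro sum.cong) (auto simp: unit_vec_def)
    thus ?thesis using False n by (simp add: vec_lw_norm_def lw_norm_def)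
  qed
  hence mem: "vec_lw_norm w (A *\<^sub>v unit_vec n 0) \<in> ?S" using A by (auto intro!: exI[of _ "unit_vec n 0"])
  have le': "y \<le> c" if "y \<in> ?S" for y using that le A by auto
  have "Sup ?S \<le> c" using mem le' by (intro cSup_least) blast+
  moreover have "0 \<le> vec_lw_norm w (A *\<^sub>v unit_vec n 0)" using A by (intro nn) auto
  hence "0 \<le> Sup ?S" using mem le' by (intro cSup_upper2[OF mem]) (auto intro!: bdd_aboveI)
  ultimately show ?thesis by (simp add: mat_op_norm_def)
qed

text \<open>Schur's test. Row sums alone suffice for the maximum norm. For finite exponents the row
  sums enter through Jensen's inequality, giving \<open>c powr (p - 1)\<close>, and the column sums
  give the remaining factor \<open>c\<close> after the summations are exchanged.\<close>

lemma vec_lw_norm_mult_le: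
  assumes A: "A \<in> carrier_mat n n" and n: "n > 0"
    and row: "\<And>i. i < n \<Longrightarrow> (\<Sum>j<n. \<bar>A $$ (i,j)\<bar>) \<le> c" and col: "\<And>j. j < n \<Longrightarrow> (\<Sum>i<n. \<bar>A $$ (i,j)\<bar>) \<le> c"
    and w: "w \<ge> 1" and x: "x \<in> carrier_vec n" and x1: "vec_lw_norm w x = 1"
  shows "vec_lw_norm w (A *\<^sub>v x) \<le> c"
proof -
  have c0: "c \<ge> 0" using row[OF n] by (rule order_trans[rotated]) (simp add: sum_nonneg)
  have Ax: "\<bar>(A *\<^sub>v x) $ i\<bar> \<le> (\<Sum>j<n. \<bar>A $$ (i,j)\<bar> * \<bar>x $ j\<bar>)" if "i < n" for i
    unfolding mult_mat_vec_index[OF A x that] abs_mult[symmetric] by (rule sum_abs)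
  show ?thesis
  proof (cases "w = \<infinity>")
    case True
    hence "Max ((\<lambda>i. \<bar>x $ i\<bar>) ` {..<n}) = 1" using x1 x by (simp add: vec_lw_norm_def lw_norm_def)
    hence xj: "\<bar>x $ j\<bar> \<le> 1" if "j < n" for j using that by (metis Max_ge finite_imageI finite_lessThan image_eqI lessThan_iff)
    have "\<bar>(A *\<^sub>v x) $ i\<bar> \<le> c" if i: "i < n" for i
    proof -
      note Ax[OF i]
      also have "(\<Sum>j<n. \<bar>A $$ (i,j)\<bar> * \<bar>x $ j\<bar>) \<le> (\<Sum>j<n. \<bar>A $$ (i,j)\<bar> * 1)"
        using xj by (intro sum_mono mult_left_mono) auto
      finally show ?thesis using row[OF i] by simp
    qed
    hence "Max ((\<lambda>i. \<bar>(A *\<^sub>v x) $ i\<bar>) ` {..<n}) \<le> c" using n by (subst Max_le_iff) auto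
    thus ?thesis using True A by (simp add: vec_lw_norm_def lw_norm_def del: index_mult_mat_vec)
  next
    case False
    define p where "p = real_of_ereal w"
    have p: "p \<ge> 1" using w False unfolding p_def by (cases w) auto
    let ?z = "\<Sum>j<n. \<bar>x $ j\<bar> powr p"
    have "?z powr (1 / p) = 1" using x1 x False by (simp add: vec_lw_norm_def lw_norm_def p_def)
    hence "(?z powr (1 / p)) powr p = 1" by simp
    hence z: "?z = 1" using p by (simp add: powr_powr sum_nonneg)
    have "(\<Sum>i<n. \<bar>(A *\<^sub>v x) $ i\<bar> powr p) \<le> (\<Sum>i<n. c powr (p - 1) * (\<Sum>j<n. \<bar>A $$ (i,j)\<bar> * \<bar>x $ j\<bar> powr p))"
    proof (rule sum_mono)
      fix i assume "i \<in> {..<n}"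
      hence i: "i < n" by simp
      have "\<bar>(A *\<^sub>v x) $ i\<bar> powr p \<le> (\<Sum>j<n. \<bar>A $$ (i,j)\<bar> * \<bar>x $ j\<bar>) powr p"
        using Ax[OF i] p by (intro powr_mono2) auto
      also have "\<dots> \<le> c powr (p - 1) * (\<Sum>j<n. \<bar>A $$ (i,j)\<bar> * \<bar>x $ j\<bar> powr p)"
        using row[OF i] p by (intro weighted_powr_sum_le) auto
      finally show "\<bar>(A *\<^sub>v x) $ i\<bar> powr p \<le> c powr (p - 1) * (\<Sum>j<n. \<bar>A $$ (i,j)\<bar> * \<bar>x $ j\<bar> powr p)" .
    qed
    also have "\<dots> = c powr (p - 1) * (\<Sum>i<n. \<Sum>j<n. \<bar>A $$ (i,j)\<bar> * \<bar>x $ j\<bar> powr p)"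
      by (simp add: sum_distrib_left)
    also have "(\<Sum>i<n. \<Sum>j<n. \<bar>A $$ (i,j)\<bar> * \<bar>x $ j\<bar> powr p) = (\<Sum>j<n. (\<Sum>i<n. \<bar>A $$ (i,j)\<bar>) * \<bar>x $ j\<bar> powr p)"
      by (subst sum.swap) (simp add: sum_distrib_right)
    also have "c powr (p - 1) * \<dots> \<le> c powr (p - 1) * (\<Sum>j<n. c * \<bar>x $ j\<bar> powr p)"
      using col by (intro mult_left_mono sum_mono mult_right_mono) auto
    also have "\<dots> = c powr (p - 1) * c" using z by (simp add: sum_distrib_left[symmetric])
    also have "\<dots> = c powr p" using c0 by (cases "c = 0") (auto simp: powr_diff)
    finally have "(\<Sum>i<n. \<bar>(A *\<^sub>v x) $ i\<bar> powr p) powr (1 / p) \<le> (c powr p) powr (1 / p)"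
      using p by (intro powr_mono2) (auto intro!: sum_nonneg)
    also have "\<dots> = c" using c0 p by (simp add: powr_powr)
    finally show ?thesis using A False by (simp add: vec_lw_norm_def lw_norm_def p_def del: index_mult_mat_vec)
  qed
qed

lemma abs_mat_op_norm_le_row_sum:
  assumes A: "A \<in> carrier_mat n n" "transpose_mat A = A" and n: "n > 0" and w: "w \<ge> 1"
    and row: "\<And>i. i < n \<Longrightarrow> (\<Sum>j<n. \<bar>A $$ (i,j)\<bar>) \<le> c"
  shows "\<bar>mat_op_norm w A\<bar> \<le> c"
proof -
  have col: "(\<Sum>i<n. \<bar>A $$ (i,j)\<bar>) \<le> c" if j: "j < n" for j
  proof -
    have "(\<Sum>i<n. \<bar>A $$ (i,j)\<bar>) = (\<Sum>i<n. \<bar>A $$ (j,i)\<bar>)"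
      by (intro sum.cong refl) (use symmetric_mat_index[OF A] j in auto)
    thus ?thesis using row[OF j] by simp
  qed
  show ?thesis by (rule abs_mat_op_norm_le[OF A(1) n vec_lw_norm_mult_le[OF A(1) n row col w] w])
qed

lemma vec_lw_norm_2: "x \<in> carrier_vec n \<Longrightarrow> vec_lw_norm 2 x = sqrt (x \<bullet> x)"
  unfolding vec_lw_norm_def lw_norm_def scalar_prod_self_eq_sum
  by (simp add: powr_numeral powr_half_sqrt sum_nonneg)

lemma mat_lw_norm_2: "mat_lw_norm 2 A = sqrt (frob_sq A)"
  unfolding mat_lw_norm_def lw_norm_def frob_sq_def sum.cartesian_product
  by (simp add: powr_numeral powr_half_sqrt sum_nonneg case_prod_beta')

lemma mat_lw_norm_1_off_diag:
  assumes K: "K \<in> carrier_mat n n"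
  shows "mat_lw_norm 1 (off_diag K) = off_l1 K"
proof -
  have "mat_lw_norm 1 (off_diag K) = (\<Sum>i<n. \<Sum>j<n. \<bar>off_diag K $$ (i,j)\<bar>)"
    unfolding mat_lw_norm_def lw_norm_def sum.cartesian_product using K
    by (simp add: off_diag_def diag_part_def mat_diag_def case_prod_beta' sum_nonneg)
  also have "\<dots> = off_l1 K" unfolding off_l1_def using K
    by (intro sum.cong) (auto simp: off_diag_def diag_part_def mat_diag_def)
  finally show ?thesis .
qed

lemma mat_lw_norm_infinity_entry:
  assumes "A \<in> carrier_mat n n" "i < n" "j < n"
  shows "\<bar>A $$ (i,j)\<bar> \<le> mat_lw_norm \<infinity> A"
  using assms unfolding mat_lw_norm_def lw_norm_def by (auto intro!: Max_ge)

lemma row_sum_le_frob_off_l1: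
  assumes A: "A \<in> carrier_mat n n" and i: "i < n"
  shows "(\<Sum>j<n. \<bar>A $$ (i,j)\<bar>) \<le> \<bar>A $$ (i,i)\<bar> + off_l1 A" "\<bar>A $$ (i,i)\<bar> \<le> sqrt (frob_sq A)"
proof -
  have off: "off_l1 A = (\<Sum>i<n. \<Sum>j<n. if i = j then 0 else \<bar>A $$ (i,j)\<bar>)"
    and fro: "frob_sq A = (\<Sum>i<n. \<Sum>j<n. (A $$ (i,j))\<^sup>2)"
    using A by (auto simp: off_l1_def frob_sq_def)
  have "(\<Sum>j<n. \<bar>A $$ (i,j)\<bar>) = (\<Sum>j<n. (if i = j then \<bar>A $$ (i,i)\<bar> else 0) + (if i = j then 0 else \<bar>A $$ (i,j)\<bar>))"
    by (intro sum.cong) auto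
  also have "\<dots> = \<bar>A $$ (i,i)\<bar> + (\<Sum>j<n. if i = j then 0 else \<bar>A $$ (i,j)\<bar>)"
    unfolding sum.distrib using i by simp
  also have "(\<Sum>j<n. if i = j then 0 else \<bar>A $$ (i,j)\<bar>) \<le> off_l1 A"
    unfolding off using i
    by (intro member_le_sum[of i _ "\<lambda>i. \<Sum>j<n. if i = j then 0 else \<bar>A $$ (i,j)\<bar>"]) (auto intro!: sum_nonneg)
  finally show "(\<Sum>j<n. \<bar>A $$ (i,j)\<bar>) \<le> \<bar>A $$ (i,i)\<bar> + off_l1 A" by simp
  have "(A $$ (i,i))\<^sup>2 \<le> (\<Sum>j<n. (A $$ (i,j))\<^sup>2)" using i by (intro member_le_sum) auto
  also have "\<dots> \<le> frob_sq A" unfolding fro using i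
    by (intro member_le_sum[of i _ "\<lambda>i. \<Sum>j<n. (A $$ (i,j))\<^sup>2"]) (auto intro!: sum_nonneg)
  finally have "sqrt ((A $$ (i,i))\<^sup>2) \<le> sqrt (frob_sq A)" by (rule real_sqrt_le_mono)
  thus "\<bar>A $$ (i,i)\<bar> \<le> sqrt (frob_sq A)" by simp
qed

section \<open>The error bound for a minimizer\<close>

lemma off_support_l1_le:
  assumes K: "K \<in> carrier_mat n n" and D: "D \<in> carrier_mat n n"
  shows "(\<Sum>i<n. \<Sum>j<n. if i \<noteq> j \<and> K $$ (i,j) \<noteq> 0 then \<bar>D $$ (i,j)\<bar> else 0)
    \<le> sqrt (real (off_diag_support_size K)) * sqrt (frob_sq D)"
proof -
  define S where "S = {(i,j). i < n \<and> j < n \<and> i \<noteq> j \<and> K $$ (i,j) \<noteq> 0}"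
  have S: "S \<subseteq> {..<n} \<times> {..<n}" by (auto simp: S_def)
  have card: "off_diag_support_size K = card S" using K by (auto simp: off_diag_support_size_def S_def)
  let ?s = "\<Sum>i<n. \<Sum>j<n. if i \<noteq> j \<and> K $$ (i,j) \<noteq> 0 then \<bar>D $$ (i,j)\<bar> else 0"
  have "?s = (\<Sum>ij\<in>{..<n} \<times> {..<n}. if ij \<in> S then \<bar>D $$ ij\<bar> else 0)"
    unfolding sum.cartesian_product by (intro sum.cong) (auto simp: S_def)
  also have "\<dots> = (\<Sum>ij\<in>S. \<bar>D $$ ij\<bar>)"
    using S by (subst sum.inter_restrict[symmetric]) (auto intro!: arg_cong2[of _ _ _ _ sum])
  finally have s: "?s = (\<Sum>ij\<in>S. \<bar>D $$ ij\<bar>)" .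
  have "?s\<^sup>2 \<le> (\<Sum>ij\<in>S. \<bar>D $$ ij\<bar>\<^sup>2) * card S" unfolding s by (rule sum_squared_le_sum_of_squares)
  also have "\<dots> \<le> (\<Sum>ij\<in>{..<n} \<times> {..<n}. \<bar>D $$ ij\<bar>\<^sup>2) * card S"
    using S by (intro mult_right_mono sum_mono2) auto
  also have "\<dots> = real (card S) * frob_sq D"
    using D by (simp add: frob_sq_def sum.cartesian_product case_prod_beta')
  finally have "?s\<^sup>2 \<le> real (card S) * frob_sq D" .
  hence "?s \<le> sqrt (real (card S) * frob_sq D)" by (rule real_le_rsqrt)
  thus ?thesis by (simp add: card real_sqrt_mult)
qed

text \<open>\<open>R\<close> is the inverse of the target and \<open>Rh\<close> its estimate. A
  deviation of at most half the penalty leaves weight \<open>l / 2 - l < 0\<close> on the error off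
  the support and \<open>l / 2 + l\<close> on the support. The constants are
  \<open>6 = 4 * 3 / 2\<close> and \<open>24 = 4 * 6\<close>, the last factor 4 coming from the cone
  condition.\<close>

theorem glasso_estimation_error:
  assumes K: "spectrum_within n m L K" and m: "m > 0" and L: "L > 0"
    and R: "R \<in> carrier_mat n n" "R * K = 1\<^sub>m n"
    and Rh: "Rh \<in> carrier_mat n n" and dev: "\<And>i j. i < n \<Longrightarrow> j < n \<Longrightarrow> i \<noteq> j \<Longrightarrow> \<bar>Rh $$ (i,j) - R $$ (i,j)\<bar> \<le> l / 2"
    and diag: "\<And>i. i < n \<Longrightarrow> Rh $$ (i,i) = R $$ (i,i)"
    and l: "l > 0" and min: "is_arg_min (glasso_objective Rh l) (pos_def n) Kh"
    and supp: "real (off_diag_support_size K) \<le> \<sigma>" and small: "6 * l * sqrt \<sigma> * L \<le> 1"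
  shows "sqrt (frob_sq (Kh - K)) \<le> 6 * l * sqrt \<sigma> * L\<^sup>2" "off_l1 (Kh - K) \<le> 24 * l * \<sigma> * L\<^sup>2"
proof -
  have Kpd: "pos_def n K" by (rule spectrum_within_pos_def[OF K m])
  have Khpd: "pos_def n Kh" and le: "glasso_objective Rh l Kh \<le> glasso_objective Rh l K"
    using min Kpd by (auto simp: is_arg_min_def not_less)
  have Kc: "K \<in> carrier_mat n n" and Khc: "Kh \<in> carrier_mat n n" using Kpd Khpd by (auto simp: pos_def_def)
  have \<sigma>: "\<sigma> \<ge> 0" using supp by (rule order_trans[rotated]) simp
  define D where "D = Kh - K"
  have Dc: "D \<in> carrier_mat n n" unfolding D_def by (rule minus_carrier_mat[OF Kc])
  have Dij: "D $$ (i,j) = Kh $$ (i,j) - K $$ (i,j)" if "i < n" "j < n" for i j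
    using that Kc Khc by (simp add: D_def)
  obtain x where x: "x \<ge> 0" "frob_sq D \<le> (L * x)\<^sup>2" and
    ld: "ln (Determinant.det Kh) \<le> ln (Determinant.det K) + mat_trace (R * D) - x\<^sup>2 / (2 * (1 + x))"
    using ln_det_strongly_concave[OF K m Khpd R] unfolding D_def by blast
  define F where "F = sqrt (frob_sq D)"
  have F0: "F \<ge> 0" by (simp add: F_def frob_sq_def sum_nonneg)
  have Fx: "F \<le> L * x" unfolding F_def using real_sqrt_le_mono[OF x(2)] x(1) L by simp
  \<comment> \<open>\<open>a\<close> and \<open>b\<close> are the off-diagonal errors on and off the
    support of \<open>K\<close>.\<close>
  define a where "a = (\<Sum>i<n. \<Sum>j<n. if i \<noteq> j \<and> K $$ (i,j) \<noteq> 0 then \<bar>D $$ (i,j)\<bar> else 0)"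
  define b where "b = (\<Sum>i<n. \<Sum>j<n. if i \<noteq> j \<and> K $$ (i,j) = 0 then \<bar>D $$ (i,j)\<bar> else 0)"
  have ab: "off_l1 D = a + b"
    unfolding off_l1_def a_def b_def sum.distrib[symmetric] carrier_matD[OF Dc]
    by (intro sum.cong refl) auto
  have a0: "a \<ge> 0" by (auto simp: a_def intro!: sum_nonneg)
  have aF: "a \<le> sqrt \<sigma> * F"
  proof -
    have "a \<le> sqrt (real (off_diag_support_size K)) * F"
      unfolding a_def F_def by (rule off_support_l1_le[OF Kc Dc])
    also have "\<dots> \<le> sqrt \<sigma> * F" using supp F0 by (intro mult_right_mono) auto
    finally show ?thesis .
  qed
  \<comment> \<open>On the support this is the reverse triangle inequality; off the support
    \<open>K\<close> vanishes, so the entry of \<open>Kh\<close> is the error itself.\<close>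
  have pen: "off_l1 K - off_l1 Kh \<le> a - b"
    unfolding off_l1_def a_def b_def sum_subtractf[symmetric] carrier_matD[OF Kc] carrier_matD[OF Khc]
    by (intro sum_mono) (auto simp: Dij)
  have tr: "mat_trace (R * D) - mat_trace (D * Rh) \<le> l / 2 * (a + b)"
  proof -
    have "mat_trace (R * D) - mat_trace (D * Rh) = (\<Sum>i<n. \<Sum>j<n. D $$ (i,j) * (R $$ (j,i) - Rh $$ (j,i)))"
      unfolding mat_trace_mult_commute[OF R(1) Dc] mat_trace_mult[OF Dc R(1)] mat_trace_mult[OF Dc Rh]
      by (simp add: sum_subtractf right_diff_distrib)
    also have "\<dots> \<le> (\<Sum>i<n. \<Sum>j<n. l / 2 * (if i = j then 0 else \<bar>D $$ (i,j)\<bar>))"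
    proof (intro sum_mono)
      fix i j assume ij: "i \<in> {..<n}" "j \<in> {..<n}"
      show "D $$ (i,j) * (R $$ (j,i) - Rh $$ (j,i)) \<le> l / 2 * (if i = j then 0 else \<bar>D $$ (i,j)\<bar>)"
      proof (cases "i = j")
        case False
        have "D $$ (i,j) * (R $$ (j,i) - Rh $$ (j,i)) \<le> \<bar>D $$ (i,j)\<bar> * \<bar>R $$ (j,i) - Rh $$ (j,i)\<bar>"
          unfolding abs_mult[symmetric] by simp
        also have "\<dots> \<le> \<bar>D $$ (i,j)\<bar> * (l / 2)"
          using dev[of j i] ij False by (intro mult_left_mono) (auto simp: abs_minus_commute)
        finally show ?thesis using False by (simp add: mult.commute)
      qed (use diag ij in auto)
    qed
    also have "\<dots> = l / 2 * off_l1 D" using Dc by (simp add: off_l1_def sum_distrib_left)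
    finally show ?thesis by (simp add: ab)
  qed
  have "mat_trace (Kh * Rh) = mat_trace (K * Rh) + mat_trace (D * Rh)"
    unfolding mat_trace_mult[OF Kc Rh] mat_trace_mult[OF Khc Rh] mat_trace_mult[OF Dc Rh] sum.distrib[symmetric]
    by (intro sum.cong) (auto simp: Dij algebra_simps)
  hence "x\<^sup>2 / (2 * (1 + x)) \<le> mat_trace (R * D) - mat_trace (D * Rh) + l * (off_l1 K - off_l1 Kh)"
    using le ld by (simp add: glasso_objective_def algebra_simps)
  also have "\<dots> \<le> l / 2 * (a + b) + l * (a - b)"
    using tr mult_left_mono[OF pen, of l] l by linarith
  also have "\<dots> = l / 2 * (3 * a - b)" by (simp add: field_simps)
  finally have key: "x\<^sup>2 / (2 * (1 + x)) \<le> l / 2 * (3 * a - b)" .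
  have "0 \<le> x\<^sup>2 / (2 * (1 + x))" using x by simp
  hence "0 \<le> l / 2 * (3 * a - b)" using key by linarith
  \<comment> \<open>The cone condition: the error off the support is controlled by the error on it,
    so the total is at most \<open>4 * a\<close>.\<close>
  hence b: "b \<le> 3 * a" using l by (simp add: zero_le_mult_iff)
  have b0: "b \<ge> 0" by (auto simp: b_def intro!: sum_nonneg)
  \<comment> \<open>Chosen so that the key inequality reads
    \<open>x\<^sup>2 / (2 * (1 + x)) \<le> e * x\<close>; the smallness hypothesis is
    \<open>4 * e \<le> 1\<close>.\<close>
  define e where "e = 3 / 2 * l * sqrt \<sigma> * L"
  have e: "e \<le> 1 / 4" using small by (simp add: e_def mult_ac)
  have "l / 2 * (3 * a - b) \<le> l / 2 * (3 * (sqrt \<sigma> * (L * x)))"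
    using aF b0 l mult_left_mono[OF Fx, of "sqrt \<sigma>"] \<sigma> by (intro mult_left_mono) auto
  also have "\<dots> = e * x" by (simp add: e_def)
  finally have ex: "x\<^sup>2 / (2 * (1 + x)) \<le> e * x" using key by linarith
  \<comment> \<open>Division by \<open>x\<close> gives \<open>x \<le> 2 * e * (1 + x)\<close>, and
    \<open>e \<le> 1 / 4\<close> absorbs half of \<open>x\<close> into the left side. Large
    \<open>x\<close>, where the loss is only linear, is excluded here.\<close>
  have x4: "x \<le> 4 * e"
  proof (cases "x = 0")
    case True
    thus ?thesis using l \<sigma> L by (simp add: e_def)
  next
    case False
    hence xp: "x > 0" using x by simp
    have "x * x \<le> x * (2 * e * (1 + x))" using ex xp by (simp add: field_simps power2_eq_square)
    hence "x \<le> 2 * e * (1 + x)" using xp by (simp only: mult_le_cancel_left_pos)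
    moreover have "e * x \<le> 1 / 4 * x" using e xp by (intro mult_right_mono) auto
    ultimately show ?thesis by (simp add: algebra_simps)
  qed
  have "F \<le> L * (4 * e)" using Fx mult_left_mono[OF x4, of L] L by linarith
  also have "\<dots> = 6 * l * sqrt \<sigma> * L\<^sup>2" by (simp add: e_def power2_eq_square)
  finally have F: "F \<le> 6 * l * sqrt \<sigma> * L\<^sup>2" .
  thus "sqrt (frob_sq (Kh - K)) \<le> 6 * l * sqrt \<sigma> * L\<^sup>2" by (simp add: F_def D_def)
  have "off_l1 D \<le> 4 * (sqrt \<sigma> * F)" using ab b aF by linarith
  also have "\<dots> \<le> 4 * (sqrt \<sigma> * (6 * l * sqrt \<sigma> * L\<^sup>2))" using F \<sigma> by (intro mult_left_mono) auto
  also have "\<dots> = 24 * l * (sqrt \<sigma> * sqrt \<sigma>) * L\<^sup>2" by simp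
  finally show "off_l1 (Kh - K) \<le> 24 * l * \<sigma> * L\<^sup>2" using \<sigma> by (simp add: D_def)
qed

section \<open>Correlation matrices and perturbation\<close>

text \<open>Each mixed product is at most half the sum of the two squares, and symmetry makes both
  halves equal to a sum over rows. This gives Gershgorin-type bounds without reference to
  eigenvectors.\<close>

lemma row_sum_spectrum_within:
  assumes A: "A \<in> carrier_mat n n" "transpose_mat A = A"
    and row: "\<And>i. i < n \<Longrightarrow> (\<Sum>j<n. \<bar>A $$ (i,j)\<bar>) \<le> c"
  shows "spectrum_within n (- c) c A"
proof -
  have "\<bar>x \<bullet> (A *\<^sub>v x)\<bar> \<le> c * (x \<bullet> x)" if x: "x \<in> carrier_vec n" for x
  proof -
    have "\<bar>x \<bullet> (A *\<^sub>v x)\<bar> \<le> (\<Sum>i<n. \<Sum>j<n. \<bar>A $$ (i,j) * x $ i * x $ j\<bar>)"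
      unfolding quadratic_form_eq_sum[OF A(1) x] by (intro order_trans[OF sum_abs] sum_mono sum_abs)
    also have "\<dots> \<le> (\<Sum>i<n. \<Sum>j<n. \<bar>A $$ (i,j)\<bar> * (x $ i)\<^sup>2 / 2 + \<bar>A $$ (i,j)\<bar> * (x $ j)\<^sup>2 / 2)"
    proof (intro sum_mono)
      fix i j
      have "0 \<le> (\<bar>x $ i\<bar> - \<bar>x $ j\<bar>)\<^sup>2" by simp
      hence "\<bar>x $ i\<bar> * \<bar>x $ j\<bar> \<le> (x $ i)\<^sup>2 / 2 + (x $ j)\<^sup>2 / 2"
        by (simp add: power2_diff)
      from mult_left_mono[OF this, of "\<bar>A $$ (i,j)\<bar>"]
      show "\<bar>A $$ (i,j) * x $ i * x $ j\<bar> \<le> \<bar>A $$ (i,j)\<bar> * (x $ i)\<^sup>2 / 2 + \<bar>A $$ (i,j)\<bar> * (x $ j)\<^sup>2 / 2"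
        by (simp add: abs_mult distrib_left mult.assoc)
    qed
    also have "\<dots> = (\<Sum>i<n. \<Sum>j<n. \<bar>A $$ (i,j)\<bar> * (x $ i)\<^sup>2 / 2) + (\<Sum>j<n. \<Sum>i<n. \<bar>A $$ (i,j)\<bar> * (x $ j)\<^sup>2 / 2)"
      unfolding sum.distrib by (subst (2) sum.swap) simp
    also have "(\<Sum>j<n. \<Sum>i<n. \<bar>A $$ (i,j)\<bar> * (x $ j)\<^sup>2 / 2) = (\<Sum>i<n. \<Sum>j<n. \<bar>A $$ (i,j)\<bar> * (x $ i)\<^sup>2 / 2)"
      by (intro sum.cong refl) (use symmetric_mat_index[OF A] in auto)
    also have "(\<Sum>i<n. \<Sum>j<n. \<bar>A $$ (i,j)\<bar> * (x $ i)\<^sup>2 / 2) + (\<Sum>i<n. \<Sum>j<n. \<bar>A $$ (i,j)\<bar> * (x $ i)\<^sup>2 / 2)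
      = (\<Sum>i<n. (\<Sum>j<n. \<bar>A $$ (i,j)\<bar>) * (x $ i)\<^sup>2)"
      by (simp add: sum.distrib[symmetric] sum_distrib_right)
    also have "\<dots> \<le> (\<Sum>i<n. c * (x $ i)\<^sup>2)" by (intro sum_mono mult_right_mono) (auto simp: row)
    also have "\<dots> = c * (x \<bullet> x)" by (simp add: scalar_prod_self_eq_sum[OF x] sum_distrib_left)
    finally show ?thesis .
  qed
  thus ?thesis using A unfolding spectrum_within_def by (auto simp: abs_le_iff minus_le_iff)
qed

lemma off_l1_le_support:
  assumes K: "K \<in> carrier_mat n n" and L: "\<And>i j. i < n \<Longrightarrow> j < n \<Longrightarrow> \<bar>K $$ (i,j)\<bar> \<le> L"
  shows "off_l1 K \<le> real (off_diag_support_size K) * L"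
proof -
  define S where "S = {(i,j). i < n \<and> j < n \<and> i \<noteq> j \<and> K $$ (i,j) \<noteq> 0}"
  have S: "S \<subseteq> {..<n} \<times> {..<n}" by (auto simp: S_def)
  have card: "off_diag_support_size K = card S" using K by (auto simp: off_diag_support_size_def S_def)
  have "off_l1 K = (\<Sum>ij\<in>{..<n} \<times> {..<n}. if ij \<in> S then \<bar>K $$ ij\<bar> else 0)"
    unfolding off_l1_def sum.cartesian_product carrier_matD[OF K]
    by (intro sum.cong) (auto simp: S_def split: if_splits)
  also have "\<dots> = (\<Sum>ij\<in>S. \<bar>K $$ ij\<bar>)"
    using S by (subst sum.inter_restrict[symmetric]) (auto intro!: arg_cong2[of _ _ _ _ sum])
  also have "\<dots> \<le> real (card S) * L" using L by (intro sum_bounded_above) (auto simp: S_def)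
  finally show ?thesis by (simp add: card)
qed

lemma scale_mat_inverse:
  assumes AB: "A \<in> carrier_mat n n" "B \<in> carrier_mat n n" "B * A = 1\<^sub>m n" and vw: "\<And>i. i < n \<Longrightarrow> v i * w i = 1"
  shows "scale_mat n v B * scale_mat n w A = 1\<^sub>m n"
proof -
  note as = assoc_mult_mat[of _ n n _ n _ n] mult_carrier_mat[of _ n n _ n]
  have vw1: "mat_diag n v * mat_diag n w = 1\<^sub>m n"
    unfolding mat_diag_diag using vw by (intro eq_matI) (auto simp: mat_diag_def)
  have "scale_mat n v B * scale_mat n w A = mat_diag n v * (B * ((mat_diag n v * mat_diag n w) * (A * mat_diag n w)))"
    unfolding scale_mat_def using AB(1,2) by (simp add: as del: mat_diag_diag)
  also have "\<dots> = mat_diag n v * ((B * A) * mat_diag n w)"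
    unfolding vw1 using AB(1,2) by (simp add: as left_mult_one_mat[of _ n n])
  also have "\<dots> = 1\<^sub>m n" unfolding AB(3) using vw1 by (simp add: left_mult_one_mat[of _ n n] del: mat_diag_diag)
  finally show ?thesis .
qed

lemma scale_mat_dim [simp]: "dim_row (scale_mat n v A) = n" "dim_col (scale_mat n v A) = n"
  by (simp_all add: scale_mat_def mat_diag_def)

lemma off_diag_support_size_scale_mat:
  assumes "A \<in> carrier_mat n n" "\<And>i. i < n \<Longrightarrow> v i \<noteq> 0"
  shows "off_diag_support_size (scale_mat n v A) = off_diag_support_size A"
proof -
  have "dim_row A = n" "dim_col A = n" using assms by auto
  thus ?thesis unfolding off_diag_support_size_def using assms
    by (intro arg_cong[of _ _ card]) auto
qed

lemma sqrt_le_self_of_ge_1: "x \<ge> 1 \<Longrightarrow> sqrt x \<le> (x::real)"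
  by (rule real_le_lsqrt) (auto simp: self_le_power)

text \<open>The perturbation is at most half of the lower bound \<open>1 / C\<close>, so the
  perturbed value stays above \<open>1 / (2 * C)\<close>. The difference of the inverse roots is the
  difference of the roots divided by both, and the difference of the roots is itself at most
  \<open>\<eta> / sqrt \<sigma>\<close>. Using \<open>sqrt x \<le> x\<close> for
  \<open>x \<ge> 1\<close> keeps the powers of \<open>C\<close> integral.\<close>

lemma inverse_sqrt_perturbation:
  fixes \<sigma> \<sigma>' :: real
  assumes C: "C \<ge> 1" and \<sigma>: "1 / C \<le> \<sigma>" and dist: "\<bar>\<sigma>' - \<sigma>\<bar> \<le> \<eta>" and \<eta>: "\<eta> \<le> 1 / (2 * C)"
  shows "\<sigma>' > 0" "\<bar>1 / sqrt \<sigma>'\<bar> \<le> 2 * C" "\<bar>1 / sqrt \<sigma>\<bar> \<le> C" "\<bar>1 / sqrt \<sigma>' - 1 / sqrt \<sigma>\<bar> \<le> 2 * C ^ 3 * \<eta>"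
proof -
  have \<sigma>0: "\<sigma> > 0" using \<sigma> C by (smt (verit) zero_less_divide_1_iff)
  have half: "1 / (2 * C) = 1 / C / 2" by simp
  have \<sigma>': "\<sigma>' \<ge> 1 / (2 * C)" using \<sigma> dist \<eta> unfolding half by linarith
  moreover have "1 / (2 * C) > 0" using C by simp
  ultimately show \<sigma>'0: "\<sigma>' > 0" by linarith
  have "1 / \<sigma> \<le> C" using \<sigma> \<sigma>0 C by (simp add: field_simps)
  hence "sqrt (1 / \<sigma>) \<le> sqrt C" by simp
  also have "\<dots> \<le> C" using C by (rule sqrt_le_self_of_ge_1)
  finally have b: "1 / sqrt \<sigma> \<le> C" by (simp add: real_sqrt_divide)
  thus "\<bar>1 / sqrt \<sigma>\<bar> \<le> C" using \<sigma>0 by simp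
  have "1 / \<sigma>' \<le> 2 * C" using \<sigma>' \<sigma>'0 C by (simp add: field_simps)
  hence "sqrt (1 / \<sigma>') \<le> sqrt (2 * C)" by simp
  also have "\<dots> \<le> 2 * C" using C by (intro sqrt_le_self_of_ge_1) simp
  finally have a: "1 / sqrt \<sigma>' \<le> 2 * C" by (simp add: real_sqrt_divide)
  thus "\<bar>1 / sqrt \<sigma>'\<bar> \<le> 2 * C" using \<sigma>'0 by simp
  have \<eta>0: "\<eta> \<ge> 0" using dist by simp
  have "(sqrt \<sigma> - sqrt \<sigma>') * (sqrt \<sigma> + sqrt \<sigma>') = \<sigma> - \<sigma>'"
    using \<sigma>0 \<sigma>'0 by (simp add: algebra_simps)
  hence "\<bar>sqrt \<sigma> - sqrt \<sigma>'\<bar> * (sqrt \<sigma> + sqrt \<sigma>') = \<bar>\<sigma> - \<sigma>'\<bar>"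
    using \<sigma>0 \<sigma>'0 by (metis abs_mult abs_of_pos add_pos_pos real_sqrt_gt_zero)
  moreover have "\<bar>sqrt \<sigma> - sqrt \<sigma>'\<bar> * sqrt \<sigma> \<le> \<bar>sqrt \<sigma> - sqrt \<sigma>'\<bar> * (sqrt \<sigma> + sqrt \<sigma>')"
    using \<sigma>'0 by (intro mult_left_mono) auto
  ultimately have "\<bar>sqrt \<sigma> - sqrt \<sigma>'\<bar> * sqrt \<sigma> \<le> \<eta>" using dist by (simp add: abs_minus_commute)
  hence d: "\<bar>sqrt \<sigma> - sqrt \<sigma>'\<bar> \<le> \<eta> * (1 / sqrt \<sigma>)" using \<sigma>0 by (simp add: field_simps)
  have "1 / sqrt \<sigma>' - 1 / sqrt \<sigma> = (sqrt \<sigma> - sqrt \<sigma>') * (1 / sqrt \<sigma>) * (1 / sqrt \<sigma>')"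
    using \<sigma>0 \<sigma>'0 by (simp add: field_simps)
  hence "\<bar>1 / sqrt \<sigma>' - 1 / sqrt \<sigma>\<bar> = \<bar>sqrt \<sigma> - sqrt \<sigma>'\<bar> * (1 / sqrt \<sigma>) * (1 / sqrt \<sigma>')"
    using \<sigma>0 \<sigma>'0 by (simp add: abs_mult)
  also have "\<dots> \<le> (\<eta> * (1 / sqrt \<sigma>)) * (1 / sqrt \<sigma>) * (1 / sqrt \<sigma>')"
    using d \<sigma>0 \<sigma>'0 by (intro mult_right_mono) auto
  also have "\<dots> \<le> (\<eta> * C) * C * (2 * C)"
    using a b \<sigma>0 \<sigma>'0 \<eta>0 C by (intro mult_mono mult_nonneg_nonneg) auto
  finally show "\<bar>1 / sqrt \<sigma>' - 1 / sqrt \<sigma>\<bar> \<le> 2 * C ^ 3 * \<eta>" by (simp add: power3_eq_cube mult_ac)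
qed

lemma product_perturbation:
  fixes a a' b b' :: real
  assumes "\<bar>a\<bar> \<le> A" "\<bar>b'\<bar> \<le> B" "\<bar>a - a'\<bar> \<le> e" "\<bar>b - b'\<bar> \<le> e"
  shows "\<bar>a * b - a' * b'\<bar> \<le> (A + B) * e"
proof -
  have "a * b - a' * b' = a * (b - b') + b' * (a - a')" by (simp add: algebra_simps)
  hence "\<bar>a * b - a' * b'\<bar> \<le> \<bar>a\<bar> * \<bar>b - b'\<bar> + \<bar>b'\<bar> * \<bar>a - a'\<bar>" by (simp add: abs_mult[symmetric])
  also have "\<dots> \<le> A * e + B * e" using assms by (intro add_mono mult_mono) auto
  finally show ?thesis by (simp add: algebra_simps)
qed

lemma is_arg_min_cong:
  assumes "\<And>x. P x \<Longrightarrow> f x = g x"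
  shows "is_arg_min f P = is_arg_min g P"
  using assms by (force simp: is_arg_min_def fun_eq_iff)

lemma correlation_pos_semidef:
  assumes S: "pos_semidef n S" and pos: "\<And>i. i < n \<Longrightarrow> S $$ (i,i) > 0"
  shows "pos_semidef n (correlation S)" "\<And>i. i < n \<Longrightarrow> correlation S $$ (i,i) = 1"
proof -
  have Sc: "S \<in> carrier_mat n n" using S by (simp add: pos_semidef_def)
  have R: "correlation S = scale_mat n (\<lambda>i. 1 / sqrt (S $$ (i,i))) S"
    by (rule correlation_eq_scale_mat[OF Sc]) (rule pos)
  show "pos_semidef n (correlation S)" unfolding R by (rule pos_semidef_scale_mat[OF S])
  show "correlation S $$ (i,i) = 1" if "i < n" for i
    unfolding R using Sc that pos[OF that] by simp
qed

text \<open>\<open>K_hat\<close> is an unspecified choice among minimizers, so its defining property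
  follows from existence.\<close>

lemma K_hat_is_arg_min:
  assumes S: "pos_semidef n S" and pos: "\<And>i. i < n \<Longrightarrow> S $$ (i,i) > 0" and l: "l > 0"
  shows "is_arg_min (glasso_objective (correlation S) l) (pos_def n) (K_hat S l)"
proof -
  let ?f = "\<lambda>K. mat_trace (K * correlation S) - ln (Determinant.det K) + l * mat_lw_norm 1 (off_diag K)"
  have eq: "is_arg_min ?f (pos_def n) = is_arg_min (glasso_objective (correlation S) l) (pos_def n)"
    by (rule is_arg_min_cong) (simp add: glasso_objective_def pos_def_def mat_lw_norm_1_off_diag[of _ n])
  have ex: "\<exists>K. is_arg_min (glasso_objective (correlation S) l) (pos_def n) K"
    by (rule glasso_minimizer_exists) (use correlation_pos_semidef[OF S] pos l in auto)
  have "dim_row S = n" using S by (auto simp: pos_semidef_def)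
  hence "K_hat S l = (SOME K. is_arg_min ?f (pos_def n) K)" by (simp add: K_hat_def arg_min_def)
  thus ?thesis using someI_ex[OF ex[unfolded eq[symmetric]]] by (simp add: eq)
qed

text \<open>The substitution of \<open>scale_mat n v \<Theta>\<close> preserves the trace term,
  turns the weighted penalty into the plain one and shifts the log determinant by a constant.
  Minimizers of both problems therefore correspond.\<close>

lemma Theta_hat_is_arg_min:
  assumes S: "pos_semidef n S" and pos: "\<And>i. i < n \<Longrightarrow> S $$ (i,i) > 0" and l: "l > 0"
  shows "pos_def n (Theta_hat S l)"
    "is_arg_min (glasso_objective (correlation S) l) (pos_def n) (scale_mat n (\<lambda>i. sqrt (S $$ (i,i))) (Theta_hat S l))"
proof -
  define v where "v i = sqrt (S $$ (i,i))" for i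
  have v: "v i > 0" if "i < n" for i using pos[OF that] by (simp add: v_def)
  have Sc: "S \<in> carrier_mat n n" using S by (simp add: pos_semidef_def)
  define f where "f = (\<lambda>\<Theta>. mat_trace (\<Theta> * S) - ln (Determinant.det \<Theta>)
    + l * (\<Sum>(i,j) \<in> {(i,j). i < n \<and> j < n \<and> i \<noteq> j}. diag_sqrt S $$ (i,i) * diag_sqrt S $$ (j,j) * \<bar>\<Theta> $$ (i,j)\<bar>))"
  let ?g = "glasso_objective (correlation S) l"
  \<comment> \<open>The determinant of the diagonal scaling matrix. Scaling from both sides
    multiplies the determinant by \<open>d * d\<close>, whence the additive constant in
    \<open>fg\<close>.\<close>
  define d where "d = (\<Prod>k<n. v k)"
  have d: "d > 0" unfolding d_def using v by (intro prod_pos) auto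
  have R: "correlation S = scale_mat n (\<lambda>i. 1 / v i) S"
    unfolding v_def by (rule correlation_eq_scale_mat[OF Sc]) (rule pos)
  have fg: "f \<Theta> = ?g (scale_mat n v \<Theta>) + ln (d * d)" if \<Theta>: "pos_def n \<Theta>" for \<Theta>
  proof -
    have c: "\<Theta> \<in> carrier_mat n n" using \<Theta> by (simp add: pos_def_def)
    have "mat_trace (scale_mat n v \<Theta> * correlation S) = mat_trace (\<Theta> * S)"
      unfolding R mat_trace_mult[OF scale_mat_carrier[OF c] scale_mat_carrier[OF Sc]] mat_trace_mult[OF c Sc]
    proof (intro sum.cong refl)
      fix i j assume "i \<in> {..<n}" "j \<in> {..<n}"
      thus "scale_mat n v \<Theta> $$ (i,j) * scale_mat n (\<lambda>i. 1 / v i) S $$ (j,i) = \<Theta> $$ (i,j) * S $$ (j,i)"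
        using c Sc v[of i] v[of j] by simp
    qed
    moreover have "Determinant.det (scale_mat n v \<Theta>) = (d * d) * Determinant.det \<Theta>"
      unfolding scale_mat_def d_def using c
      by (simp add: det_mult[of _ n] mult_carrier_mat[of _ n n _ n] det_mat_diag mult_ac)
    hence "ln (Determinant.det (scale_mat n v \<Theta>)) = ln (d * d) + ln (Determinant.det \<Theta>)"
      using d pos_def_det_pos[OF \<Theta>] by (simp add: ln_mult_pos)
    moreover have "(\<Sum>(i,j) \<in> {(i,j). i < n \<and> j < n \<and> i \<noteq> j}. diag_sqrt S $$ (i,i) * diag_sqrt S $$ (j,j) * \<bar>\<Theta> $$ (i,j)\<bar>)
      = off_l1 (scale_mat n v \<Theta>)"
    proof -
      have "off_l1 (scale_mat n v \<Theta>) = (\<Sum>(i,j)\<in>{..<n} \<times> {..<n}. if i = j then 0 else \<bar>scale_mat n v \<Theta> $$ (i,j)\<bar>)"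
        using scale_mat_carrier[OF c, of v] by (simp add: off_l1_def sum.cartesian_product)
      also have "\<dots> = (\<Sum>(i,j) \<in> {(i,j). i < n \<and> j < n \<and> i \<noteq> j}. \<bar>scale_mat n v \<Theta> $$ (i,j)\<bar>)"
        by (intro sum.mono_neutral_cong_right) (auto split: if_splits)
      also have "\<dots> = (\<Sum>(i,j) \<in> {(i,j). i < n \<and> j < n \<and> i \<noteq> j}. diag_sqrt S $$ (i,i) * diag_sqrt S $$ (j,j) * \<bar>\<Theta> $$ (i,j)\<bar>)"
        using c Sc v by (intro sum.cong refl) (auto simp: abs_mult diag_sqrt_def mat_diag_def v_def[symmetric] less_imp_le)
      finally show ?thesis by simp
    qed
    ultimately show ?thesis by (simp add: f_def glasso_objective_def)
  qed
  have sc: "pos_def n (scale_mat n v \<Theta>)" if "pos_def n \<Theta>" for \<Theta>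
    using v by (intro pos_def_scale_mat[OF that]) force
  have sc': "pos_def n (scale_mat n (\<lambda>i. 1 / v i) K) \<and> scale_mat n v (scale_mat n (\<lambda>i. 1 / v i) K) = K" if "pos_def n K" for K
  proof
    show "pos_def n (scale_mat n (\<lambda>i. 1 / v i) K)"
      using v by (intro pos_def_scale_mat[OF that]) force
    show "scale_mat n v (scale_mat n (\<lambda>i. 1 / v i) K) = K"
      using that v by (intro scale_mat_scale_mat) (force simp: pos_def_def)+
  qed
  obtain K0 where K0: "is_arg_min ?g (pos_def n) K0"
    using glasso_minimizer_exists[of n "correlation S" l] correlation_pos_semidef[OF S] pos l by blast
  \<comment> \<open>A minimizer of the weighted problem is obtained from one of the correlation
    problem; only then does the choice in \<open>Theta_hat\<close> yield a minimizer.\<close>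
  have "is_arg_min f (pos_def n) (scale_mat n (\<lambda>i. 1 / v i) K0)"
    using K0 sc sc'[of K0] fg by (force simp: is_arg_min_def)
  moreover have "Theta_hat S l = (SOME \<Theta>. is_arg_min f (pos_def n) \<Theta>)"
    using Sc by (simp add: Theta_hat_def arg_min_def f_def Let_def)
  ultimately have m: "is_arg_min f (pos_def n) (Theta_hat S l)" by (metis someI_ex)
  show pd: "pos_def n (Theta_hat S l)" using m by (simp add: is_arg_min_def)
  have "\<not> ?g K < ?g (scale_mat n v (Theta_hat S l))" if K: "pos_def n K" for K
  proof
    assume "?g K < ?g (scale_mat n v (Theta_hat S l))"
    hence "f (scale_mat n (\<lambda>i. 1 / v i) K) < f (Theta_hat S l)" using fg sc'[OF K] pd by simp
    thus False using m sc'[OF K] by (auto simp: is_arg_min_def)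
  qed
  thus "is_arg_min ?g (pos_def n) (scale_mat n (\<lambda>i. sqrt (S $$ (i,i))) (Theta_hat S l))"
    using sc[OF pd] by (auto simp: is_arg_min_def v_def[symmetric])
qed

section \<open>Error bounds for a single sample\<close>

text \<open>The deterministic conditions met by one realization on the good event. A single
  \<open>C\<close> bounds the spectrum and the relative sparsity. The tolerance is a common
  majorant: it covers the deviation of the correlations, the smallness condition
  \<open>6 * C ^ 3 * s * l \<le> 1\<close> of the estimation error and
  \<open>264 * C ^ 8 * s * l \<le> 1\<close> for the inverse.\<close>

locale glasso_sample =
  fixes n :: nat and Sg S :: "real mat" and l s C :: real
  assumes n: "n > 0" and C: "C \<ge> 1" and Sg: "spectrum_within n (1 / C) C Sg"
    and supp: "real (off_diag_support_size (minv Sg)) \<le> C * s" and s: "s \<ge> 1"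
    and S: "pos_semidef n S" and S_diag: "\<And>i. i < n \<Longrightarrow> S $$ (i,i) > 0" and l: "l > 0"
    and dist: "\<And>i j. i < n \<Longrightarrow> j < n \<Longrightarrow> \<bar>S $$ (i,j) - Sg $$ (i,j)\<bar> \<le> l / (300 * C ^ 8)"
    and small: "s * l \<le> 1 / (300 * C ^ 8)"
begin

definition "\<eta> = l / (300 * C ^ 8)"
definition "v i = sqrt (Sg $$ (i,i))"
definition "a i = 1 / sqrt (S $$ (i,i))"
definition "b i = 1 / v i"
abbreviation "\<Theta> \<equiv> minv Sg"
definition "K = scale_mat n v \<Theta>"

lemma C_pos: "C > 0" "1 / C > 0" using C by auto

lemma C_pow: "i \<le> j \<Longrightarrow> C ^ i \<le> C ^ j" "C ^ i \<ge> 1" "C ^ i > 0"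
  using C by (auto intro: power_increasing one_le_power simp: order_less_le_trans[OF zero_less_one])

text \<open>Brings the individual rates to the common factor \<open>300 * C ^ 9\<close> that the
  passage to probability uses for all four claims.\<close>

lemma const_bound:
  assumes "c \<le> 300" "i \<le> 9" "u \<ge> 0" "c \<ge> 0"
  shows "c * C ^ i * u \<le> 300 * C ^ 9 * u"
  using assms C_pow(1)[OF assms(2)] C_pos by (intro mult_right_mono mult_mono) auto

lemma Sg_carrier: "Sg \<in> carrier_mat n n" using Sg by (simp add: spectrum_within_def)
lemma S_carrier: "S \<in> carrier_mat n n" using S by (simp add: pos_semidef_def)

lemma Sg_pos_def: "pos_def n Sg" using spectrum_within_pos_def[OF Sg] C_pos by simp

lemma Theta_inverse: "\<Theta> \<in> carrier_mat n n" "\<Theta> * Sg = 1\<^sub>m n" "Sg * \<Theta> = 1\<^sub>m n"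
  using minv_pos_def[OF Sg_pos_def] .

lemma Theta_spectrum: "spectrum_within n (1 / C) C \<Theta>"
  using spectrum_within_inverse[OF Sg C_pos(2) Theta_inverse(1,2)] by simp

lemma Sg_diag: "i < n \<Longrightarrow> 1 / C \<le> Sg $$ (i,i)" "i < n \<Longrightarrow> Sg $$ (i,i) \<le> C"
  using spectrum_within_diag[OF Sg] by auto

lemma sqrt_diag: "i < n \<Longrightarrow> v i > 0" "i < n \<Longrightarrow> (v i)\<^sup>2 = Sg $$ (i,i)"
proof -
  assume "i < n"
  hence "Sg $$ (i,i) > 0" using Sg_diag(1)[of i] C_pos(2) by linarith
  thus "v i > 0" "(v i)\<^sup>2 = Sg $$ (i,i)" by (auto simp: v_def)
qed

lemma correlation_Sg: "correlation Sg = scale_mat n b Sg"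
  unfolding b_def v_def
  by (rule correlation_eq_scale_mat[OF Sg_carrier]) (use Sg_diag(1) C_pos in \<open>blast intro: order_less_le_trans\<close>)

lemma correlation_S: "correlation S = scale_mat n a S"
  unfolding a_def by (rule correlation_eq_scale_mat[OF S_carrier]) (rule S_diag)

lemma K_props: "K \<in> carrier_mat n n" "K * correlation Sg = 1\<^sub>m n" "correlation Sg * K = 1\<^sub>m n"
  "minv (correlation Sg) = K" "spectrum_within n (1 / C\<^sup>2) (C\<^sup>2) K"
  "off_diag_support_size K = off_diag_support_size \<Theta>"
proof -
  show c: "K \<in> carrier_mat n n" using Theta_inverse by (simp add: K_def)
  have Rc: "correlation Sg \<in> carrier_mat n n" using Sg_carrier by (simp add: correlation_Sg)
  show KR: "K * correlation Sg = 1\<^sub>m n"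
    unfolding K_def correlation_Sg using sqrt_diag(1)
    by (intro scale_mat_inverse[OF Sg_carrier Theta_inverse(1,2)]) (force simp: b_def)
  show "correlation Sg * K = 1\<^sub>m n" by (rule mat_mult_left_right_inverse[OF c Rc KR])
  show "minv (correlation Sg) = K" by (rule minv_eq[OF Rc c KR])
  have "spectrum_within n (1 / C * (1 / C)) (C * C) K"
    unfolding K_def by (rule spectrum_within_scale_mat[OF Theta_spectrum]) (use C_pos sqrt_diag Sg_diag in auto)
  thus "spectrum_within n (1 / C\<^sup>2) (C\<^sup>2) K" by (simp add: power2_eq_square)
  show "off_diag_support_size K = off_diag_support_size \<Theta>"
    unfolding K_def using sqrt_diag(1) by (intro off_diag_support_size_scale_mat[OF Theta_inverse(1)]) force
qed

lemma eta_bounds: "\<eta> \<ge> 0" "\<eta> * (300 * C ^ 8) = l" "\<eta> \<le> 1 / (2 * C)"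
proof -
  show "\<eta> \<ge> 0" using l C_pos by (simp add: \<eta>_def)
  show "\<eta> * (300 * C ^ 8) = l" using C_pos by (simp add: \<eta>_def)
  \<comment> \<open>Since \<open>s \<ge> 1\<close>, smallness of \<open>s * l\<close> also makes
    \<open>l\<close>, and hence \<open>\<eta>\<close>, small.\<close>
  have "1 * l \<le> s * l" using s l by (intro mult_right_mono) auto
  hence "l \<le> 1 / (300 * C ^ 8)" using small by simp
  also have "\<dots> \<le> 1" using C_pow(2)[of 8] C_pos by (subst divide_le_eq_1_pos) auto
  finally have l1: "l \<le> 1" .
  have "\<eta> \<le> 1 / (300 * C ^ 8)" unfolding \<eta>_def using l1 C_pos by (intro divide_right_mono) auto
  also have "\<dots> \<le> 1 / (2 * C)"
    using C_pow(1)[of 1 8] C_pos by (intro divide_left_mono mult_pos_pos) auto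
  finally show "\<eta> \<le> 1 / (2 * C)" .
qed

lemma inverse_sqrt_diag: "i < n \<Longrightarrow> \<bar>a i\<bar> \<le> 2 * C" "i < n \<Longrightarrow> \<bar>b i\<bar> \<le> C" "i < n \<Longrightarrow> \<bar>a i - b i\<bar> \<le> 2 * C ^ 3 * \<eta>"
  using inverse_sqrt_perturbation[OF C Sg_diag(1) dist[of i i, folded \<eta>_def] eta_bounds(3)]
  by (auto simp: a_def b_def v_def)

lemma ab_product:
  assumes "i < n" "j < n"
  shows "\<bar>a i * a j\<bar> \<le> 4 * C\<^sup>2" "\<bar>a i * a j - b i * b j\<bar> \<le> 6 * C ^ 4 * \<eta>"
proof -
  have "\<bar>a i\<bar> * \<bar>a j\<bar> \<le> (2 * C) * (2 * C)" using inverse_sqrt_diag(1)[OF assms(1)] inverse_sqrt_diag(1)[OF assms(2)] C_pos by (intro mult_mono) auto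
  thus "\<bar>a i * a j\<bar> \<le> 4 * C\<^sup>2" by (simp add: abs_mult power2_eq_square)
  have "\<bar>a i * a j - b i * b j\<bar> \<le> (2 * C + C) * (2 * C ^ 3 * \<eta>)"
    using inverse_sqrt_diag assms by (intro product_perturbation) auto
  thus "\<bar>a i * a j - b i * b j\<bar> \<le> 6 * C ^ 4 * \<eta>" by (simp add: power4_eq_xxxx power3_eq_cube mult_ac)
qed

lemma correlation_dist:
  assumes ij: "i < n" "j < n"
  shows "\<bar>correlation S $$ (i,j) - correlation Sg $$ (i,j)\<bar> \<le> l / 2"
proof -
  \<comment> \<open>The entry error times the estimated scaling plus the true entry times the
    scaling error; both are of order \<open>\<eta>\<close> with powers of \<open>C\<close> at most
    5.\<close>
  have "correlation S $$ (i,j) - correlation Sg $$ (i,j)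
    = (S $$ (i,j) - Sg $$ (i,j)) * (a i * a j) + Sg $$ (i,j) * (a i * a j - b i * b j)"
    unfolding correlation_S correlation_Sg using S_carrier Sg_carrier ij by (simp add: algebra_simps)
  also have "\<bar>\<dots>\<bar> \<le> \<eta> * (4 * C\<^sup>2) + C * (6 * C ^ 4 * \<eta>)"
    using ab_product[OF ij] dist[OF ij] spectrum_within_entry_le[OF Sg _ ij] C_pos eta_bounds(1)
    by (intro order_trans[OF abs_triangle_ineq] add_mono) (auto simp: abs_mult \<eta>_def[symmetric] intro!: mult_mono)
  also have "\<dots> = \<eta> * (4 * C ^ 2 + 6 * C ^ 5)" by (simp add: eval_nat_numeral algebra_simps)
  also have "\<dots> \<le> \<eta> * (150 * C ^ 8)"
    using C_pow(1)[of 2 8] C_pow(1)[of 5 8] C_pow(3)[of 8] eta_bounds(1) by (intro mult_left_mono) linarith+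
  also have "\<dots> = l / 2" using eta_bounds(2) by simp
  finally show ?thesis .
qed

lemma correlation_diag: "i < n \<Longrightarrow> correlation S $$ (i,i) = correlation Sg $$ (i,i)"
proof -
  assume i: "i < n"
  have "correlation S $$ (i,i) = 1" using correlation_pos_semidef(2)[OF S S_diag i] .
  moreover have "correlation Sg $$ (i,i) = 1"
    using correlation_pos_semidef(2)[OF pos_def_imp_pos_semidef[OF Sg_pos_def] _ i] Sg_diag(1) C_pos
    by (meson order_less_le_trans)
  ultimately show ?thesis by simp
qed

text \<open>\<open>30 = 6 + 24\<close>: the Frobenius bound controls the diagonal entry of a row and
  the off-diagonal norm controls the rest, for support size \<open>C * s\<close> and spectral bound
  \<open>C\<^sup>2\<close>.\<close>

definition "\<rho> = 30 * C ^ 5 * l * s"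

lemma s_l_bounds: "s * l * (300 * C ^ 8) \<le> 1" "s * l > 0"
  using small s l C_pow(3)[of 8] by (auto simp: field_simps)

lemma minimizer_error:
  assumes min: "is_arg_min (glasso_objective (correlation S) l) (pos_def n) Kh"
  shows "sqrt (frob_sq (Kh - K)) \<le> 6 * C ^ 5 * l * sqrt s"
    "\<And>i. i < n \<Longrightarrow> (\<Sum>j<n. \<bar>(Kh - K) $$ (i,j)\<bar>) \<le> \<rho>"
proof -
  have Rc: "correlation Sg \<in> carrier_mat n n" "correlation S \<in> carrier_mat n n"
    using Sg_carrier S_carrier by (simp_all add: correlation_Sg correlation_S)
  have s1: "sqrt s \<le> s" using s by (rule sqrt_le_self_of_ge_1)
  have c1: "sqrt C \<le> C" using C by (rule sqrt_le_self_of_ge_1)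
  \<comment> \<open>Trades the half power of \<open>C\<close> for a full one but keeps
    \<open>sqrt s\<close>, on which the Frobenius rate depends.\<close>
  have sq: "sqrt (C * s) \<le> C * sqrt s" unfolding real_sqrt_mult using c1 s by (intro mult_right_mono) auto
  have "6 * l * sqrt (C * s) * C\<^sup>2 \<le> 6 * l * (C * s) * C\<^sup>2"
    using order_trans[OF sq mult_left_mono[OF s1]] C_pos l by (intro mult_right_mono mult_left_mono) auto
  also have "\<dots> = s * l * (6 * C ^ 3)" by (simp add: eval_nat_numeral mult_ac)
  also have "\<dots> \<le> s * l * (300 * C ^ 8)"
    using C_pow(1)[of 3 8] C_pow(3)[of 8] s_l_bounds(2) by (intro mult_left_mono) linarith+
  finally have small': "6 * l * sqrt (C * s) * C\<^sup>2 \<le> 1" using s_l_bounds(1) by linarith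
  have supp': "real (off_diag_support_size K) \<le> C * s" using supp K_props(6) by simp
  note est = glasso_estimation_error[OF K_props(5) _ _ Rc(1) K_props(3) Rc(2) correlation_dist correlation_diag l min supp' small']
  have F: "sqrt (frob_sq (Kh - K)) \<le> 6 * l * sqrt (C * s) * (C\<^sup>2)\<^sup>2" and O: "off_l1 (Kh - K) \<le> 24 * l * (C * s) * (C\<^sup>2)\<^sup>2"
    using est C_pos by auto
  have "6 * l * sqrt (C * s) * (C\<^sup>2)\<^sup>2 \<le> 6 * l * (C * sqrt s) * (C\<^sup>2)\<^sup>2"
    using sq l by (intro mult_right_mono mult_left_mono) auto
  also have "\<dots> = 6 * C ^ 5 * l * sqrt s" by (simp add: eval_nat_numeral mult_ac)
  finally show F': "sqrt (frob_sq (Kh - K)) \<le> 6 * C ^ 5 * l * sqrt s" using F by linarith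
  fix i assume i: "i < n"
  have c: "Kh - K \<in> carrier_mat n n" by (rule minus_carrier_mat[OF K_props(1)])
  have "6 * C ^ 5 * l * sqrt s \<le> 6 * C ^ 5 * l * s" using s1 C_pos l by (intro mult_left_mono) auto
  moreover have eq: "24 * l * (C * s) * (C\<^sup>2)\<^sup>2 = 24 * C ^ 5 * l * s" by (simp add: eval_nat_numeral mult_ac)
  ultimately show "(\<Sum>j<n. \<bar>(Kh - K) $$ (i,j)\<bar>) \<le> \<rho>"
    using row_sum_le_frob_off_l1[OF c i] F' O[unfolded eq] unfolding \<rho>_def by linarith
qed

text \<open>Needed on the covariance scale, where the error of the estimated scaling multiplies
  \<open>K\<close> itself. At most \<open>C * s\<close> off-diagonal entries are nonzero, each
  bounded by \<open>C\<^sup>2\<close>, and the diagonal entry is absorbed by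
  \<open>s \<ge> 1\<close>.\<close>

lemma K_row_sum: 
  assumes i: "i < n"
  shows "(\<Sum>j<n. \<bar>K $$ (i,j)\<bar>) \<le> 2 * C ^ 3 * s"
proof -
  have e: "\<bar>K $$ (i,j)\<bar> \<le> C\<^sup>2" if "i < n" "j < n" for i j
    using spectrum_within_entry_le[OF K_props(5) _ that] C_pos by simp
  have "off_l1 K \<le> real (off_diag_support_size K) * C\<^sup>2" by (rule off_l1_le_support[OF K_props(1) e])
  also have "\<dots> \<le> C * s * C\<^sup>2" using supp K_props(6) by (intro mult_right_mono) auto
  finally have "off_l1 K \<le> C ^ 3 * s" by (simp add: eval_nat_numeral mult_ac)
  moreover have "C\<^sup>2 * 1 \<le> C ^ 3 * s" using C_pow(1)[of 2 3] s C_pos by (intro mult_mono) auto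
  ultimately show ?thesis using row_sum_le_frob_off_l1(1)[OF K_props(1) i] e[OF i i] by simp
qed

abbreviation "Kh \<equiv> K_hat S l"
abbreviation "\<Theta>h \<equiv> Theta_hat S l"

text \<open>\<open>132 = 120 + 12\<close>: the error \<open>\<rho>\<close> scaled by
  \<open>4 * C\<^sup>2\<close>, plus the scaling error \<open>6 * C ^ 4 * \<eta>\<close> times the
  row sum \<open>2 * C ^ 3 * s\<close>, with \<open>\<eta> \<le> l\<close>.\<close>

definition "\<kappa> = 132 * C ^ 7 * l * s"

lemma Theta_hat_props: "pos_def n \<Theta>h" "\<Theta>h \<in> carrier_mat n n" "transpose_mat \<Theta>h = \<Theta>h"
  using Theta_hat_is_arg_min(1)[OF S S_diag l] by (auto simp: pos_def_def)

lemma Theta_symmetric: "transpose_mat \<Theta> = \<Theta>"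
  using Theta_spectrum by (simp add: spectrum_within_def)

lemma symmetric_minus:
  assumes "A \<in> carrier_mat n n" "B \<in> carrier_mat n n" "transpose_mat A = A" "transpose_mat B = B"
  shows "transpose_mat (A - B) = (A - B :: real mat)"
  using assms transpose_minus[of A n n B] by simp

text \<open>The rescaled estimator \<open>K'\<close> is some minimizer of the correlation problem,
  and \<open>minimizer_error\<close> applies to every one of them. It remains to compare the
  estimated scalings \<open>a\<close> with the true scalings \<open>b\<close>.\<close>

lemma Theta_row_sum:
  assumes i: "i < n"
  shows "(\<Sum>j<n. \<bar>(\<Theta>h - \<Theta>) $$ (i,j)\<bar>) \<le> \<kappa>"
proof -
  define K' where "K' = scale_mat n (\<lambda>i. sqrt (S $$ (i,i))) \<Theta>h"
  have K'c: "K' \<in> carrier_mat n n" using Theta_hat_props by (simp add: K'_def)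
  have "is_arg_min (glasso_objective (correlation S) l) (pos_def n) K'"
    using Theta_hat_is_arg_min(2)[OF S S_diag l] by (simp add: K'_def)
  note err = minimizer_error(2)[OF this i]
  have e1: "\<Theta>h $$ (i,j) = a i * a j * K' $$ (i,j)" if "j < n" for j
    using Theta_hat_props(2) i that S_diag[OF i] S_diag[OF that] by (simp add: K'_def a_def)
  have e2: "\<Theta> $$ (i,j) = b i * b j * K $$ (i,j)" if "j < n" for j
    using Theta_inverse(1) i that sqrt_diag(1)[OF i] sqrt_diag(1)[OF that] by (simp add: K_def b_def)
  have "(\<Sum>j<n. \<bar>(\<Theta>h - \<Theta>) $$ (i,j)\<bar>) \<le> (\<Sum>j<n. 4 * C\<^sup>2 * \<bar>(K' - K) $$ (i,j)\<bar> + 6 * C ^ 4 * \<eta> * \<bar>K $$ (i,j)\<bar>)"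
  proof (rule sum_mono)
    fix j assume "j \<in> {..<n}"
    hence j: "j < n" by simp
    \<comment> \<open>The estimated scaling goes with the error and the scaling error with the
      sparse target, so the row sums of \<open>K'\<close> itself never have to be bounded.\<close>
    have "(\<Theta>h - \<Theta>) $$ (i,j) = (a i * a j) * ((K' - K) $$ (i,j)) + (a i * a j - b i * b j) * K $$ (i,j)"
      using e1[OF j] e2[OF j] i j Theta_inverse(1) K_props(1) by (simp add: algebra_simps)
    also have "\<bar>\<dots>\<bar> \<le> 4 * C\<^sup>2 * \<bar>(K' - K) $$ (i,j)\<bar> + 6 * C ^ 4 * \<eta> * \<bar>K $$ (i,j)\<bar>"
      using ab_product[OF i j]
      by (intro order_trans[OF abs_triangle_ineq] add_mono) (auto simp only: abs_mult[of "a i * a j"] abs_mult[of "a i * a j - b i * b j"] intro!: mult_right_mono abs_ge_zero)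
    finally show "\<bar>(\<Theta>h - \<Theta>) $$ (i,j)\<bar> \<le> 4 * C\<^sup>2 * \<bar>(K' - K) $$ (i,j)\<bar> + 6 * C ^ 4 * \<eta> * \<bar>K $$ (i,j)\<bar>" .
  qed
  also have "\<dots> = 4 * C\<^sup>2 * (\<Sum>j<n. \<bar>(K' - K) $$ (i,j)\<bar>) + 6 * C ^ 4 * \<eta> * (\<Sum>j<n. \<bar>K $$ (i,j)\<bar>)"
    by (simp only: sum.distrib sum_distrib_left)
  also have "\<dots> \<le> 4 * C\<^sup>2 * \<rho> + 6 * C ^ 4 * \<eta> * (2 * C ^ 3 * s)"
    using err K_row_sum[OF i] C_pos eta_bounds(1) by (intro add_mono mult_left_mono) auto
  also have "\<dots> = 120 * C ^ 7 * l * s + 12 * C ^ 7 * \<eta> * s" by (simp add: \<rho>_def eval_nat_numeral mult_ac)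
  also have "\<dots> \<le> 120 * C ^ 7 * l * s + 12 * C ^ 7 * l * s"
  proof -
    have "\<eta> * 1 \<le> \<eta> * (300 * C ^ 8)" using eta_bounds(1) C_pow(2)[of 8] by (intro mult_left_mono) auto
    hence "\<eta> \<le> l" using eta_bounds(2) by simp
    thus ?thesis using C_pos s by (intro add_left_mono mult_right_mono mult_left_mono) auto
  qed
  finally show ?thesis unfolding \<kappa>_def by linarith
qed

lemma K_hat_frobenius: "mat_lw_norm 2 (Kh - minv (correlation Sg)) \<le> 300 * C ^ 9 * (l * sqrt s)"
proof -
  have "mat_lw_norm 2 (Kh - minv (correlation Sg)) \<le> 6 * C ^ 5 * l * sqrt s"
    unfolding mat_lw_norm_2 K_props(4) by (rule minimizer_error(1)[OF K_hat_is_arg_min[OF S S_diag l]])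
  also have "\<dots> \<le> 300 * C ^ 9 * (l * sqrt s)"
    using const_bound[of 6 5 "l * sqrt s"] l s by (simp only: mult.assoc) simp
  finally show ?thesis .
qed

lemma K_hat_op_norm:
  assumes w: "w \<ge> 1"
  shows "\<bar>mat_op_norm w (Kh - minv (correlation Sg))\<bar> \<le> 300 * C ^ 9 * (l * s)"
proof -
  have Kh: "is_arg_min (glasso_objective (correlation S) l) (pos_def n) Kh" by (rule K_hat_is_arg_min[OF S S_diag l])
  hence Khc: "Kh \<in> carrier_mat n n" "transpose_mat Kh = Kh" by (auto simp: is_arg_min_def pos_def_def)
  have Ks: "transpose_mat K = K" using K_props(5) by (simp add: spectrum_within_def)
  have "\<bar>mat_op_norm w (Kh - minv (correlation Sg))\<bar> \<le> \<rho>"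
    unfolding K_props(4)
    by (rule abs_mat_op_norm_le_row_sum[OF minus_carrier_mat[OF K_props(1)] symmetric_minus[OF Khc(1) K_props(1) Khc(2) Ks] n w
        minimizer_error(2)[OF Kh]])
  also have "\<rho> \<le> 300 * C ^ 9 * (l * s)"
    unfolding \<rho>_def using const_bound[of 30 5 "l * s"] l s by (simp only: mult.assoc) simp
  finally show ?thesis .
qed

lemma Theta_hat_op_norm:
  assumes w: "w \<ge> 1"
  shows "\<bar>mat_op_norm w (\<Theta>h - minv Sg)\<bar> \<le> 300 * C ^ 9 * (l * s)"
proof -
  have "\<bar>mat_op_norm w (\<Theta>h - minv Sg)\<bar> \<le> \<kappa>"
    by (rule abs_mat_op_norm_le_row_sum[OF minus_carrier_mat[OF Theta_inverse(1)] symmetric_minus[OF Theta_hat_props(2) Theta_inverse(1) Theta_hat_props(3) Theta_symmetric] n w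
        Theta_row_sum])
  also have "\<kappa> \<le> 300 * C ^ 9 * (l * s)"
    unfolding \<kappa>_def using const_bound[of 132 7 "l * s"] l s by (simp only: mult.assoc) simp
  finally show ?thesis .
qed

text \<open>The difference factors as \<open>minv \<Theta>h * (\<Theta> - \<Theta>h) * Sg\<close>,
  with Euclidean operator norms at most \<open>2 * C\<close>, \<open>\<kappa>\<close> and
  \<open>C\<close>. The first bound holds because a perturbation of size \<open>\<kappa>\<close>
  leaves the eigenvalues of \<open>\<Theta>h\<close> above \<open>1 / (2 * C)\<close>.\<close>

lemma inverse_Theta_hat_op_norm: "\<bar>mat_op_norm 2 (minv \<Theta>h - Sg)\<bar> \<le> 300 * C ^ 9 * (l * s)"
proof -
  define D where "D = \<Theta>h - \<Theta>"
  have Dc: "D \<in> carrier_mat n n" unfolding D_def by (rule minus_carrier_mat[OF Theta_inverse(1)])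
  have D: "spectrum_within n (- \<kappa>) \<kappa> D"
    by (rule row_sum_spectrum_within[OF Dc]) 
      (use symmetric_minus[OF Theta_hat_props(2) Theta_inverse(1) Theta_hat_props(3) Theta_symmetric] Theta_row_sum in \<open>auto simp: D_def simp del: index_minus_mat\<close>)
  have \<kappa>0: "\<kappa> \<ge> 0" using C_pos l s by (simp add: \<kappa>_def)
  \<comment> \<open>\<open>264 = 2 * 132\<close>; this condition determines the power and the size
    of the tolerance \<open>300 * C ^ 8\<close>.\<close>
  have "\<kappa> * (2 * C) = s * l * (264 * C ^ 8)" by (simp add: \<kappa>_def eval_nat_numeral mult_ac)
  also have "\<dots> \<le> s * l * (300 * C ^ 8)" using s_l_bounds(2) C_pos by (intro mult_left_mono) auto
  finally have "\<kappa> * (2 * C) \<le> 1" using s_l_bounds(1) by linarith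
  hence \<kappa>: "1 / (2 * C) \<le> 1 / C - \<kappa>" using C_pos by (simp add: field_simps)
  have "spectrum_within n (1 / (2 * C)) (C + \<kappa>) \<Theta>h"
    unfolding spectrum_within_def
  proof (intro conjI ballI Theta_hat_props(2,3))
    fix x :: "real Matrix.vec" assume x: "x \<in> carrier_vec n"
    have xx: "x \<bullet> x \<ge> 0" by (simp add: scalar_prod_self_eq_sum[OF x] sum_nonneg)
    have "x \<bullet> (\<Theta>h *\<^sub>v x) = x \<bullet> (\<Theta> *\<^sub>v x) + x \<bullet> (D *\<^sub>v x)"
      unfolding quadratic_form_eq_sum[OF Theta_hat_props(2) x] quadratic_form_eq_sum[OF Theta_inverse(1) x] quadratic_form_eq_sum[OF Dc x] sum.distrib[symmetric]
      using Theta_inverse(1) by (intro sum.cong refl) (auto simp: D_def algebra_simps)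
    moreover have "1 / C * (x \<bullet> x) \<le> x \<bullet> (\<Theta> *\<^sub>v x)" "x \<bullet> (\<Theta> *\<^sub>v x) \<le> C * (x \<bullet> x)"
      "- \<kappa> * (x \<bullet> x) \<le> x \<bullet> (D *\<^sub>v x)" "x \<bullet> (D *\<^sub>v x) \<le> \<kappa> * (x \<bullet> x)"
      using Theta_spectrum D x by (auto simp: spectrum_within_def)
    moreover note mult_right_mono[OF \<kappa> xx]
    ultimately show "1 / (2 * C) * (x \<bullet> x) \<le> x \<bullet> (\<Theta>h *\<^sub>v x)" "x \<bullet> (\<Theta>h *\<^sub>v x) \<le> (C + \<kappa>) * (x \<bullet> x)"
      unfolding left_diff_distrib distrib_right by linarith+
  qed
  note inv = minv_pos_def[OF Theta_hat_props(1)]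
  have "spectrum_within n (1 / (C + \<kappa>)) (1 / (1 / (2 * C))) (minv \<Theta>h)"
    by (rule spectrum_within_inverse[OF \<open>spectrum_within n (1 / (2 * C)) (C + \<kappa>) \<Theta>h\<close> _ inv(1,2)]) (use C_pos in auto)
  hence Si: "spectrum_within n (1 / (C + \<kappa>)) (2 * C) (minv \<Theta>h)" by simp
  have factor: "minv \<Theta>h - Sg = minv \<Theta>h * ((\<Theta> - \<Theta>h) * Sg)"
  proof -
    have "minv \<Theta>h * ((\<Theta> - \<Theta>h) * Sg) = minv \<Theta>h * (1\<^sub>m n - \<Theta>h * Sg)"
      using Theta_inverse Theta_hat_props(2) Sg_carrier by (simp add: minus_mult_distrib_mat[of _ n n _ _ n])
    also have "\<dots> = minv \<Theta>h - minv \<Theta>h * (\<Theta>h * Sg)"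
      using inv Theta_hat_props(2) Sg_carrier by (simp add: mult_minus_distrib_mat[of _ n n _ n] mult_carrier_mat[of _ n n _ n] right_mult_one_mat[of _ n n])
    also have "minv \<Theta>h * (\<Theta>h * Sg) = Sg"
      using inv Theta_hat_props(2) Sg_carrier by (simp add: assoc_mult_mat[symmetric, of _ n n _ n _ n])
    finally show ?thesis by simp
  qed
  have D': "\<Theta> - \<Theta>h \<in> carrier_mat n n" by (rule minus_carrier_mat[OF Theta_hat_props(2)])
  have D's: "spectrum_within n (- \<kappa>) \<kappa> (\<Theta> - \<Theta>h)"
  proof (rule row_sum_spectrum_within[OF D' symmetric_minus[OF Theta_inverse(1) Theta_hat_props(2) Theta_symmetric Theta_hat_props(3)]])
    fix i assume i: "i < n"
    have "(\<Sum>j<n. \<bar>(\<Theta> - \<Theta>h) $$ (i,j)\<bar>) = (\<Sum>j<n. \<bar>(\<Theta>h - \<Theta>) $$ (i,j)\<bar>)"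
      using i Theta_inverse(1) Theta_hat_props(2) by (intro sum.cong refl) (auto simp: abs_minus_commute)
    thus "(\<Sum>j<n. \<bar>(\<Theta> - \<Theta>h) $$ (i,j)\<bar>) \<le> \<kappa>" using Theta_row_sum[OF i] by simp
  qed
  have "vec_lw_norm 2 ((minv \<Theta>h - Sg) *\<^sub>v x) \<le> 2 * C * (\<kappa> * C)"
    if x: "x \<in> carrier_vec n" and x1: "vec_lw_norm 2 x = 1" for x
  proof -
    have xx: "x \<bullet> x = 1" using x1 unfolding vec_lw_norm_2[OF x] by simp
    define y where "y = Sg *\<^sub>v x"
    define z where "z = (\<Theta> - \<Theta>h) *\<^sub>v y"
    have y: "y \<in> carrier_vec n" using Sg_carrier x by (simp add: y_def)
    have z: "z \<in> carrier_vec n" using D' y unfolding z_def by (metis mult_mat_vec_carrier)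
    have e: "(minv \<Theta>h - Sg) *\<^sub>v x = minv \<Theta>h *\<^sub>v z"
      unfolding factor z_def y_def using inv(1) D' Sg_carrier x
      by (simp add: assoc_mult_mat_vec[of _ n n _ n] mult_carrier_mat[of _ n n _ n])
    have "y \<bullet> y \<le> C\<^sup>2 * 1"
      using spectrum_within_mult_vec[OF Sg _ x] C_pos unfolding y_def xx by simp
    moreover have "z \<bullet> z \<le> \<kappa>\<^sup>2 * (y \<bullet> y)"
      using spectrum_within_mult_vec[OF D's _ y] unfolding z_def by simp
    moreover have "(minv \<Theta>h *\<^sub>v z) \<bullet> (minv \<Theta>h *\<^sub>v z) \<le> (2 * C)\<^sup>2 * (z \<bullet> z)"
    proof (rule spectrum_within_mult_vec[OF Si _ z])
      have "0 \<le> 1 / (C + \<kappa>)" using C_pos \<kappa>0 by simp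
      thus "- (2 * C) \<le> 1 / (C + \<kappa>)" using C_pos by linarith
    qed
    ultimately have "(minv \<Theta>h *\<^sub>v z) \<bullet> (minv \<Theta>h *\<^sub>v z) \<le> (2 * C)\<^sup>2 * (\<kappa>\<^sup>2 * C\<^sup>2)"
      by (smt (verit) mult.right_neutral mult_left_mono zero_le_power2)
    also have "\<dots> = (2 * C * (\<kappa> * C))\<^sup>2" by (simp add: power_mult_distrib)
    finally have "sqrt ((minv \<Theta>h *\<^sub>v z) \<bullet> (minv \<Theta>h *\<^sub>v z)) \<le> 2 * C * (\<kappa> * C)"
      using C_pos \<kappa>0 by (intro real_le_lsqrt) (auto simp: scalar_prod_self_eq_sum[of _ n] inv z sum_nonneg)
    thus ?thesis unfolding e using inv z by (subst vec_lw_norm_2[of _ n]) auto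
  qed
  hence "\<bar>mat_op_norm 2 (minv \<Theta>h - Sg)\<bar> \<le> 2 * C * (\<kappa> * C)"
    by (intro abs_mat_op_norm_le[OF minus_carrier_mat[OF Sg_carrier] n]) auto
  also have "\<dots> = 264 * C ^ 9 * (l * s)" by (simp add: \<kappa>_def eval_nat_numeral mult_ac)
  also have "\<dots> \<le> 300 * C ^ 9 * (l * s)" using C_pos l s by (intro mult_right_mono) auto
  finally show ?thesis .
qed

end

section \<open>Convergence in probability\<close>

text \<open>Both sets have measurable covers of the same outer measure, and subadditivity is applied
  to the covers.\<close>

lemma outer_measure_of_Un_le:
  assumes "A \<subseteq> space M" "B \<subseteq> space M"
  shows "outer_measure_of M (A \<union> B) \<le> outer_measure_of M A + outer_measure_of M B"
proof -
  obtain E where E: "E \<in> sets M" "A \<subseteq> E" "outer_measure_of M A = emeasure M E"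
    using outer_measure_of_attain[OF assms(1)] by blast
  obtain G where G: "G \<in> sets M" "B \<subseteq> G" "outer_measure_of M B = emeasure M G"
    using outer_measure_of_attain[OF assms(2)] by blast
  have "outer_measure_of M (A \<union> B) \<le> outer_measure_of M (E \<union> G)"
    using E G by (intro outer_measure_of_mono) auto
  also have "\<dots> = emeasure M (E \<union> G)" using E G by simp
  also have "\<dots> \<le> emeasure M E + emeasure M G" using E G by (intro emeasure_subadditive)
  finally show ?thesis using E G by simp
qed

lemma outer_measure_of_AE_compl:
  assumes "AE \<omega> in M. P \<omega>"
  shows "outer_measure_of M {\<omega> \<in> space M. \<not> P \<omega>} = 0"
proof -
  obtain N where N: "{\<omega> \<in> space M. \<not> P \<omega>} \<subseteq> N" "emeasure M N = 0" "N \<in> sets M"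
    using AE_E[OF assms] by blast
  have "outer_measure_of M {\<omega> \<in> space M. \<not> P \<omega>} \<le> outer_measure_of M N"
    using N by (intro outer_measure_of_mono)
  thus ?thesis using N by simp
qed

lemma tendsto_prob_0_add:
  assumes "tendsto_prob_0 M X" "tendsto_prob_0 M Y"
  shows "tendsto_prob_0 M (\<lambda>n \<omega>. X n \<omega> + Y n \<omega>)"
  unfolding tendsto_prob_0_def
proof (intro allI impI)
  fix \<epsilon> :: real assume \<epsilon>: "\<epsilon> > 0"
  let ?A = "\<lambda>n. {\<omega> \<in> space (M n). \<bar>X n \<omega>\<bar> > \<epsilon> / 2}" and ?B = "\<lambda>n. {\<omega> \<in> space (M n). \<bar>Y n \<omega>\<bar> > \<epsilon> / 2}"
  have lim: "(\<lambda>n. outer_measure_of (M n) (?A n) + outer_measure_of (M n) (?B n)) \<longlonglongrightarrow> 0 + 0"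
    using assms \<epsilon> unfolding tendsto_prob_0_def by (intro tendsto_add) (auto dest: spec[of _ "\<epsilon> / 2"])
  have le: "outer_measure_of (M n) {\<omega> \<in> space (M n). \<bar>X n \<omega> + Y n \<omega>\<bar> > \<epsilon>}
    \<le> outer_measure_of (M n) (?A n) + outer_measure_of (M n) (?B n)" for n
    by (rule order_trans[OF outer_measure_of_mono outer_measure_of_Un_le]) auto
  show "(\<lambda>n. outer_measure_of (M n) {\<omega> \<in> space (M n). \<bar>X n \<omega> + Y n \<omega>\<bar> > \<epsilon>}) \<longlonglongrightarrow> 0"
    by (rule tendsto_sandwich[OF _ _ tendsto_const lim[simplified]]) (use le in auto)
qed

lemma tendsto_prob_0_cmult:
  assumes "tendsto_prob_0 M X"
  shows "tendsto_prob_0 M (\<lambda>n \<omega>. c * X n \<omega>)"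
  unfolding tendsto_prob_0_def
proof (intro allI impI)
  fix \<epsilon> :: real assume \<epsilon>: "\<epsilon> > 0"
  define \<delta> where "\<delta> = \<epsilon> / (\<bar>c\<bar> + 1)"
  have \<delta>: "\<delta> > 0" using \<epsilon> by (simp add: \<delta>_def)
  have lim: "(\<lambda>n. outer_measure_of (M n) {\<omega> \<in> space (M n). \<bar>X n \<omega>\<bar> > \<delta>}) \<longlonglongrightarrow> 0"
    using assms \<delta> by (simp add: tendsto_prob_0_def)
  have "\<bar>x\<bar> > \<delta>" if "\<bar>c * x\<bar> > \<epsilon>" for x
  proof (rule ccontr)
    assume "\<not> \<bar>x\<bar> > \<delta>"
    hence "\<bar>c\<bar> * \<bar>x\<bar> \<le> (\<bar>c\<bar> + 1) * \<delta>" by (intro mult_mono) auto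
    also have "\<dots> = \<epsilon>" by (simp add: \<delta>_def)
    finally show False using that by (simp add: abs_mult)
  qed
  hence le: "outer_measure_of (M n) {\<omega> \<in> space (M n). \<bar>c * X n \<omega>\<bar> > \<epsilon>}
    \<le> outer_measure_of (M n) {\<omega> \<in> space (M n). \<bar>X n \<omega>\<bar> > \<delta>}" for n
    by (intro outer_measure_of_mono) auto
  show "(\<lambda>n. outer_measure_of (M n) {\<omega> \<in> space (M n). \<bar>c * X n \<omega>\<bar> > \<epsilon>}) \<longlonglongrightarrow> 0"
    by (rule tendsto_sandwich[OF _ _ tendsto_const lim]) (use le in auto)
qed

lemma tendsto_prob_0_sum:
  assumes "finite I" "\<And>i. i \<in> I \<Longrightarrow> tendsto_prob_0 M (X i)"
  shows "tendsto_prob_0 M (\<lambda>n \<omega>. \<Sum>i\<in>I. X i n \<omega>)"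
  using assms
proof (induction I rule: finite_induct)
  case empty
  thus ?case by (simp add: tendsto_prob_0_def outer_measure_of_eq)
next
  case (insert i I)
  thus ?case using tendsto_prob_0_add[of M "X i"] by simp
qed

text \<open>Where \<open>C \<omega> < - \<epsilon>\<close>, each nonnegative
  \<open>Q m \<omega>\<close> is more than \<open>\<epsilon>\<close> away. The fixed event on the
  left thus has outer measure below a null sequence, and measurability of \<open>C\<close> makes it
  a null set. A countable sequence of \<open>\<epsilon>\<close> finishes the argument.\<close>

lemma tendsto_prob_limit_nonneg:
  assumes lim: "tendsto_prob_0 (\<lambda>_. M) (\<lambda>m \<omega>. Q m \<omega> - C \<omega>)"
    and Q: "\<And>m \<omega>. \<omega> \<in> space M \<Longrightarrow> Q m \<omega> \<ge> 0" and C: "C \<in> borel_measurable M"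
  shows "AE \<omega> in M. C \<omega> \<ge> 0"
proof -
  have ae: "AE \<omega> in M. C \<omega> \<ge> - \<epsilon>" if \<epsilon>: "\<epsilon> > 0" for \<epsilon> :: real
  proof -
    have meas: "{\<omega> \<in> space M. \<not> C \<omega> \<ge> - \<epsilon>} \<in> sets M" using C by measurable
    have "outer_measure_of M {\<omega> \<in> space M. \<not> C \<omega> \<ge> - \<epsilon>}
      \<le> outer_measure_of M {\<omega> \<in> space M. \<bar>Q m \<omega> - C \<omega>\<bar> > \<epsilon>}" for m
    proof (intro outer_measure_of_mono subsetI)
      fix \<omega> assume "\<omega> \<in> {\<omega> \<in> space M. \<not> C \<omega> \<ge> - \<epsilon>}"
      thus "\<omega> \<in> {\<omega> \<in> space M. \<bar>Q m \<omega> - C \<omega>\<bar> > \<epsilon>}" using Q[of \<omega> m] by auto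
    qed
    moreover have "(\<lambda>m. outer_measure_of M {\<omega> \<in> space M. \<bar>Q m \<omega> - C \<omega>\<bar> > \<epsilon>}) \<longlonglongrightarrow> 0"
      using lim \<epsilon> by (simp add: tendsto_prob_0_def)
    ultimately have "outer_measure_of M {\<omega> \<in> space M. \<not> C \<omega> \<ge> - \<epsilon>} \<le> 0"
      by (intro LIMSEQ_le_const) auto
    hence "emeasure M {\<omega> \<in> space M. \<not> C \<omega> \<ge> - \<epsilon>} = 0" using meas by simp
    thus ?thesis using meas by (intro AE_I[of _ _ "{\<omega> \<in> space M. \<not> C \<omega> \<ge> - \<epsilon>}"]) auto
  qed
  have "AE \<omega> in M. \<forall>k :: nat. C \<omega> \<ge> - inverse (real (Suc k))"
    unfolding AE_all_countable using ae by simp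
  thus ?thesis
  proof (eventually_elim)
    fix \<omega> assume *: "\<forall>k :: nat. C \<omega> \<ge> - inverse (real (Suc k))"
    have "(\<lambda>k. - inverse (real (Suc k))) \<longlonglongrightarrow> - 0" by (intro tendsto_minus LIMSEQ_inverse_real_of_nat)
    thus "C \<omega> \<ge> 0" using * by (intro LIMSEQ_le_const2[of _ 0]) auto
  qed
qed

section \<open>Almost sure positive semidefiniteness of the quadratic covariation\<close>

definition uniform_partition :: "nat \<Rightarrow> nat \<Rightarrow> real" where
  "uniform_partition m i = real i / real (Suc m)"

lemma uniform_partition:
  "unit_partition (Suc m) (uniform_partition m)" "(\<lambda>m. mesh (Suc m) (uniform_partition m)) \<longlonglongrightarrow> 0"
proof -
  show "unit_partition (Suc m) (uniform_partition m)"
    by (simp add: unit_partition_def uniform_partition_def divide_strict_right_mono del: of_nat_Suc)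
  have "mesh (Suc m) (uniform_partition m) = inverse (real (Suc m))" for m
  proof -
    have "(\<lambda>i. uniform_partition m (Suc i) - uniform_partition m i) ` {..<Suc m} = {inverse (real (Suc m))}"
      by (auto simp: uniform_partition_def diff_divide_distrib[symmetric] inverse_eq_divide image_iff)
    thus ?thesis unfolding mesh_def by simp
  qed
  thus "(\<lambda>m. mesh (Suc m) (uniform_partition m)) \<longlonglongrightarrow> 0"
    using LIMSEQ_inverse_real_of_nat by simp
qed

text \<open>Almost sure statements are available for countably many vectors only, so the quadratic form is
  first considered at rational vectors.\<close>

lemma quadratic_form_nonneg_of_rationals:
  fixes A :: "nat \<Rightarrow> nat \<Rightarrow> real" and x :: "nat \<Rightarrow> real"
  assumes rat: "\<And>q :: rat list. 0 \<le> (\<Sum>i<d. \<Sum>j<d. A i j * of_rat (q ! i) * of_rat (q ! j))"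
  shows "0 \<le> (\<Sum>i<d. \<Sum>j<d. A i j * x i * x j)"
proof -
  have "\<exists>r :: rat. \<bar>of_rat r - x i\<bar> < inverse (real (Suc k))" for i k
  proof -
    obtain r where "x i < of_rat r" "of_rat r < x i + inverse (real (Suc k))"
      using of_rat_dense[of "x i" "x i + inverse (real (Suc k))"] by auto
    thus ?thesis by (intro exI[of _ r]) auto
  qed
  then obtain r :: "nat \<Rightarrow> nat \<Rightarrow> rat" where r: "\<And>i k. \<bar>of_rat (r i k) - x i\<bar> < inverse (real (Suc k))"
    by metis
  have lim: "(\<lambda>k. of_rat (r i k)) \<longlonglongrightarrow> x i" for i
  proof (rule LIMSEQ_I)
    fix e :: real assume "e > 0"
    then obtain N where N: "inverse (real (Suc N)) < e" using reals_Archimedean by blast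
    have "norm (of_rat (r i k) - x i) < e" if "k \<ge> N" for k
    proof -
      have "inverse (real (Suc k)) \<le> inverse (real (Suc N))" using that by (intro le_imp_inverse_le) auto
      thus ?thesis using r[of i k] N unfolding real_norm_def by linarith
    qed
    thus "\<exists>N. \<forall>k\<ge>N. norm (of_rat (r i k) - x i) < e" by blast
  qed
  have "(\<lambda>k. \<Sum>i<d. \<Sum>j<d. A i j * of_rat (r i k) * of_rat (r j k)) \<longlonglongrightarrow> (\<Sum>i<d. \<Sum>j<d. A i j * x i * x j)"
    by (intro tendsto_sum tendsto_mult tendsto_const lim)
  moreover have "0 \<le> (\<Sum>i<d. \<Sum>j<d. A i j * of_rat (r i k) * of_rat (r j k))" for k
    using rat[of "map (\<lambda>i. r i k) [0..<d]"] by simp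
  ultimately show ?thesis by (intro LIMSEQ_le_const) auto
qed

text \<open>Realized covariation matrices are sums of outer products of increments, hence symmetric
  and positive semidefinite; both properties survive the limit in probability. Uniform partitions
  suffice as the approximating sequence.\<close>

lemma quadratic_covariation_pos_semidef:
  assumes A: "random_matrix M d A"
    and cov: "\<And>i j. i < d \<Longrightarrow> j < d \<Longrightarrow> quadratic_covariation M (Y i) (Y j) (\<lambda>\<omega>. A \<omega> $$ (i,j))"
  shows "AE \<omega> in M. pos_semidef d (A \<omega>)"
proof -
  define D where "D m i p \<omega> = Y i (uniform_partition m (Suc p)) \<omega> - Y i (uniform_partition m p) \<omega>" for m i p \<omega>
  define Q where "Q i j m \<omega> = (\<Sum>p<Suc m. D m i p \<omega> * D m j p \<omega>)" for i j m \<omega>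
  have meas: "(\<lambda>\<omega>. A \<omega> $$ (i,j)) \<in> borel_measurable M" if "i < d" "j < d" for i j
    using A that by (simp add: random_matrix_def)
  have lim: "tendsto_prob_0 (\<lambda>_. M) (\<lambda>m \<omega>. Q i j m \<omega> - A \<omega> $$ (i,j))" if "i < d" "j < d" for i j
    using cov[OF that] uniform_partition unfolding quadratic_covariation_def Q_def D_def
    by (auto dest!: spec[of _ Suc] spec[of _ uniform_partition])
  have symQ: "Q j i m \<omega> = Q i j m \<omega>" for i j m \<omega> by (simp add: Q_def mult.commute)
  \<comment> \<open>The realized covariations of \<open>(i,j)\<close> and \<open>(j,i)\<close>
    coincide, so the difference of their limits is a limit of zeros. Both index orders together give
    symmetry.\<close>
  have "AE \<omega> in M. A \<omega> $$ (i,j) - A \<omega> $$ (j,i) \<ge> 0" if ij: "i < d" "j < d" for i j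
  proof (rule tendsto_prob_limit_nonneg[where Q = "\<lambda>_ _. 0"])
    have "tendsto_prob_0 (\<lambda>_. M) (\<lambda>m \<omega>. (Q i j m \<omega> - A \<omega> $$ (i,j)) + (-1) * (Q j i m \<omega> - A \<omega> $$ (j,i)))"
      by (rule tendsto_prob_0_add[OF lim[OF ij] tendsto_prob_0_cmult[OF lim[OF ij(2,1)]]])
    thus "tendsto_prob_0 (\<lambda>_. M) (\<lambda>m \<omega>. 0 - (A \<omega> $$ (i,j) - A \<omega> $$ (j,i)))"
      by (simp add: symQ)
  qed (use meas[OF ij] meas[OF ij(2,1)] in auto)
  hence "AE \<omega> in M. \<forall>i\<in>{..<d}. \<forall>j\<in>{..<d}. A \<omega> $$ (i,j) - A \<omega> $$ (j,i) \<ge> 0"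
    by (intro AE_finite_allI) auto
  moreover have "AE \<omega> in M. \<forall>q :: rat list. 0 \<le> (\<Sum>i<d. \<Sum>j<d. A \<omega> $$ (i,j) * of_rat (q ! i) * of_rat (q ! j))"
    unfolding AE_all_countable
  proof (intro allI)
    fix q :: "rat list"
    \<comment> \<open>Lists of rationals form a countable type. \<open>q ! i\<close> is unspecified
      beyond the length of \<open>q\<close>, which is harmless because the argument works for
      arbitrary reals \<open>x i\<close>.\<close>
    define x where "x i = (of_rat (q ! i) :: real)" for i
    have "AE \<omega> in M. 0 \<le> (\<Sum>i<d. \<Sum>j<d. A \<omega> $$ (i,j) * x i * x j)"
    proof (rule tendsto_prob_limit_nonneg[where Q = "\<lambda>m \<omega>. \<Sum>i<d. \<Sum>j<d. x i * x j * Q i j m \<omega>"])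
      have "tendsto_prob_0 (\<lambda>_. M) (\<lambda>m \<omega>. \<Sum>i<d. \<Sum>j<d. x i * x j * (Q i j m \<omega> - A \<omega> $$ (i,j)))"
        by (intro tendsto_prob_0_sum tendsto_prob_0_cmult lim) auto
      thus "tendsto_prob_0 (\<lambda>_. M) (\<lambda>m \<omega>. (\<Sum>i<d. \<Sum>j<d. x i * x j * Q i j m \<omega>) - (\<Sum>i<d. \<Sum>j<d. A \<omega> $$ (i,j) * x i * x j))"
        by (simp add: sum_subtractf[symmetric] algebra_simps)
      fix m \<omega>
      \<comment> \<open>The quadratic form of the realized covariation is the realized variance of
        the combination with coefficients \<open>x i\<close>.\<close>
      have "(\<Sum>i<d. \<Sum>j<d. x i * x j * Q i j m \<omega>) = (\<Sum>p<Suc m. (\<Sum>i<d. x i * D m i p \<omega>)\<^sup>2)"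
      proof -
        have "(\<Sum>i<d. \<Sum>j<d. x i * x j * Q i j m \<omega>) = (\<Sum>i<d. \<Sum>j<d. \<Sum>p<Suc m. (x i * D m i p \<omega>) * (x j * D m j p \<omega>))"
          unfolding Q_def sum_distrib_left by (intro sum.cong refl) (simp add: mult_ac)
        also have "\<dots> = (\<Sum>i<d. \<Sum>p<Suc m. \<Sum>j<d. (x i * D m i p \<omega>) * (x j * D m j p \<omega>))"
          by (intro sum.cong refl sum.swap)
        also have "\<dots> = (\<Sum>p<Suc m. \<Sum>i<d. \<Sum>j<d. (x i * D m i p \<omega>) * (x j * D m j p \<omega>))"
          by (rule sum.swap)
        finally show ?thesis by (simp only: power2_eq_square sum_product)
      qed
      thus "0 \<le> (\<Sum>i<d. \<Sum>j<d. x i * x j * Q i j m \<omega>)" by (simp only: sum_nonneg zero_le_power2)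
    next
      show "(\<lambda>\<omega>. \<Sum>i<d. \<Sum>j<d. A \<omega> $$ (i,j) * x i * x j) \<in> borel_measurable M"
        by (intro borel_measurable_sum borel_measurable_times meas borel_measurable_const) auto
    qed
    thus "AE \<omega> in M. 0 \<le> (\<Sum>i<d. \<Sum>j<d. A \<omega> $$ (i,j) * of_rat (q ! i) * of_rat (q ! j))"
      by (simp add: x_def)
  qed
  ultimately show ?thesis using AE_space
  proof eventually_elim
    case (elim \<omega>)
    have c: "A \<omega> \<in> carrier_mat d d" using A elim by (simp add: random_matrix_def)
    have "A \<omega> $$ (j,i) = A \<omega> $$ (i,j)" if "i < d" "j < d" for i j
      using elim(1) that by (meson diff_ge_0_iff_ge lessThan_iff order_antisym)
    hence "transpose_mat (A \<omega>) = A \<omega>" using c by (intro eq_matI) auto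
    moreover have "x \<bullet> (A \<omega> *\<^sub>v x) \<ge> 0" if "x \<in> carrier_vec d" for x
      unfolding quadratic_form_eq_sum[OF c that]
      by (rule quadratic_form_nonneg_of_rationals) (use elim(2) in auto)
    ultimately show ?case using c by (simp add: pos_semidef_def)
  qed
qed

theorem proposition2p1:
  fixes M :: "nat \<Rightarrow> 'a measure"
    and F :: "nat \<Rightarrow> real \<Rightarrow> 'a measure"
    and d :: "nat \<Rightarrow> nat"
    and Y :: "nat \<Rightarrow> nat \<Rightarrow> real \<Rightarrow> 'a \<Rightarrow> real"
    and \<Sigma>\<^sub>Y :: "nat \<Rightarrow> 'a \<Rightarrow> real mat"
    and \<Sigma>hat :: "nat \<Rightarrow> 'a \<Rightarrow> real mat"
    and s :: "nat \<Rightarrow> real"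
    and lam :: "nat \<Rightarrow> 'a \<Rightarrow> real"
  assumes basis: "\<And>n. stochastic_basis (M n) (F n)"
    and dim: "\<And>n. d n \<ge> 2"
    and semimart: "\<And>n i. i < d n \<Longrightarrow> semimartingale (M n) (F n) (Y n i)"
    and Sigma_Y_rv: "\<And>n. random_matrix (M n) (d n) (\<Sigma>\<^sub>Y n)"
    and Sigma_Y: "\<And>n i j. i < d n \<Longrightarrow> j < d n \<Longrightarrow>
          quadratic_covariation (M n) (Y n i) (Y n j) (\<lambda>\<omega>. \<Sigma>\<^sub>Y n \<omega> $$ (i,j))"
    and Sigma_Y_inv: "\<And>n. AE \<omega> in M n. invertible_mat (\<Sigma>\<^sub>Y n \<omega>)"
    and Sigma_hat_rv: "\<And>n. random_matrix (M n) (d n) (\<Sigma>hat n)"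
    and Sigma_hat_psd: "\<And>n \<omega>. \<omega> \<in> space (M n) \<Longrightarrow> pos_semidef (d n) (\<Sigma>hat n \<omega>)"
    and Sigma_hat_diag: "\<And>n. AE \<omega> in M n. \<forall>i<d n. \<Sigma>hat n \<omega> $$ (i,i) > 0"
    and eig_bdd: "big_O_prob M (\<lambda>n \<omega>. eig_max (\<Sigma>\<^sub>Y n \<omega>) + 1 / eig_min (\<Sigma>\<^sub>Y n \<omega>)) (\<lambda>n. 1)"
    and s_ge_1: "\<And>n. s n \<ge> 1"
    and sparse: "big_O_prob M (\<lambda>n \<omega>. real (off_diag_support_size (minv (\<Sigma>\<^sub>Y n \<omega>)))) s"
    and lambda_rv: "\<And>n. lam n \<in> borel_measurable (M n)"
    and lambda_pos: "\<And>n \<omega>. \<omega> \<in> space (M n) \<Longrightarrow> lam n \<omega> > 0"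
    and lambda_dominates:
      "tendsto_prob_0 M (\<lambda>n \<omega>. inverse (lam n \<omega>) * mat_lw_norm \<infinity> (\<Sigma>hat n \<omega> - \<Sigma>\<^sub>Y n \<omega>))"
    and s_lambda: "tendsto_prob_0 M (\<lambda>n \<omega>. s n * lam n \<omega>)"
  shows
    "big_O_prob M (\<lambda>n \<omega>. inverse (lam n \<omega>) *
        mat_lw_norm 2 (K_hat (\<Sigma>hat n \<omega>) (lam n \<omega>) - minv (correlation (\<Sigma>\<^sub>Y n \<omega>)))) (\<lambda>n. sqrt (s n)) \<and>
     (\<forall>w\<ge>1. big_O_prob M (\<lambda>n \<omega>. inverse (lam n \<omega>) *
        mat_op_norm w (K_hat (\<Sigma>hat n \<omega>) (lam n \<omega>) - minv (correlation (\<Sigma>\<^sub>Y n \<omega>)))) s) \<and>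
     (\<forall>w\<ge>1. big_O_prob M (\<lambda>n \<omega>. inverse (lam n \<omega>) *
        mat_op_norm w (Theta_hat (\<Sigma>hat n \<omega>) (lam n \<omega>) - minv (\<Sigma>\<^sub>Y n \<omega>))) s) \<and>
     big_O_prob M (\<lambda>n \<omega>. inverse (lam n \<omega>) *
        mat_op_norm 2 (minv (Theta_hat (\<Sigma>hat n \<omega>) (lam n \<omega>)) - \<Sigma>\<^sub>Y n \<omega>)) s"
proof -
  \<comment> \<open>All probability is concentrated in this event; the claims hold pointwise on it,
    with constants depending on \<open>C\<close> only.\<close>
  define good where "good C n \<omega> \<longleftrightarrow> glasso_sample (d n) (\<Sigma>\<^sub>Y n \<omega>) (\<Sigma>hat n \<omega>) (lam n \<omega>) (s n) C" for C n \<omega>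
  have likely: "\<exists>C\<ge>1. \<forall>\<^sub>F n in sequentially.
      outer_measure_of (M n) {\<omega> \<in> space (M n). \<not> good C n \<omega>} \<le> ennreal \<epsilon>" if \<epsilon>: "\<epsilon> > 0" for \<epsilon>
  proof -
    \<comment> \<open>Four exceptional events share the probability \<open>\<epsilon>\<close>:
      spectrum, sparsity, estimation error and penalty. The almost sure properties fail only on the
      null set \<open>N\<close>.\<close>
    have \<epsilon>4: "\<epsilon> / 4 > 0" using \<epsilon> by simp
    define E where "E c n = {\<omega> \<in> space (M n). \<bar>eig_max (\<Sigma>\<^sub>Y n \<omega>) + 1 / eig_min (\<Sigma>\<^sub>Y n \<omega>)\<bar> > c * 1}" for c n
    define B where "B c n = {\<omega> \<in> space (M n). \<bar>real (off_diag_support_size (minv (\<Sigma>\<^sub>Y n \<omega>)))\<bar> > c * s n}" for c n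
    obtain c1 where c1: "\<forall>\<^sub>F n in sequentially. outer_measure_of (M n) (E c1 n) \<le> ennreal (\<epsilon> / 4)"
      using eig_bdd \<epsilon>4 unfolding big_O_prob_def E_def by blast
    obtain c2 where c2: "\<forall>\<^sub>F n in sequentially. outer_measure_of (M n) (B c2 n) \<le> ennreal (\<epsilon> / 4)"
      using sparse \<epsilon>4 unfolding big_O_prob_def B_def by blast
    \<comment> \<open>The order matters: the bounds in probability first fix \<open>C\<close>, and
      the convergence hypotheses are then used at the level \<open>e\<close>, which depends on
      \<open>C\<close>.\<close>
    define C where "C = max 1 (max c1 c2)"
    have C: "C \<ge> 1" "C \<ge> c1" "C \<ge> c2" by (auto simp: C_def)
    define e where "e = 1 / (300 * C ^ 8)"
    have e: "e > 0" using C(1) by (simp add: e_def)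
    define G where "G n = {\<omega> \<in> space (M n). \<bar>inverse (lam n \<omega>) * mat_lw_norm \<infinity> (\<Sigma>hat n \<omega> - \<Sigma>\<^sub>Y n \<omega>)\<bar> > e}" for n
    define H where "H n = {\<omega> \<in> space (M n). \<bar>s n * lam n \<omega>\<bar> > e}" for n
    have small: "\<forall>\<^sub>F n in sequentially. outer_measure_of (M n) (X n) \<le> ennreal (\<epsilon> / 4)"
      if "(\<lambda>n. outer_measure_of (M n) (X n)) \<longlonglongrightarrow> 0" for X
      using order_tendstoD(2)[OF that, of "ennreal (\<epsilon> / 4)"] \<epsilon> by (auto elim: eventually_mono simp: less_imp_le)
    have G: "\<forall>\<^sub>F n in sequentially. outer_measure_of (M n) (G n) \<le> ennreal (\<epsilon> / 4)"
      by (rule small) (use lambda_dominates e in \<open>simp add: tendsto_prob_0_def G_def\<close>)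
    have H: "\<forall>\<^sub>F n in sequentially. outer_measure_of (M n) (H n) \<le> ennreal (\<epsilon> / 4)"
      by (rule small) (use s_lambda e in \<open>simp add: tendsto_prob_0_def H_def\<close>)
    define P where "P n \<omega> \<longleftrightarrow> pos_semidef (d n) (\<Sigma>\<^sub>Y n \<omega>) \<and> invertible_mat (\<Sigma>\<^sub>Y n \<omega>) \<and>
      (\<forall>i<d n. \<Sigma>hat n \<omega> $$ (i,i) > 0)" for n \<omega>
    have P: "AE \<omega> in M n. P n \<omega>" for n
      unfolding P_def using quadratic_covariation_pos_semidef[OF Sigma_Y_rv Sigma_Y] Sigma_Y_inv Sigma_hat_diag by auto
    define N where "N n = {\<omega> \<in> space (M n). \<not> P n \<omega>}" for n
    have N: "outer_measure_of (M n) (N n) = 0" for n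
      unfolding N_def by (rule outer_measure_of_AE_compl[OF P])
    have sub: "{\<omega> \<in> space (M n). \<not> good C n \<omega>} \<subseteq> N n \<union> (E c1 n \<union> (B c2 n \<union> (G n \<union> H n)))" for n
    proof
      fix \<omega> assume \<omega>: "\<omega> \<in> {\<omega> \<in> space (M n). \<not> good C n \<omega>}"
      hence sp: "\<omega> \<in> space (M n)" by simp
      have d0: "d n > 0" using dim[of n] by simp
      have "good C n \<omega>" if not: "\<omega> \<notin> N n" "\<omega> \<notin> E c1 n" "\<omega> \<notin> B c2 n" "\<omega> \<notin> G n" "\<omega> \<notin> H n"
        unfolding good_def
      proof
        have p: "pos_semidef (d n) (\<Sigma>\<^sub>Y n \<omega>)" "invertible_mat (\<Sigma>\<^sub>Y n \<omega>)" "\<And>i. i < d n \<Longrightarrow> \<Sigma>hat n \<omega> $$ (i,i) > 0"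
          using not(1) sp by (auto simp: N_def P_def)
        show "d n > 0" "C \<ge> 1" "s n \<ge> 1" "lam n \<omega> > 0" using d0 C s_ge_1 lambda_pos[OF sp] by auto
        show "pos_semidef (d n) (\<Sigma>hat n \<omega>)" by (rule Sigma_hat_psd[OF sp])
        show "\<Sigma>hat n \<omega> $$ (i,i) > 0" if "i < d n" for i by (rule p(3)[OF that])
        show "spectrum_within (d n) (1 / C) C (\<Sigma>\<^sub>Y n \<omega>)"
          by (rule pos_semidef_invertible_spectrum_within[OF p(1,2) d0]) (use not(2) sp C in \<open>auto simp: E_def\<close>)
        have "real (off_diag_support_size (minv (\<Sigma>\<^sub>Y n \<omega>))) \<le> c2 * s n"
          using not(3) sp by (auto simp: B_def)
        also have "\<dots> \<le> C * s n" using C s_ge_1[of n] by (intro mult_right_mono) auto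
        finally show "real (off_diag_support_size (minv (\<Sigma>\<^sub>Y n \<omega>))) \<le> C * s n" .
        show "s n * lam n \<omega> \<le> 1 / (300 * C ^ 8)"
          using not(5) sp by (auto simp: H_def e_def)
        fix i j assume ij: "i < d n" "j < d n"
        have c: "\<Sigma>\<^sub>Y n \<omega> \<in> carrier_mat (d n) (d n)" "\<Sigma>hat n \<omega> \<in> carrier_mat (d n) (d n)"
          using p(1) Sigma_hat_psd[OF sp] by (auto simp: pos_semidef_def)
        have "inverse (lam n \<omega>) * mat_lw_norm \<infinity> (\<Sigma>hat n \<omega> - \<Sigma>\<^sub>Y n \<omega>) \<le> e"
          using not(4) sp by (auto simp: G_def)
        hence "mat_lw_norm \<infinity> (\<Sigma>hat n \<omega> - \<Sigma>\<^sub>Y n \<omega>) \<le> lam n \<omega> / (300 * C ^ 8)"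
          using lambda_pos[OF sp] by (simp add: e_def field_simps)
        thus "\<bar>\<Sigma>hat n \<omega> $$ (i,j) - \<Sigma>\<^sub>Y n \<omega> $$ (i,j)\<bar> \<le> lam n \<omega> / (300 * C ^ 8)"
          using mat_lw_norm_infinity_entry[OF minus_carrier_mat[OF c(1)] ij, of "\<Sigma>hat n \<omega>"] c ij by simp
      qed
      thus "\<omega> \<in> N n \<union> (E c1 n \<union> (B c2 n \<union> (G n \<union> H n)))" using \<omega> by blast
    qed
    have "\<forall>\<^sub>F n in sequentially. outer_measure_of (M n) {\<omega> \<in> space (M n). \<not> good C n \<omega>} \<le> ennreal \<epsilon>"
      using c1 c2 G H
    proof eventually_elim
      case (elim n)
      let ?\<mu> = "outer_measure_of (M n)"
      have sp: "N n \<subseteq> space (M n)" "E c1 n \<subseteq> space (M n)" "B c2 n \<subseteq> space (M n)" "G n \<subseteq> space (M n)" "H n \<subseteq> space (M n)"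
        by (auto simp: N_def E_def B_def G_def H_def)
      have "?\<mu> {\<omega> \<in> space (M n). \<not> good C n \<omega>} \<le> ?\<mu> (N n \<union> (E c1 n \<union> (B c2 n \<union> (G n \<union> H n))))"
        by (rule outer_measure_of_mono[OF sub])
      also have "\<dots> \<le> ?\<mu> (N n) + (?\<mu> (E c1 n) + (?\<mu> (B c2 n) + (?\<mu> (G n) + ?\<mu> (H n))))"
        using sp by (intro order_trans[OF outer_measure_of_Un_le] add_mono order_refl) auto
      also have "\<dots> \<le> 0 + (ennreal (\<epsilon> / 4) + (ennreal (\<epsilon> / 4) + (ennreal (\<epsilon> / 4) + ennreal (\<epsilon> / 4))))"
        using elim N by (intro add_mono) auto
      also have "\<dots> = ennreal \<epsilon>" using \<epsilon> by (simp add: ennreal_plus[symmetric] del: ennreal_plus)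
      finally show ?case .
    qed
    thus ?thesis using C(1) by blast
  qed
  \<comment> \<open>The event that the bound fails is contained in the complement of
    \<open>good\<close>, so monotonicity of the outer measure transfers the estimate.
    \<open>C\<close> depends on \<open>\<epsilon>\<close> but not on \<open>n\<close>, as a bound in
    probability requires.\<close>
  have bigO: "big_O_prob M X a" if bound: "\<And>C n \<omega>. \<omega> \<in> space (M n) \<Longrightarrow> good C n \<omega> \<Longrightarrow> \<bar>X n \<omega>\<bar> \<le> 300 * C ^ 9 * a n" for X a
    unfolding big_O_prob_def
  proof (intro allI impI)
    fix \<epsilon> :: real assume "\<epsilon> > 0"
    then obtain C where C: "C \<ge> 1" and ev: "\<forall>\<^sub>F n in sequentially.
      outer_measure_of (M n) {\<omega> \<in> space (M n). \<not> good C n \<omega>} \<le> ennreal \<epsilon>" using likely by blast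
    have "\<forall>\<^sub>F n in sequentially. outer_measure_of (M n) {\<omega> \<in> space (M n). \<bar>X n \<omega>\<bar> > 300 * C ^ 9 * a n} \<le> ennreal \<epsilon>"
      using ev
    proof eventually_elim
      case (elim n)
      have "{\<omega> \<in> space (M n). \<bar>X n \<omega>\<bar> > 300 * C ^ 9 * a n} \<subseteq> {\<omega> \<in> space (M n). \<not> good C n \<omega>}"
        using bound by (auto simp: not_less[symmetric])
      thus ?case using elim by (meson order_trans outer_measure_of_mono)
    qed
    moreover have "300 * C ^ 9 > 0" using C by simp
    ultimately show "\<exists>C>0. \<forall>\<^sub>F n in sequentially. outer_measure_of (M n) {\<omega> \<in> space (M n). \<bar>X n \<omega>\<bar> > C * a n} \<le> ennreal \<epsilon>"
      by blast
  qed
  have scaled: "\<bar>inverse (lam n \<omega>) * x\<bar> \<le> c * r" if "\<omega> \<in> space (M n)" "\<bar>x\<bar> \<le> c * (lam n \<omega> * r)" for n \<omega> x c r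
    using lambda_pos[OF that(1)] that(2) by (simp add: abs_mult field_simps)
  show ?thesis
  proof (intro conjI allI impI)
    show "big_O_prob M (\<lambda>n \<omega>. inverse (lam n \<omega>) *
        mat_lw_norm 2 (K_hat (\<Sigma>hat n \<omega>) (lam n \<omega>) - minv (correlation (\<Sigma>\<^sub>Y n \<omega>)))) (\<lambda>n. sqrt (s n))"
    proof (rule bigO, rule scaled, assumption)
      fix C n \<omega> assume "good C n \<omega>"
      from glasso_sample.K_hat_frobenius[OF this[unfolded good_def]]
      show "\<bar>mat_lw_norm 2 (K_hat (\<Sigma>hat n \<omega>) (lam n \<omega>) - minv (correlation (\<Sigma>\<^sub>Y n \<omega>)))\<bar> \<le> 300 * C ^ 9 * (lam n \<omega> * sqrt (s n))"
        unfolding mat_lw_norm_2 by (simp add: frob_sq_def sum_nonneg)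
    qed
    show "big_O_prob M (\<lambda>n \<omega>. inverse (lam n \<omega>) *
        mat_op_norm w (K_hat (\<Sigma>hat n \<omega>) (lam n \<omega>) - minv (correlation (\<Sigma>\<^sub>Y n \<omega>)))) s" if "w \<ge> 1" for w
      by (rule bigO, rule scaled, assumption) (rule glasso_sample.K_hat_op_norm[OF _ that], simp add: good_def)
    show "big_O_prob M (\<lambda>n \<omega>. inverse (lam n \<omega>) *
        mat_op_norm w (Theta_hat (\<Sigma>hat n \<omega>) (lam n \<omega>) - minv (\<Sigma>\<^sub>Y n \<omega>))) s" if "w \<ge> 1" for w
      by (rule bigO, rule scaled, assumption) (rule glasso_sample.Theta_hat_op_norm[OF _ that], simp add: good_def)
    show "big_O_prob M (\<lambda>n \<omega>. inverse (lam n \<omega>) *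
        mat_op_norm 2 (minv (Theta_hat (\<Sigma>hat n \<omega>) (lam n \<omega>)) - \<Sigma>\<^sub>Y n \<omega>)) s"
      by (rule bigO, rule scaled, assumption) (rule glasso_sample.inverse_Theta_hat_op_norm, simp add: good_def)
  qed
qed

end
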